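(* Let $0<\alpha<1$. The mean queue length $\mathcal{M}^\alpha(t)$ of the time-changed Erlang queue with multiple arrivals $\{\mathcal{Q}^\alpha(t)\}_{t\ge0}$ is given, for $t\ge0$, by $$\mathcal{M}^\alpha(t)=k\Big(\lambda\sum_{i=1}^{l}ic_i-\mu\Big)\frac{t^\alpha}{\Gamma(\alpha+1)}+k\mu\sum_{h=1}^{\infty}\sum_{n=0}^{\infty}\sum_{\substack{m_1+\dots+m_l=n\\ m_j\ge0}}C^0_{h,n}(\mathbf{m})\,t^{\beta^{\mathcal{M}}_{h,n}(\mathbf{m})-1}E^{\gamma^0_{h,n}(\mathbf{m})}_{\alpha,\beta^{\mathcal{M}}_{h,n}(\mathbf{m})}\big(-(\lambda+k\mu)t^\alpha\big),$$ where $\mathbf{m}=(m_1,\dots,m_l)$ and $\beta^{\mathcal{M}}_{h,n}(\mathbf{m})=\alpha\gamma^0_{h,n}(\mathbf{m})+1$.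
   Context: Let $k,l\ge 1$ be integers, $\mu>0$, $\lambda_1,\dots,\lambda_l>0$, $\lambda=\lambda_1+\dots+\lambda_l$ and $c_m=\lambda_m/\lambda$ for $1\le m\le l$. $\mathbb{N}_0=\{0,1,2,\dots\}$. The Erlang queue with multiple arrivals is the continuous-time Markov process $\mathcal{Q}(t)=(\mathcal{N}(t),\mathcal{S}(t))$, $t\ge 0$, on the state space $\mathcal{H}_0=\mathcal{H}\cup\{(0,0)\}$, $\mathcal{H}=\{(n,s)\in\mathbb{N}\times\mathbb{N}: n\ge 1,\ 1\le s\le k\}$, with $\mathcal{Q}(0)=(0,0)$. Here $\mathcal{N}(t)$ is the number of customers in a single-channel system and $\mathcal{S}(t)$ is the phase of the customer in service (each service starts in phase $k$, and the phases are counted down to $1$), with $\mathcal{S}(t)=0$ if $\mathcal{N}(t)=0$. Its nonzero transition rates (an event of rate $q$ has probability $qh+o(h)$ in an interval of length $h$) are, for $1\le m\le l$: (arrivals) $(0,0)\to(m,k)$ at rate $\lambda_m=\lambda c_m$, and $(n,s)\to(n+m,s)$ at rate $\lambda_m=\lambda c_m$ for $(n,s)\in\mathcal{H}$; (service, each phase being exponential with mean $1/(k\mu)$) at rate $k\mu$: $(n,s)\to(n,s-1)$ for $n\ge1$, $2\le s\le k$; $(n,1)\to(n-1,k)$ for $n\ge 2$; and $(1,1)\to(0,0)$. For $0<\alpha<1$ let $\{D_\alpha(t)\}_{t\ge0}$ be an $\alpha$-stable subordinator, i.e. the one-dimensional non-decreasing Lévy process with $\mathbb{E}(e^{-zD_\alpha(t)})=e^{-tz^\alpha}$,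 $z>0$, and let $Y_\alpha(t)=\inf\{s\ge 0: D_\alpha(s)>t\}$ be its first hitting time (inverse $\alpha$-stable subordinator), taken independent of $\mathcal{Q}$. The time-changed Erlang queue with multiple arrivals is $\mathcal{Q}^\alpha(t)=\mathcal{Q}(Y_\alpha(t))$, $t\ge0$. Let $g_k:\mathcal{H}_0\to\mathbb{N}_0$ be the bijection $g_k(n,s)=k(n-1)+s$ for $(n,s)\in\mathcal{H}$, $g_k(0,0)=0$. The time-changed queue length process (counted in phases) is $\mathcal{L}^\alpha(t)=g_k(\mathcal{Q}^\alpha(t))$, and the mean queue length is $\mathcal{M}^\alpha(t)=\mathbb{E}(\mathcal{L}^\alpha(t)\mid\mathcal{L}^\alpha(0)=0)$. For integers $h\ge1$, $n\ge0$ and $\mathbf{m}\in\mathbb{N}_0^l$: $\gamma^0_{h,n}(\mathbf{m})=h+n+k\sum_{j=1}^{l}jm_j$ and $C^0_{h,n}(\mathbf{m})=h\lambda^n\big(\prod_{i=1}^{l}\frac{c_i^{m_i}}{m_i!}\big)\frac{(k\mu)^{\gamma^0_{h,n}(\mathbf{m})-n-1}}{(\gamma^0_{h,n}(\mathbf{m})-n)!}(\gamma^0_{h,n}(\mathbf{m})-1)!$. The three-parameter Mittag-Leffler function is $E^{\gamma}_{\alpha,\beta}(t)=\sum_{r=0}^{\infty}\frac{\Gamma(\gamma+r)\,t^r}{r!\,\Gamma(\gamma)\,\Gamma(\alpha r+\beta)}$ for $\alpha,\beta,\gamma>0$. *)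

theory Defs
  imports "HOL-Probability.Probability" "HOL-Library.Landau_Symbols"
begin

text \<open>Continuous-time Markov chains on a countable set \<open>S\<close>. Times range over the nonnegative
  reals; values of a process at negative times are irrelevant.\<close>

definition transition_function :: "'s set \<Rightarrow> (real \<Rightarrow> 's \<Rightarrow> 's \<Rightarrow> real) \<Rightarrow> bool" where
  "transition_function S p \<longleftrightarrow>
     (\<forall>t\<ge>0. \<forall>x\<in>S. (\<forall>y\<in>S. 0 \<le> p t x y) \<and> (p t x has_sum 1) S) \<and>
     (\<forall>x\<in>S. \<forall>y\<in>S. p 0 x y = (if x = y then 1 else 0)) \<and>
     (\<forall>s\<ge>0. \<forall>t\<ge>0. \<forall>x\<in>S. \<forall>z\<in>S. ((\<lambda>y. p s x y * p t y z) has_sum p (s + t) x z) S)"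

definition has_transition_rates ::
    "'s set \<Rightarrow> (real \<Rightarrow> 's \<Rightarrow> 's \<Rightarrow> real) \<Rightarrow> ('s \<Rightarrow> 's \<Rightarrow> real) \<Rightarrow> bool" where
  "has_transition_rates S p q \<longleftrightarrow>
     (\<forall>x\<in>S. \<forall>y\<in>S. x \<noteq> y \<longrightarrow> (\<lambda>h. p h x y - q x y * h) \<in> o[at_right 0](\<lambda>h. h)) \<and>
     (\<forall>x\<in>S. (\<lambda>h. p h x x - (1 - (\<Sum>\<^sub>\<infinity>y\<in>S - {x}. q x y) * h)) \<in> o[at_right 0](\<lambda>h. h))"

text \<open>A time-homogeneous Markov process with rates \<open>q\<close>. The second conjunct is right-continuity
  of every path for the discrete topology; it is what makes \<open>Q\<close> evaluated at a random time
  a random variable. In the Markov property, the past is observed at the finitely many times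
  in \<open>J\<close>.\<close>

definition markov_process ::
    "'a measure \<Rightarrow> 's set \<Rightarrow> ('s \<Rightarrow> 's \<Rightarrow> real) \<Rightarrow> (real \<Rightarrow> 'a \<Rightarrow> 's) \<Rightarrow> bool" where
  "markov_process M S q Q \<longleftrightarrow>
     (\<forall>t\<ge>0. Q t \<in> measurable M (count_space S)) \<and>
     (\<forall>\<omega>\<in>space M. \<forall>t\<ge>0. \<forall>\<^sub>F s in at_right t. Q s \<omega> = Q t \<omega>) \<and>
     (\<exists>p. transition_function S p \<and> has_transition_rates S p q \<and>
        (\<forall>t\<ge>0. \<forall>h\<ge>0. \<forall>x\<in>S. \<forall>y\<in>S. \<forall>J z. finite J \<and> J \<subseteq> {0..<t} \<and>
           measure M {\<omega>\<in>space M. Q t \<omega> = x \<and> (\<forall>u\<in>J. Q u \<omega> = z u)} > 0 \<longrightarrow>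
           \<P>(\<omega> in M. Q (t + h) \<omega> = y \<bar> Q t \<omega> = x \<and> (\<forall>u\<in>J. Q u \<omega> = z u)) = p h x y))"

definition erlang_states :: "nat \<Rightarrow> (nat \<times> nat) set" where
  "erlang_states k = {(0, 0)} \<union> {(n, s). 1 \<le> n \<and> 1 \<le> s \<and> s \<le> k}"

fun arrival_target :: "nat \<Rightarrow> nat \<Rightarrow> nat \<times> nat \<Rightarrow> nat \<times> nat" where
  "arrival_target k m (n, s) = (if n = 0 then (m, k) else (n + m, s))"

fun service_target :: "nat \<Rightarrow> nat \<times> nat \<Rightarrow> nat \<times> nat" where
  "service_target k (n, s) =
     (if 2 \<le> s then (n, s - 1) else if 2 \<le> n then (n - 1, k) else (0, 0))"

definition erlang_rate ::
    "nat \<Rightarrow> nat \<Rightarrow> real \<Rightarrow> (nat \<Rightarrow> real) \<Rightarrow> nat \<times> nat \<Rightarrow> nat \<times> nat \<Rightarrow> real" where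
  "erlang_rate k l mu lam x y =
     (\<Sum>m=1..l. if y = arrival_target k m x then lam m else 0) +
     (if x \<noteq> (0, 0) \<and> y = service_target k x then real k * mu else 0)"

definition erlang_queue ::
    "'a measure \<Rightarrow> nat \<Rightarrow> nat \<Rightarrow> real \<Rightarrow> (nat \<Rightarrow> real) \<Rightarrow> (real \<Rightarrow> 'a \<Rightarrow> nat \<times> nat) \<Rightarrow> bool" where
  "erlang_queue M k l mu lam Q \<longleftrightarrow>
     markov_process M (erlang_states k) (erlang_rate k l mu lam) Q \<and>
     (AE \<omega> in M. Q 0 \<omega> = (0, 0))"

definition levy_process :: "'a measure \<Rightarrow> (real \<Rightarrow> 'a \<Rightarrow> real) \<Rightarrow> bool" where
  "levy_process M X \<longleftrightarrow>
     (\<forall>t\<ge>0. X t \<in> borel_measurable M) \<and>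
     (AE \<omega> in M. X 0 \<omega> = 0) \<and>
     (\<forall>n ts. 0 \<le> ts 0 \<and> strict_mono_on {..n} ts \<longrightarrow>
        prob_space.indep_vars M (\<lambda>_. borel)
          (\<lambda>i \<omega>. X (ts (Suc i)) \<omega> - X (ts i) \<omega>) {..<n::nat}) \<and>
     (\<forall>s\<ge>0. \<forall>t\<ge>0. distr M borel (\<lambda>\<omega>. X (s + t) \<omega> - X s \<omega>) = distr M borel (X t)) \<and>
     (\<forall>t\<ge>0. \<forall>e>0. ((\<lambda>s. measure M {\<omega>\<in>space M. \<bar>X s \<omega> - X t \<omega>\<bar> > e}) \<longlongrightarrow> 0)
        (at t within {0..})) \<and>
     (AE \<omega> in M. (\<forall>t\<ge>0. continuous (at_right t) (\<lambda>s. X s \<omega>)) \<and>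
        (\<forall>t>0. \<exists>L. ((\<lambda>s. X s \<omega>) \<longlongrightarrow> L) (at_left t)))"

definition stable_subordinator ::
    "'a measure \<Rightarrow> real \<Rightarrow> (real \<Rightarrow> 'a \<Rightarrow> real) \<Rightarrow> bool" where
  "stable_subordinator M \<alpha> D \<longleftrightarrow>
     levy_process M D \<and>
     (AE \<omega> in M. mono_on {0..} (\<lambda>t. D t \<omega>)) \<and>
     (\<forall>t\<ge>0. \<forall>z>0. (\<integral>\<omega>. exp (- z * D t \<omega>) \<partial>M) = exp (- t * z powr \<alpha>))"

text \<open>On the null event that the path never exceeds \<open>t\<close>, the hitting time is set to \<open>0\<close>,
  because the infimum of the empty set of reals is an unspecified number.\<close>

definition hitting_time :: "(real \<Rightarrow> 'a \<Rightarrow> real) \<Rightarrow> real \<Rightarrow> 'a \<Rightarrow> real" where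
  "hitting_time D t \<omega> =
     (if \<exists>s\<ge>0. D s \<omega> > t then Inf {s. 0 \<le> s \<and> D s \<omega> > t} else 0)"

definition time_changed ::
    "(real \<Rightarrow> 'a \<Rightarrow> 's) \<Rightarrow> (real \<Rightarrow> 'a \<Rightarrow> real) \<Rightarrow> real \<Rightarrow> 'a \<Rightarrow> 's" where
  "time_changed Q Y t \<omega> = Q (Y t \<omega>) \<omega>"

definition independent_processes ::
    "'a measure \<Rightarrow> 's measure \<Rightarrow> (real \<Rightarrow> 'a \<Rightarrow> 's) \<Rightarrow> 'r measure \<Rightarrow> (real \<Rightarrow> 'a \<Rightarrow> 'r) \<Rightarrow> bool" where
  "independent_processes M A X B Y \<longleftrightarrow>
     (\<forall>t\<ge>0. X t \<in> measurable M A) \<and> (\<forall>t\<ge>0. Y t \<in> measurable M B) \<and>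
     prob_space.indep_set M
       (sets (vimage_algebra (space M) (\<lambda>\<omega>. \<lambda>t\<in>{0..}. X t \<omega>) (PiM {0..} (\<lambda>_. A))))
       (sets (vimage_algebra (space M) (\<lambda>\<omega>. \<lambda>t\<in>{0..}. Y t \<omega>) (PiM {0..} (\<lambda>_. B))))"

fun phase_number :: "nat \<Rightarrow> nat \<times> nat \<Rightarrow> nat" where
  "phase_number k (n, s) = (if n = 0 then 0 else k * (n - 1) + s)"

definition queue_length :: "nat \<Rightarrow> (real \<Rightarrow> 'a \<Rightarrow> nat \<times> nat) \<Rightarrow> real \<Rightarrow> 'a \<Rightarrow> nat" where
  "queue_length k Q t \<omega> = phase_number k (Q t \<omega>)"

definition mean_queue_length ::
    "'a measure \<Rightarrow> nat \<Rightarrow> (real \<Rightarrow> 'a \<Rightarrow> nat \<times> nat) \<Rightarrow> real \<Rightarrow> real" where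
  "mean_queue_length M k Q t =
     (LINT \<omega>:{\<omega>\<in>space M. queue_length k Q 0 \<omega> = 0}|M. real (queue_length k Q t \<omega>)) /
     measure M {\<omega>\<in>space M. queue_length k Q 0 \<omega> = 0}"

definition mittag_leffler3 :: "real \<Rightarrow> real \<Rightarrow> real \<Rightarrow> real \<Rightarrow> real" where
  "mittag_leffler3 \<gamma> \<alpha> \<beta> x =
     (\<Sum>r. Gamma (\<gamma> + real r) * x ^ r / (fact r * Gamma \<gamma> * Gamma (\<alpha> * real r + \<beta>)))"

definition total_rate :: "nat \<Rightarrow> (nat \<Rightarrow> real) \<Rightarrow> real" where
  "total_rate l lam = (\<Sum>m=1..l. lam m)"

definition arrival_prob :: "nat \<Rightarrow> (nat \<Rightarrow> real) \<Rightarrow> nat \<Rightarrow> real" where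
  "arrival_prob l lam m = lam m / total_rate l lam"

definition multi_indices :: "nat \<Rightarrow> nat \<Rightarrow> (nat \<Rightarrow> nat) set" where
  "multi_indices l n = {m \<in> {1..l} \<rightarrow>\<^sub>E UNIV. (\<Sum>j=1..l. m j) = n}"

definition gamma0 :: "nat \<Rightarrow> nat \<Rightarrow> nat \<Rightarrow> nat \<Rightarrow> (nat \<Rightarrow> nat) \<Rightarrow> nat" where
  "gamma0 k l h n m = h + n + k * (\<Sum>j=1..l. j * m j)"

text \<open>Used only for \<open>h \<ge> 1\<close>, where no subtraction of naturals below is truncated.\<close>

definition C0 ::
    "nat \<Rightarrow> nat \<Rightarrow> real \<Rightarrow> (nat \<Rightarrow> real) \<Rightarrow> nat \<Rightarrow> nat \<Rightarrow> (nat \<Rightarrow> nat) \<Rightarrow> real" where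
  "C0 k l mu lam h n m =
     real h * total_rate l lam ^ n * (\<Prod>i=1..l. arrival_prob l lam i ^ m i / fact (m i)) *
     ((real k * mu) ^ (gamma0 k l h n m - n - 1) / fact (gamma0 k l h n m - n)) *
     fact (gamma0 k l h n m - 1)"

definition betaM :: "nat \<Rightarrow> nat \<Rightarrow> real \<Rightarrow> nat \<Rightarrow> nat \<Rightarrow> (nat \<Rightarrow> nat) \<Rightarrow> real" where
  "betaM k l \<alpha> h n m = \<alpha> * real (gamma0 k l h n m) + 1"

end

theory Submission
  imports Defs
begin

text \<open>
Count the customers in phases. An arriving batch of size \<open>m\<close> raises the length \<open>L\<close> by \<open>k m\<close>, at
rate \<open>lam m\<close>; a completed phase lowers it by one, at rate \<open>k mu\<close>, as long as \<open>L > 0\<close>. Hence the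
generator maps \<open>L\<close> to a constant drift plus \<open>k mu\<close> times the indicator of \<open>L = 0\<close>, and before the
time change,
\<open>E L(u) = drift * u + k mu (\<integral>0..u. P(L(s) = 0) ds)\<close>.
This is \<open>nn_integral_phase_number\<close>, proved from Dynkin's formula for truncations of \<open>L\<close>.

The probability of an empty queue comes from a random walk. Let all events ring at the total rate
\<open>a = \<lambda> + k mu\<close>, a service event at an empty queue having no effect. Then \<open>P(L(s) = 0)\<close> is the sum
over \<open>N\<close> of \<open>exp (- a s) s ^ N / N!\<close> times the weight of the \<open>N\<close>-step paths of the reflected walk
that lead from \<open>0\<close> to \<open>0\<close>. The reflected walk is at \<open>0\<close> exactly if the free walk is at its running
minimum, that is, if one more service step would take it to some level \<open>- h\<close> for the first time.
The hitting-time theorem for walks whose only downward step is \<open>- 1\<close> says that the first-passage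
weight is \<open>h / (N + 1)\<close> times the weight of all walks of \<open>N + 1\<close> steps that end at \<open>- h\<close>. The latter
is a sum of multinomial weights over the numbers \<open>m\<close> of batches of each size. Without the factor
\<open>k mu\<close> of the last step, its terms times \<open>h / (N + 1)\<close> are the coefficients \<open>C0\<close> with
\<open>gamma0 = N + 1\<close>. The combinatorial part is \<open>hitting_coeff_Suc\<close> and \<open>empty_coeff_eq_sum\<close>; that the
resulting power series is the probability of an empty queue is \<open>pmf_empty\<close>.

The time change replaces \<open>u\<close> by the independent hitting time \<open>Y\<close>, so that
\<open>E L(Y) = drift E Y + k mu E (\<integral>0..Y. P(L(s) = 0) ds)\<close>. Self-similarity of the stable subordinator
gives \<open>Y\<close> the law of \<open>(t / D 1) powr \<alpha>\<close>, whose moments are found from the Laplace transform of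
\<open>D 1\<close>. Expanding the exponential, \<open>E (\<integral>0..Y. s ^ N / N! exp (- a s) ds)\<close> becomes the three-parameter
Mittag-Leffler term (\<open>occupation_gamma_density\<close>). All terms are nonnegative, so the triple series
may be regrouped by the value of \<open>gamma0\<close> (\<open>sum_C0_regroup\<close>).
\<close>

section \<open>Markov transition functions with bounded rates\<close>

text \<open>
Transition rates are one-sided limits at time 0, so expectations along a transition function come
with right derivatives only. The bound \<open>\<bar>g u - g a\<bar> \<le> e * (u - a)\<close> is followed up to the supremum \<open>c\<close> of
the times until which it holds; the right derivative at \<open>c\<close> would carry it beyond \<open>c\<close>.
\<close>

lemma zero_right_derivative_imp_const:
  fixes g :: "real \<Rightarrow> real"
  assumes "a \<le> b" and cont: "continuous_on {a..b} g"
    and der: "\<And>s. a \<le> s \<Longrightarrow> s < b \<Longrightarrow> ((\<lambda>d. (g (s + d) - g s) / d) \<longlongrightarrow> 0) (at_right 0)"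
  shows "g b = g a"
proof -
  have main: "\<bar>g b - g a\<bar> \<le> e * (b - a)" if "e > 0" for e
  proof -
    define G where "G = {s\<in>{a..b}. \<forall>u\<in>{a..s}. \<bar>g u - g a\<bar> \<le> e * (u - a)}"
    define c where "c = Sup G"
    have aG: "a \<in> G" using \<open>a \<le> b\<close> by (auto simp: G_def)
    have bdd: "bdd_above G" by (auto simp: G_def bdd_above_def)
    have ac: "a \<le> c" unfolding c_def by (rule cSup_upper[OF aG bdd])
    have cb: "c \<le> b" unfolding c_def using aG by (intro cSup_least) (auto simp: G_def)
    have below: "\<bar>g u - g a\<bar> \<le> e * (u - a)" if "a \<le> u" "u < c" for u
    proof -
      have "\<exists>s\<in>G. u < s" using less_cSupD[of G u] that aG unfolding c_def by blast
      then obtain s where "s \<in> G" "u < s" by blast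
      then show ?thesis using that by (auto simp: G_def)
    qed
    have atc: "\<bar>g c - g a\<bar> \<le> e * (c - a)"
    proof (cases "a = c")
      case False
      then have "a < c" using ac by simp
      have "continuous_on {a..c} (\<lambda>u. \<bar>g u - g a\<bar> - e * (u - a))"
        using cont cb by (intro continuous_intros) (auto intro: continuous_on_subset)
      moreover have "closure {a<..<c} = {a..c}" using \<open>a < c\<close> by simp
      ultimately have "continuous_on (closure {a<..<c}) (\<lambda>u. \<bar>g u - g a\<bar> - e * (u - a))" by simp
      then have "\<bar>g c - g a\<bar> - e * (c - a) \<le> 0"
      proof (rule continuous_le_on_closure)
        show "c \<in> closure {a<..<c}" using \<open>a < c\<close> by simp
        show "\<bar>g u - g a\<bar> - e * (u - a) \<le> 0" if "u \<in> {a<..<c}" for u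
          using below[of u] that by simp
      qed
      then show ?thesis by simp
    qed simp
    have "c = b"
    proof (rule ccontr)
      assume "c \<noteq> b"
      then have "c < b" using cb by simp
      have "\<forall>\<^sub>F d in at_right 0. dist ((g (c + d) - g c) / d) 0 < e"
        using tendstoD[OF der[OF ac \<open>c < b\<close>] \<open>e > 0\<close>] .
      then obtain r where r: "r > 0" "\<And>d. 0 < d \<Longrightarrow> d < r \<Longrightarrow> \<bar>(g (c + d) - g c) / d\<bar> < e"
        by (auto simp: eventually_at_right_field)
      define s where "s = min b (c + r / 2)"
      have "c < s" "s \<le> b" "s < c + r" using r(1) \<open>c < b\<close> by (auto simp: s_def)
      have "\<bar>g u - g a\<bar> \<le> e * (u - a)" if "a \<le> u" "u \<le> s" for u
      proof (cases "u \<le> c")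
        case True then show ?thesis using below[of u] atc that by (cases "u = c") auto
      next
        case False
        then have "\<bar>(g (c + (u - c)) - g c) / (u - c)\<bar> < e" using that \<open>s < c + r\<close> by (intro r(2)) auto
        then have "\<bar>g u - g c\<bar> < e * (u - c)" using False by (simp add: abs_divide pos_divide_less_eq)
        then show ?thesis using atc by (auto simp: algebra_simps)
      qed
      then have "s \<in> G" using \<open>s \<le> b\<close> \<open>c < s\<close> ac by (auto simp: G_def)
      then have "s \<le> c" unfolding c_def by (rule cSup_upper[OF _ bdd])
      then show False using \<open>c < s\<close> by simp
    qed
    then show ?thesis using atc by simp
  qed
  have "\<bar>g b - g a\<bar> \<le> 0"
  proof (rule field_le_epsilon)
    fix e :: real assume "e > 0"
    have "\<bar>g b - g a\<bar> \<le> e / (b - a + 1) * (b - a)" using \<open>a \<le> b\<close> \<open>e > 0\<close> by (intro main) auto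
    also have "\<dots> \<le> e" using \<open>a \<le> b\<close> \<open>e > 0\<close> by (simp add: field_simps)
    finally show "\<bar>g b - g a\<bar> \<le> 0 + e" by simp
  qed
  then show ?thesis by simp
qed

lemma integrable_pmf_bounded:
  fixes f :: "'s \<Rightarrow> real"
  assumes "\<And>x. \<bar>f x\<bar> \<le> B"
  shows "integrable (measure_pmf p) f"
  using assms by (intro measure_pmf.integrable_const_bound[where B = B]) auto

lemma abs_integral_pmf_le:
  fixes f :: "'s \<Rightarrow> real"
  assumes "\<And>x. \<bar>f x\<bar> \<le> B"
  shows "\<bar>\<integral>x. f x \<partial>measure_pmf p\<bar> \<le> B"
proof -
  have "\<bar>\<integral>x. f x \<partial>measure_pmf p\<bar> \<le> (\<integral>x. \<bar>f x\<bar> \<partial>measure_pmf p)"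
    by (rule integral_abs_bound)
  also have "\<dots> \<le> (\<integral>x. B \<partial>measure_pmf p)"
    using assms order_trans[OF abs_ge_zero assms]
    by (intro integral_mono integrable_pmf_bounded[of _ B]) auto
  finally show ?thesis by simp
qed

lemma integral_bind_pmf_bounded:
  fixes f :: "'t \<Rightarrow> real"
  assumes f: "\<And>x. \<bar>f x\<bar> \<le> B"
  shows "(\<integral>y. f y \<partial>bind_pmf p N) = (\<integral>x. (\<integral>y. f y \<partial>N x) \<partial>p)"
proof -
  let ?g = "\<lambda>x. \<integral>y. f y \<partial>N x"
  have nn: "0 \<le> f y + B" for y using f[of y] by auto
  note int = integrable_pmf_bounded[of f B, OF f]
  have "ennreal (\<integral>y. f y + B \<partial>bind_pmf p N) = (\<integral>\<^sup>+y. ennreal (f y + B) \<partial>bind_pmf p N)"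
    using nn int by (intro nn_integral_eq_integral[symmetric]) auto
  also have "\<dots> = (\<integral>\<^sup>+x. (\<integral>\<^sup>+y. ennreal (f y + B) \<partial>N x) \<partial>p)" by simp
  also have "\<dots> = (\<integral>\<^sup>+x. ennreal (?g x + B) \<partial>p)"
    using nn int by (intro nn_integral_cong, subst nn_integral_eq_integral) auto
  also have "\<dots> = ennreal (\<integral>x. ?g x + B \<partial>p)"
  proof (intro nn_integral_eq_integral AE_I2)
    show "integrable p (\<lambda>x. ?g x + B)"
      using abs_integral_pmf_le[of f B, OF f]
      by (intro Bochner_Integration.integrable_add integrable_pmf_bounded[of ?g B]) auto
    show "0 \<le> ?g x + B" for x
      using abs_integral_pmf_le[of f B "N x", OF f] by auto
  qed
  finally have "(\<integral>y. f y + B \<partial>bind_pmf p N) = (\<integral>x. ?g x + B \<partial>p)"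
  proof (subst (asm) ennreal_inj)
    show "0 \<le> (\<integral>y. f y + B \<partial>bind_pmf p N)" using nn by (intro integral_nonneg_AE) auto
    show "0 \<le> (\<integral>x. ?g x + B \<partial>p)"
    proof (intro integral_nonneg_AE AE_I2)
      show "0 \<le> ?g x + B" for x
        using abs_integral_pmf_le[of f B "N x", OF f] by auto
    qed
  qed
  moreover have "integrable p (\<lambda>x. \<integral>y. f y \<partial>N x)"
    using abs_integral_pmf_le[of f B, OF f] by (intro integrable_pmf_bounded[of _ B]) auto
  ultimately show ?thesis using int by simp
qed

text \<open>
The finite set \<open>T x\<close> contains all direct successors of \<open>x\<close>: by \<open>rate\<close> and \<open>exit_rate\<close>, the
probability of leaving \<open>x\<close> for a state outside \<open>T x\<close> within time \<open>h\<close> is of smaller order than \<open>h\<close>.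
\<close>

locale bounded_rate_kernel =
  fixes S :: "'s set" and K :: "real \<Rightarrow> 's \<Rightarrow> 's pmf"
    and q :: "'s \<Rightarrow> 's \<Rightarrow> real" and T :: "'s \<Rightarrow> 's set" and \<Lambda> :: real
  assumes K0: "x \<in> S \<Longrightarrow> K 0 x = return_pmf x"
    and K_closed: "x \<in> S \<Longrightarrow> 0 \<le> t \<Longrightarrow> set_pmf (K t x) \<subseteq> S"
    and K_add: "x \<in> S \<Longrightarrow> 0 \<le> s \<Longrightarrow> 0 \<le> t \<Longrightarrow> K (s + t) x = bind_pmf (K s x) (K t)"
    and finite_T: "x \<in> S \<Longrightarrow> finite (T x)"
    and T_subset: "x \<in> S \<Longrightarrow> T x \<subseteq> S - {x}"
    and rate: "x \<in> S \<Longrightarrow> y \<in> T x \<Longrightarrow> ((\<lambda>h. pmf (K h x) y / h) \<longlongrightarrow> q x y) (at_right 0)"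
    and exit_rate: "x \<in> S \<Longrightarrow> ((\<lambda>h. (1 - pmf (K h x) x) / h) \<longlongrightarrow> (\<Sum>y\<in>T x. q x y)) (at_right 0)"
    and exit_rate_le: "x \<in> S \<Longrightarrow> (\<Sum>y\<in>T x. q x y) \<le> \<Lambda>"
begin

definition generator :: "('s \<Rightarrow> real) \<Rightarrow> 's \<Rightarrow> real" where
  "generator \<phi> x = (\<Sum>y\<in>T x. q x y * (\<phi> y - \<phi> x))"

lemma pmf_return_mult_le:
  assumes "x \<in> S" "0 \<le> s" "0 \<le> t"
  shows "pmf (K s x) x * pmf (K t x) x \<le> pmf (K (s + t) x) x"
proof -
  have "pmf (K s x) x * pmf (K t x) x = (\<integral>y. indicator {x} y * pmf (K t x) x \<partial>K s x)"
    by (simp add: measure_pmf_single)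
  also have "\<dots> = (\<integral>y. indicator {x} y * pmf (K t y) x \<partial>K s x)"
    by (intro Bochner_Integration.integral_cong) (auto simp: indicator_def)
  also have "\<dots> \<le> (\<integral>y. pmf (K t y) x \<partial>K s x)"
    by (intro integral_mono integrable_pmf_bounded[of _ 1])
       (auto simp: indicator_def pmf_le_1 pmf_nonneg)
  also have "\<dots> = pmf (K (s + t) x) x"
    using assms by (simp add: K_add pmf_bind)
  finally show ?thesis .
qed

lemma pmf_return_power_le:
  assumes "x \<in> S" "0 \<le> s"
  shows "pmf (K s x) x ^ n \<le> pmf (K (real n * s) x) x"
proof (induction n)
  case 0 then show ?case using assms K0 by simp
next
  case (Suc n)
  have "pmf (K s x) x ^ Suc n \<le> pmf (K s x) x * pmf (K (real n * s) x) x"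
    using Suc by (simp add: mult_left_mono pmf_nonneg)
  also have "\<dots> \<le> pmf (K (s + real n * s) x) x"
    using assms by (intro pmf_return_mult_le) auto
  finally show ?case by (simp add: algebra_simps)
qed

text \<open>
The rates are limits at each state separately. This bound is uniform in the state, and it is what
dominates the difference quotients below. Staying put during \<open>n\<close> steps of length \<open>d / n\<close> gives
\<open>pmf (K (d / n) x) x ^ n \<le> pmf (K d x) x\<close>, and Bernoulli's inequality turns the rate at 0 into a bound at \<open>d\<close>.
\<close>

lemma exit_prob_le:
  assumes "x \<in> S" "0 \<le> d"
  shows "1 - pmf (K d x) x \<le> \<Lambda> * d"
proof (cases "d = 0")
  case True then show ?thesis using K0[OF assms(1)] by simp
next
  case False
  then have d: "d > 0" using assms by simp
  have "1 - pmf (K d x) x \<le> \<Lambda> * d + e" if "e > 0" for e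
  proof -
    \<comment> \<open>the slack \<open>e / d\<close> in the rate adds up to \<open>e\<close> over a time of length \<open>d\<close>\<close>
    define r where "r = \<Lambda> + e / d"
    have "(\<Sum>y\<in>T x. q x y) < r" using exit_rate_le[OF assms(1)] d that by (auto simp: r_def intro: le_less_trans)
    then have "\<forall>\<^sub>F h in at_right 0. (1 - pmf (K h x) x) / h < r"
      using order_tendstoD(2)[OF exit_rate[OF assms(1)]] by blast
    then obtain u where u: "u > 0" "\<And>h. 0 < h \<Longrightarrow> h < u \<Longrightarrow> (1 - pmf (K h x) x) / h < r"
      by (auto simp: eventually_at_right_field)
    obtain n :: nat where n: "real n > d / u" using reals_Archimedean2 by blast
    then have n0: "real n > 0" using d u(1) by (meson divide_pos_pos less_trans)
    define h where "h = d / real n"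
    have h: "0 < h" "h < u" "real n * h = d" using n n0 d u(1) by (auto simp: h_def field_simps)
    have "1 - pmf (K h x) x < r * h" using u(2)[OF h(1,2)] h(1) by (simp add: pos_divide_less_eq)
    then have "real n * (1 - pmf (K h x) x) \<le> real n * (r * h)"
      using n0 by (intro mult_left_mono) auto
    also have "\<dots> = r * d" using h(3) by (simp add: algebra_simps)
    finally have "real n * (1 - pmf (K h x) x) \<le> r * d" .
    moreover have "1 + real n * (pmf (K h x) x - 1) \<le> (1 + (pmf (K h x) x - 1)) ^ n"
      by (rule Bernoulli_inequality) (simp add: pmf_nonneg)
    moreover have "pmf (K h x) x ^ n \<le> pmf (K d x) x"
      using pmf_return_power_le[OF assms(1), of h n] h by simp
    ultimately show ?thesis using d by (simp add: r_def algebra_simps)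
  qed
  then show ?thesis by (rule field_le_epsilon)
qed

lemma expectation_diff_le:
  assumes "x \<in> S" "0 \<le> d" and \<phi>: "\<And>y. \<bar>\<phi> y\<bar> \<le> B"
  shows "\<bar>(\<integral>y. \<phi> y \<partial>K d x) - \<phi> x\<bar> \<le> 2 * B * \<Lambda> * d"
proof -
  have B: "0 \<le> B" using \<phi>[of x] by auto
  have bd: "\<bar>\<phi> y - \<phi> x\<bar> \<le> 2 * B * indicator (- {x}) y" for y
    using \<phi>[of y] \<phi>[of x] by (auto simp: indicator_def)
  have "(\<integral>y. \<phi> y \<partial>K d x) - \<phi> x = (\<integral>y. \<phi> y - \<phi> x \<partial>K d x)"
    by (simp add: integrable_pmf_bounded[of \<phi> B, OF \<phi>])
  also have "\<bar>\<dots>\<bar> \<le> (\<integral>y. \<bar>\<phi> y - \<phi> x\<bar> \<partial>K d x)" by (rule integral_abs_bound)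
  also have "\<dots> \<le> (\<integral>y. 2 * B * indicator (- {x}) y \<partial>K d x)"
  proof (intro integral_mono integrable_pmf_bounded[of _ "2 * B"])
    show "\<bar>\<bar>\<phi> y - \<phi> x\<bar>\<bar> \<le> 2 * B" for y using \<phi>[of y] \<phi>[of x] by simp
  qed (use bd B in \<open>auto simp: indicator_def\<close>)
  also have "\<dots> = 2 * B * (1 - pmf (K d x) x)"
    using measure_pmf.prob_compl[of "{x}" "K d x"] by (simp add: measure_pmf_single Compl_eq_Diff_UNIV)
  also have "\<dots> \<le> 2 * B * (\<Lambda> * d)" using B exit_prob_le[OF assms(1,2)] by (intro mult_left_mono) auto
  finally show ?thesis by (simp add: algebra_simps)
qed

text \<open>
Since the exit rate is the sum of the rates into \<open>T x\<close>, the mass that \<open>K h x\<close> puts outside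
\<open>insert x (T x)\<close> is of smaller order than \<open>h\<close>, and a bounded function cannot see it in the limit.
\<close>

lemma generator_limit:
  assumes x: "x \<in> S" and \<phi>: "\<And>y. \<bar>\<phi> y\<bar> \<le> B"
  shows "((\<lambda>h. ((\<integral>y. \<phi> y \<partial>K h x) - \<phi> x) / h) \<longlongrightarrow> generator \<phi> x) (at_right 0)"
proof -
  let ?E = "\<lambda>h. \<integral>y. \<phi> y \<partial>K h x"
  have B: "0 \<le> B" using \<phi>[of x] by auto
  have fin: "finite (T x)" and xT: "x \<notin> T x" using finite_T[OF x] T_subset[OF x] by auto
  define m where "m h = (\<Sum>y\<in>T x. pmf (K h x) y * (\<phi> y - \<phi> x))" for h
  define r where "r h = 2 * B * ((1 - pmf (K h x) x) - (\<Sum>y\<in>T x. pmf (K h x) y))" for h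
  have le: "\<bar>?E h - \<phi> x - m h\<bar> \<le> r h" for h
  proof -
    define R where "R = - insert x (T x)"
    have "(\<integral>y. indicator (T x) y * (\<phi> y - \<phi> x) \<partial>K h x) = m h"
      unfolding m_def using fin
      by (subst integral_measure_pmf_real[of "T x"]) (auto simp: indicator_def mult.commute split: if_splits)
    moreover have "integrable (K h x) (\<lambda>y. indicator (T x) y * (\<phi> y - \<phi> x))"
    proof (rule integrable_pmf_bounded[of _ "2 * B"])
      show "\<bar>indicator (T x) y * (\<phi> y - \<phi> x)\<bar> \<le> 2 * B" for y
        using \<phi>[of y] \<phi>[of x] by (auto simp: indicator_def)
    qed
    ultimately have "?E h - \<phi> x - m h =
        (\<integral>y. \<phi> y - \<phi> x - indicator (T x) y * (\<phi> y - \<phi> x) \<partial>K h x)"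
      by (simp add: integrable_pmf_bounded[of \<phi> B, OF \<phi>])
    also have "\<bar>\<dots>\<bar> \<le> (\<integral>y. \<bar>\<phi> y - \<phi> x - indicator (T x) y * (\<phi> y - \<phi> x)\<bar> \<partial>K h x)"
      by (rule integral_abs_bound)
    also have "\<dots> \<le> (\<integral>y. 2 * B * indicator R y \<partial>K h x)"
    proof (intro integral_mono integrable_pmf_bounded[of _ "2 * B"])
      fix y
      show *: "\<bar>\<phi> y - \<phi> x - indicator (T x) y * (\<phi> y - \<phi> x)\<bar> \<le> 2 * B * indicator R y"
        using \<phi>[of y] \<phi>[of x] by (auto simp: indicator_def R_def)
      show "\<bar>\<bar>\<phi> y - \<phi> x - indicator (T x) y * (\<phi> y - \<phi> x)\<bar>\<bar> \<le> 2 * B"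
        using \<phi>[of y] \<phi>[of x] by (auto simp: indicator_def)
    qed (use B in \<open>auto simp: indicator_def\<close>)
    also have "\<dots> = 2 * B * measure (K h x) R" by simp
    also have "measure (K h x) R = 1 - measure (K h x) (insert x (T x))"
      using measure_pmf.prob_compl[of "insert x (T x)" "K h x"] by (simp add: R_def Compl_eq_Diff_UNIV)
    also have "measure (K h x) (insert x (T x)) = pmf (K h x) x + (\<Sum>y\<in>T x. pmf (K h x) y)"
      using fin xT by (simp add: measure_measure_pmf_finite)
    finally show ?thesis by (simp add: r_def algebra_simps)
  qed
  have lim_m: "((\<lambda>h. m h / h) \<longlongrightarrow> generator \<phi> x) (at_right 0)"
  proof -
    have "((\<lambda>h. \<Sum>y\<in>T x. (pmf (K h x) y / h) * (\<phi> y - \<phi> x)) \<longlongrightarrow> (\<Sum>y\<in>T x. q x y * (\<phi> y - \<phi> x))) (at_right 0)"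
      by (intro tendsto_sum tendsto_mult rate x tendsto_const)
    then show ?thesis by (simp add: m_def generator_def sum_divide_distrib)
  qed
  have lim_r: "((\<lambda>h. r h / h) \<longlongrightarrow> 0) (at_right 0)"
  proof -
    have "((\<lambda>h. 2 * B * ((1 - pmf (K h x) x) / h - (\<Sum>y\<in>T x. pmf (K h x) y / h))) \<longlongrightarrow>
        2 * B * ((\<Sum>y\<in>T x. q x y) - (\<Sum>y\<in>T x. q x y))) (at_right 0)"
      by (intro tendsto_intros tendsto_sum rate exit_rate x)
    moreover have "2 * B * ((1 - pmf (K h x) x) / h - (\<Sum>y\<in>T x. pmf (K h x) y / h)) = r h / h" for h
      by (simp add: r_def sum_divide_distrib[symmetric] diff_divide_distrib[symmetric])
    ultimately show ?thesis by simp
  qed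
  have "((\<lambda>h. (?E h - \<phi> x) / h - m h / h) \<longlongrightarrow> 0) (at_right 0)"
  proof (rule Lim_null_comparison[OF _ lim_r])
    show "\<forall>\<^sub>F h in at_right 0. norm ((?E h - \<phi> x) / h - m h / h) \<le> r h / h"
    proof (rule eventually_at_right_less[THEN eventually_mono])
      fix h :: real assume "0 < h"
      then show "norm ((?E h - \<phi> x) / h - m h / h) \<le> r h / h"
        using le[of h] by (simp flip: diff_divide_distrib add: abs_divide divide_right_mono)
    qed
  qed
  from tendsto_add[OF this lim_m] show ?thesis by simp
qed

lemma expectation_Lipschitz:
  assumes x0: "x0 \<in> S" and st: "0 \<le> s" "0 \<le> d" and \<phi>: "\<And>y. \<bar>\<phi> y\<bar> \<le> B"
  shows "\<bar>(\<integral>y. \<phi> y \<partial>K (s + d) x0) - (\<integral>y. \<phi> y \<partial>K s x0)\<bar> \<le> 2 * B * \<Lambda> * d"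
proof -
  have B: "0 \<le> B" using \<phi>[of x0] by auto
  have "(\<integral>y. \<phi> y \<partial>K (s + d) x0) - (\<integral>y. \<phi> y \<partial>K s x0) =
      (\<integral>x. (\<integral>y. \<phi> y \<partial>K d x) - \<phi> x \<partial>K s x0)"
    using x0 st abs_integral_pmf_le[of \<phi> B, OF \<phi>]
    by (simp add: K_add integral_bind_pmf_bounded[of \<phi> B, OF \<phi>]
          integrable_pmf_bounded[of \<phi> B, OF \<phi>] integrable_pmf_bounded[of "\<lambda>x. \<integral>y. \<phi> y \<partial>K d x" B])
  also have "\<bar>\<dots>\<bar> \<le> (\<integral>x. \<bar>(\<integral>y. \<phi> y \<partial>K d x) - \<phi> x\<bar> \<partial>K s x0)" by (rule integral_abs_bound)
  also have "\<dots> \<le> (\<integral>x. 2 * B * \<Lambda> * d \<partial>K s x0)"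
  proof (intro integral_mono_AE)
    show "integrable (K s x0) (\<lambda>x. \<bar>(\<integral>y. \<phi> y \<partial>K d x) - \<phi> x\<bar>)"
    proof (rule integrable_pmf_bounded[of _ "2 * B"])
      show "\<bar>\<bar>(\<integral>y. \<phi> y \<partial>K d x) - \<phi> x\<bar>\<bar> \<le> 2 * B" for x
        using abs_integral_pmf_le[of \<phi> B "K d x", OF \<phi>] \<phi>[of x] by simp
    qed
    show "AE x in K s x0. \<bar>(\<integral>y. \<phi> y \<partial>K d x) - \<phi> x\<bar> \<le> 2 * B * \<Lambda> * d"
      using K_closed[OF x0 st(1)] expectation_diff_le[OF _ st(2), of _ \<phi> B] \<phi>
      by (auto simp: AE_measure_pmf_iff)
  qed simp
  finally show ?thesis by simp
qed

text \<open>
The Chapman-Kolmogorov equation writes the increment over \<open>[s, s + d]\<close> as the mean, over the state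
at time \<open>s\<close>, of an increment that starts from a fixed state. The latter converges by
\<open>generator_limit\<close> and is dominated by \<open>expectation_diff_le\<close>.
\<close>

lemma expectation_right_derivative:
  fixes W W' :: "real \<Rightarrow> 's \<Rightarrow> real"
  assumes x0: "x0 \<in> S" and s: "0 \<le> s" "s < t"
    and bound: "\<And>u y. 0 \<le> u \<Longrightarrow> u \<le> t \<Longrightarrow> \<bar>W u y\<bar> \<le> B"
    and lip: "\<And>u v y. 0 \<le> u \<Longrightarrow> u \<le> v \<Longrightarrow> v \<le> t \<Longrightarrow> \<bar>W v y - W u y\<bar> \<le> C * (v - u)"
    and der: "\<And>y. y \<in> S \<Longrightarrow> ((\<lambda>d. (W (s + d) y - W s y) / d) \<longlongrightarrow> W' s y) (at_right 0)"
  shows "((\<lambda>d. ((\<integral>y. W (s + d) y \<partial>K (s + d) x0) - (\<integral>y. W s y \<partial>K s x0)) / d) \<longlongrightarrow>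
     (\<integral>x. W' s x + generator (W s) x \<partial>K s x0)) (at_right 0)"
proof (rule tendsto_at_right_sequentially[of 0 "t - s"])
  show "0 < t - s" using s by simp
  fix X :: "nat \<Rightarrow> real"
  let ?V = "\<lambda>n y. (W (s + X n) y - W s y) / X n"
  assume X: "\<And>n. 0 < X n" "\<And>n. X n < t - s" "X \<longlonglongrightarrow> 0"
  have sX: "0 \<le> s + X n" "s + X n \<le> t" "0 \<le> X n" for n
    using X(1)[of n] X(2)[of n] s by auto
  have C: "0 \<le> C"
  proof -
    have "0 \<le> C * (t - s)" using order_trans[OF abs_ge_zero lip[of s t x0]] s by simp
    then show ?thesis using s by (simp add: zero_le_mult_iff)
  qed
  have B: "0 \<le> B" using bound[of s x0] s by auto
  note bW = bound[OF sX(1,2)]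
  have bWs: "\<bar>W s y\<bar> \<le> B" for y using bound[of s y] s by auto
  define f where "f n x = ((\<integral>y. W (s + X n) y \<partial>K (X n) x) - W s x) / X n" for n x
  have eq: "((\<integral>y. W (s + X n) y \<partial>K (s + X n) x0) - (\<integral>y. W s y \<partial>K s x0)) / X n =
      (\<integral>x. f n x \<partial>K s x0)" for n
  proof -
    have "integrable (K s x0) (\<lambda>x. \<integral>y. W (s + X n) y \<partial>K (X n) x)"
      by (rule integrable_pmf_bounded[of _ B]) (rule abs_integral_pmf_le[OF bW])
    then show ?thesis
      using x0 s sX(3)[of n]
      by (simp add: f_def K_add integral_bind_pmf_bounded[OF bW[of n]] integrable_pmf_bounded[OF bWs])
  qed
  \<comment> \<open>the error from evaluating the increment of \<open>W\<close> at a moved state, the time derivative, and the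
     quotient whose limit is the generator\<close>
  have split: "f n x = ((\<integral>y. ?V n y \<partial>K (X n) x) - ?V n x)
     + ?V n x + ((\<integral>y. W s y \<partial>K (X n) x) - W s x) / X n" for n x
    by (simp add: f_def integrable_pmf_bounded[OF bW[of n]] integrable_pmf_bounded[OF bWs] diff_divide_distrib)
  have Vb: "\<bar>?V n y\<bar> \<le> C" for n y
    using lip[of s "s + X n" y] s sX(2,3)[of n] X(1)[of n] by (simp add: abs_divide pos_divide_le_eq)
  have first: "\<bar>(\<integral>y. ?V n y \<partial>K (X n) x) - ?V n x\<bar>
      \<le> 2 * C * \<Lambda> * X n" if "x \<in> S" for n x
    by (rule expectation_diff_le[OF that sX(3) Vb])
  have third: "\<bar>((\<integral>y. W s y \<partial>K (X n) x) - W s x) / X n\<bar> \<le> 2 * B * \<Lambda>" if "x \<in> S" for n x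
    using expectation_diff_le[OF that sX(3), of "W s" B n] bWs X(1)[of n]
    by (simp add: abs_divide pos_divide_le_eq)
  have Xr: "filterlim X (at_right 0) sequentially"
    using X(1,3) by (auto simp: filterlim_at intro!: always_eventually dest: less_imp_neq[THEN not_sym])
  have "(\<lambda>n. \<integral>x. f n x \<partial>K s x0) \<longlonglongrightarrow> (\<integral>x. W' s x + generator (W s) x \<partial>K s x0)"
  proof (rule integral_dominated_convergence[where s = f
      and f = "\<lambda>x. W' s x + generator (W s) x" and w = "\<lambda>_. 2 * C * \<Lambda> * (t - s) + C + 2 * B * \<Lambda>"])
    show "AE x in K s x0. (\<lambda>n. f n x) \<longlonglongrightarrow> W' s x + generator (W s) x"
    proof (rule AE_pmfI)
      fix x assume "x \<in> set_pmf (K s x0)"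
      then have x: "x \<in> S" using K_closed[OF x0 s(1)] by auto
      have "(\<lambda>n. 2 * C * \<Lambda> * X n) \<longlonglongrightarrow> 0"
        using tendsto_mult_right_zero[OF X(3)] by simp
      then have "(\<lambda>n. (\<integral>y. ?V n y \<partial>K (X n) x) - ?V n x) \<longlonglongrightarrow> 0"
        by (rule Lim_null_comparison[rotated]) (use first[OF x] in auto)
      moreover have "(\<lambda>n. ?V n x) \<longlonglongrightarrow> W' s x"
        by (rule filterlim_compose[OF der[OF x] Xr])
      moreover have "(\<lambda>n. ((\<integral>y. W s y \<partial>K (X n) x) - W s x) / X n) \<longlonglongrightarrow> generator (W s) x"
        by (rule filterlim_compose[OF generator_limit[OF x bWs] Xr])
      ultimately show "(\<lambda>n. f n x) \<longlonglongrightarrow> W' s x + generator (W s) x"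
        unfolding split by (rule tendsto_add[OF tendsto_add[where a = 0, simplified add_0_left]])
    qed
    show "AE x in K s x0. norm (f n x) \<le> 2 * C * \<Lambda> * (t - s) + C + 2 * B * \<Lambda>" for n
    proof (rule AE_pmfI)
      fix x assume "x \<in> set_pmf (K s x0)"
      then have x: "x \<in> S" using K_closed[OF x0 s(1)] by auto
      have "0 \<le> \<Lambda>" using exit_prob_le[OF x, of 1] pmf_le_1[of "K 1 x" x] by simp
      then have "2 * C * \<Lambda> * X n \<le> 2 * C * \<Lambda> * (t - s)"
        using C X(2)[of n] by (intro mult_left_mono) auto
      then show "norm (f n x) \<le> 2 * C * \<Lambda> * (t - s) + C + 2 * B * \<Lambda>"
        unfolding split real_norm_def using first[OF x, of n] Vb[of n x] third[OF x, of n] by linarith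
    qed
  qed auto
  then show "(\<lambda>n. ((\<integral>y. W (s + X n) y \<partial>K (s + X n) x0) - (\<integral>y. W s y \<partial>K s x0)) / X n) \<longlonglongrightarrow>
     (\<integral>x. W' s x + generator (W s) x \<partial>K s x0)" by (simp add: eq)
qed

lemma rate_bound_nonneg:
  assumes "x0 \<in> S" shows "0 \<le> \<Lambda>"
  using exit_prob_le[OF assms, of 1] pmf_le_1[of "K 1 x0" x0] by simp

lemma continuous_expectation:
  fixes \<phi> :: "'s \<Rightarrow> real"
  assumes x0: "x0 \<in> S" and \<phi>: "\<And>y. \<bar>\<phi> y\<bar> \<le> B"
  shows "continuous_on {0..} (\<lambda>s. \<integral>y. \<phi> y \<partial>K s x0)"
proof -
  have B: "0 \<le> B" using \<phi>[of x0] by auto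
  have "(2 * B * \<Lambda>)-lipschitz_on {0..} (\<lambda>s. \<integral>y. \<phi> y \<partial>K s x0)"
  proof (rule lipschitz_on_leI)
    fix s u :: real assume "s \<in> {0..}" "u \<in> {0..}" "s \<le> u"
    then show "dist (\<integral>y. \<phi> y \<partial>K s x0) (\<integral>y. \<phi> y \<partial>K u x0) \<le> 2 * B * \<Lambda> * dist s u"
      using expectation_Lipschitz[OF x0, of s "u - s" \<phi> B] \<phi>
      by (simp add: dist_real_def abs_minus_commute)
  qed (use B rate_bound_nonneg[OF x0] in simp)
  then show ?thesis by (rule lipschitz_on_continuous_on)
qed

text \<open>
Applied to a bounded solution of the backward equation with reversed time, this identifies
transition probabilities: it is the uniqueness of bounded solutions.
\<close>

lemma expectation_space_time_const:
  fixes W W' :: "real \<Rightarrow> 's \<Rightarrow> real"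
  assumes x0: "x0 \<in> S" and t: "0 \<le> t"
    and bound: "\<And>u y. 0 \<le> u \<Longrightarrow> u \<le> t \<Longrightarrow> \<bar>W u y\<bar> \<le> B"
    and lip: "\<And>u v y. 0 \<le> u \<Longrightarrow> u \<le> v \<Longrightarrow> v \<le> t \<Longrightarrow> \<bar>W v y - W u y\<bar> \<le> C * (v - u)"
    and der: "\<And>s y. 0 \<le> s \<Longrightarrow> s < t \<Longrightarrow> y \<in> S \<Longrightarrow>
       ((\<lambda>d. (W (s + d) y - W s y) / d) \<longlongrightarrow> W' s y) (at_right 0)"
    and zero: "\<And>s. 0 \<le> s \<Longrightarrow> s < t \<Longrightarrow> (\<integral>x. W' s x + generator (W s) x \<partial>K s x0) = 0"
  shows "(\<integral>y. W t y \<partial>K t x0) = W 0 x0"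
proof (cases "t = 0")
  case True then show ?thesis using K0[OF x0] by simp
next
  case False
  then have t0: "0 < t" using t by simp
  have C: "0 \<le> C"
  proof -
    have "0 \<le> C * t" using order_trans[OF abs_ge_zero lip[of 0 t x0]] t by simp
    then show ?thesis using t0 by (simp add: zero_le_mult_iff)
  qed
  have B: "0 \<le> B" using bound[of 0 x0] t by auto
  have "(\<integral>y. W t y \<partial>K t x0) = (\<integral>y. W 0 y \<partial>K 0 x0)"
  proof (rule zero_right_derivative_imp_const[OF t])
    have "(C + 2 * B * \<Lambda>)-lipschitz_on {0..t} (\<lambda>s. \<integral>y. W s y \<partial>K s x0)"
    proof (rule lipschitz_on_leI)
      fix s u :: real assume su: "s \<in> {0..t}" "u \<in> {0..t}" "s \<le> u"
      have "\<bar>(\<integral>y. W s y \<partial>K u x0) - (\<integral>y. W s y \<partial>K s x0)\<bar> \<le> 2 * B * \<Lambda> * (u - s)"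
        using expectation_Lipschitz[OF x0, of s "u - s" "W s" B] bound[of s] su by simp
      moreover have "\<bar>(\<integral>y. W u y \<partial>K u x0) - (\<integral>y. W s y \<partial>K u x0)\<bar> \<le> C * (u - s)"
      proof -
        have "(\<integral>y. W u y \<partial>K u x0) - (\<integral>y. W s y \<partial>K u x0) = (\<integral>y. W u y - W s y \<partial>K u x0)"
          using bound[of s] bound[of u] su
          by (subst Bochner_Integration.integral_diff) (auto intro!: integrable_pmf_bounded[of _ B])
        then show ?thesis
          using abs_integral_pmf_le[of "\<lambda>y. W u y - W s y" "C * (u - s)" "K u x0"] lip[of s u] su by simp
      qed
      ultimately show "dist (\<integral>y. W s y \<partial>K s x0) (\<integral>y. W u y \<partial>K u x0) \<le> (C + 2 * B * \<Lambda>) * dist s u"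
        using su by (simp add: dist_real_def abs_le_iff algebra_simps)
    qed (use B C rate_bound_nonneg[OF x0] in simp)
    then show "continuous_on {0..t} (\<lambda>s. \<integral>y. W s y \<partial>K s x0)" by (rule lipschitz_on_continuous_on)
    fix s :: real assume s: "0 \<le> s" "s < t"
    show "((\<lambda>d. ((\<integral>y. W (s + d) y \<partial>K (s + d) x0) - (\<integral>y. W s y \<partial>K s x0)) / d) \<longlongrightarrow> 0) (at_right 0)"
      using expectation_right_derivative[where W = W and W' = W' and B = B and C = C, OF x0 s bound lip der[OF s]]
      by (simp add: zero[OF s])
  qed
  then show ?thesis using K0[OF x0] by simp
qed

text \<open>
This is the preceding lemma for \<open>\<phi>\<close> minus the running integral of the mean of \<open>\<psi>\<close>.
\<close>

lemma Dynkin_formula: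
  assumes x0: "x0 \<in> S" and t: "0 \<le> t" and \<phi>: "\<And>y. \<bar>\<phi> y\<bar> \<le> B" and \<psi>: "\<And>y. \<bar>\<psi> y\<bar> \<le> C"
    and gen: "\<And>x. x \<in> S \<Longrightarrow> generator \<phi> x = \<psi> x"
  shows "(\<integral>y. \<phi> y \<partial>K t x0) = \<phi> x0 + integral {0..t} (\<lambda>s. \<integral>y. \<psi> y \<partial>K s x0)"
proof -
  define a where "a s = (\<integral>y. \<psi> y \<partial>K s x0)" for s
  define F where "F u = integral {0..u} a" for u
  have acont: "continuous_on {0..t} a"
    unfolding a_def by (rule continuous_on_subset[OF continuous_expectation[OF x0 \<psi>]]) auto
  have ab: "\<bar>a s\<bar> \<le> C" for s unfolding a_def by (rule abs_integral_pmf_le[OF \<psi>])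
  have C: "0 \<le> C" using \<psi>[of x0] by auto
  have Flip: "\<bar>F v - F u\<bar> \<le> C * (v - u)" if "0 \<le> u" "u \<le> v" "v \<le> t" for u v
  proof -
    have int: "a integrable_on {0..v}" using that
      by (intro integrable_continuous_real continuous_on_subset[OF acont]) auto
    have "F v - F u = integral {u..v} a"
      using Henstock_Kurzweil_Integration.integral_combine[OF that(1,2) int] by (simp add: F_def)
    also have "norm \<dots> \<le> C * (v - u)"
      using that ab by (intro integral_bound continuous_on_subset[OF acont]) auto
    finally show ?thesis by simp
  qed
  have Fder: "((\<lambda>d. (F (s + d) - F s) / d) \<longlongrightarrow> a s) (at_right 0)" if s: "0 \<le> s" "s < t" for s
  proof -
    have "(F has_real_derivative a s) (at s within {0..t})"
      unfolding F_def using integral_has_real_derivative[OF acont] s by simp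
    then have "(F has_real_derivative a s) (at s within {s..t})"
      by (rule DERIV_subset) (use s in auto)
    then have "((\<lambda>y. (F y - F s) / (y - s)) \<longlongrightarrow> a s) (at_right s)"
      using s by (simp add: has_field_derivative_iff at_within_Icc_at_right)
    then show ?thesis
      by (subst (asm) filterlim_at_right_to_0) (simp add: add.commute)
  qed
  have Fb: "\<bar>F u\<bar> \<le> C * t" if "0 \<le> u" "u \<le> t" for u
  proof -
    have "\<bar>F u\<bar> \<le> C * u" using Flip[of 0 u] that by (simp add: F_def)
    also have "\<dots> \<le> C * t" using that C by (intro mult_left_mono)
    finally show ?thesis .
  qed
  have "(\<integral>y. \<phi> y - F t \<partial>K t x0) = \<phi> x0 - F 0"
  proof (rule expectation_space_time_const[OF x0 t, where W = "\<lambda>s y. \<phi> y - F s"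
        and W' = "\<lambda>s y. - a s" and B = "B + C * t" and C = C])
    show "\<bar>\<phi> y - F u\<bar> \<le> B + C * t" if "0 \<le> u" "u \<le> t" for u y
      using \<phi>[of y] Fb[OF that] by linarith
    show "\<bar>\<phi> y - F v - (\<phi> y - F u)\<bar> \<le> C * (v - u)" if "0 \<le> u" "u \<le> v" "v \<le> t" for u v y
      using Flip[OF that] by simp
    fix s assume s: "0 \<le> s" "s < t"
    show "((\<lambda>d. (\<phi> y - F (s + d) - (\<phi> y - F s)) / d) \<longlongrightarrow> - a s) (at_right 0)" for y
      using tendsto_minus[OF Fder[OF s]] by (simp add: minus_divide_left)
    have "(\<integral>x. - a s + generator (\<lambda>y. \<phi> y - F s) x \<partial>K s x0) = (\<integral>x. - a s + \<psi> x \<partial>K s x0)"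
      using K_closed[OF x0 s(1)] gen
      by (intro integral_cong_AE AE_pmfI) (auto simp: generator_def)
    also have "\<dots> = (\<integral>x. - a s \<partial>K s x0) + (\<integral>x. \<psi> x \<partial>K s x0)"
      by (intro Bochner_Integration.integral_add integrable_pmf_bounded[of \<psi> C, OF \<psi>]) simp
    also have "\<dots> = 0" by (simp add: a_def)
    finally show "(\<integral>x. - a s + generator (\<lambda>y. \<phi> y - F s) x \<partial>K s x0) = 0" .
  qed
  moreover have "(\<integral>y. \<phi> y - F t \<partial>K t x0) = (\<integral>y. \<phi> y \<partial>K t x0) - F t"
    using integrable_pmf_bounded[of \<phi> B, OF \<phi>] by simp
  ultimately show ?thesis by (simp add: F_def a_def[abs_def])
qed

end

lemma nn_integral_count_space_has_sum:
  fixes f :: "'s \<Rightarrow> real"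
  assumes "(f has_sum c) A" and "\<And>x. x \<in> A \<Longrightarrow> 0 \<le> f x"
  shows "(\<integral>\<^sup>+x. ennreal (f x) \<partial>count_space A) = ennreal c"
proof -
  have "f summable_on A" using assms(1) by (auto simp: summable_on_def)
  moreover have "(\<lambda>x. norm (f x)) summable_on A \<longleftrightarrow> f summable_on A"
    using assms(2) by (intro summable_on_cong) auto
  ultimately have s: "Infinite_Set_Sum.abs_summable_on f A" unfolding abs_summable_equivalent[symmetric] by simp
  then have "(\<integral>\<^sup>+x. ennreal (f x) \<partial>count_space A) = ennreal (infsetsum f A)"
    using assms(2) by (rule nn_integral_conv_infsetsum)
  also have "infsetsum f A = c" using infsetsum_infsum[OF s] infsumI[OF assms(1)] by simp
  finally show ?thesis .
qed

definition transition_kernel :: "'s set \<Rightarrow> (real \<Rightarrow> 's \<Rightarrow> 's \<Rightarrow> real) \<Rightarrow> real \<Rightarrow> 's \<Rightarrow> 's pmf" where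
  "transition_kernel S p t x =
     (if 0 \<le> t \<and> x \<in> S then embed_pmf (\<lambda>y. if y \<in> S then p t x y else 0) else return_pmf x)"

lemma pmf_transition_kernel:
  assumes p: "transition_function S p" and t: "0 \<le> t" and x: "x \<in> S"
  shows "pmf (transition_kernel S p t x) y = (if y \<in> S then p t x y else 0)"
proof -
  have nn: "\<And>y. y \<in> S \<Longrightarrow> 0 \<le> p t x y" and sum: "(p t x has_sum 1) S"
    using p t x by (auto simp: transition_function_def)
  have "(\<integral>\<^sup>+y. ennreal (if y \<in> S then p t x y else 0) \<partial>count_space UNIV) =
      (\<integral>\<^sup>+y. ennreal (p t x y) \<partial>count_space S)"
    by (subst nn_integral_count_space_indicator) (auto intro!: nn_integral_cong split: split_indicator)
  also have "\<dots> = 1" using nn_integral_count_space_has_sum[OF sum nn] by simp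
  finally have "pmf (embed_pmf (\<lambda>y. if y \<in> S then p t x y else 0)) y = (if y \<in> S then p t x y else 0)"
    using nn by (intro pmf_embed_pmf) auto
  then show ?thesis using t x by (simp add: transition_kernel_def)
qed

lemma bounded_rate_kernel_transition_kernel:
  assumes p: "transition_function S p" and q: "has_transition_rates S p q"
    and finT: "\<And>x. x \<in> S \<Longrightarrow> finite (T x)" and T: "\<And>x. x \<in> S \<Longrightarrow> T x \<subseteq> S - {x}"
    and q0: "\<And>x y. x \<in> S \<Longrightarrow> y \<in> S - {x} - T x \<Longrightarrow> q x y = 0"
    and \<Lambda>: "\<And>x. x \<in> S \<Longrightarrow> (\<Sum>y\<in>T x. q x y) \<le> \<Lambda>"
  shows "bounded_rate_kernel S (transition_kernel S p) q T \<Lambda>"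
proof
  let ?K = "transition_kernel S p"
  note pmfK = pmf_transition_kernel[OF p]
  have p0: "p 0 x y = (if x = y then 1 else 0)" if "x \<in> S" "y \<in> S" for x y
    using p that by (auto simp: transition_function_def)
  fix x assume x: "x \<in> S"
  show "?K 0 x = return_pmf x"
    using x p0 by (intro pmf_eqI) (auto simp: pmfK indicator_def)
  have closed: "set_pmf (?K t y) \<subseteq> S" if "0 \<le> t" "y \<in> S" for t y
    using that by (auto simp: set_pmf_eq pmfK)
  then show "set_pmf (?K t x) \<subseteq> S" if "0 \<le> t" for t using x that by blast
  show "?K (s + t) x = bind_pmf (?K s x) (?K t)" if st: "0 \<le> s" "0 \<le> t" for s t
  proof (rule pmf_eqI)
    fix z
    show "pmf (?K (s + t) x) z = pmf (bind_pmf (?K s x) (?K t)) z"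
    proof (cases "z \<in> S")
      case True
      have nn: "0 \<le> p u y w" if "0 \<le> u" "y \<in> S" "w \<in> S" for u y w
        using p that by (auto simp: transition_function_def)
      have "ennreal (pmf (bind_pmf (?K s x) (?K t)) z) =
          (\<integral>\<^sup>+y. ennreal (pmf (?K s x) y) * ennreal (pmf (?K t y) z) \<partial>count_space UNIV)"
        by (simp add: ennreal_pmf_bind nn_integral_measure_pmf)
      also have "\<dots> = (\<integral>\<^sup>+y. ennreal (p s x y * p t y z) \<partial>count_space S)"
        using x st True nn
        by (subst nn_integral_count_space_indicator)
           (auto intro!: nn_integral_cong simp: pmfK ennreal_mult split: split_indicator)
      also have "\<dots> = ennreal (p (s + t) x z)"
        using p x st True nn
        by (intro nn_integral_count_space_has_sum) (auto simp: transition_function_def)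
      finally have "pmf (bind_pmf (?K s x) (?K t)) z = p (s + t) x z"
        using nn x st True by (simp add: pmf_nonneg)
      then show ?thesis using x st True by (simp add: pmfK)
    next
      case False
      have "z \<notin> set_pmf (?K (s + t) x)" using False x st by (simp add: set_pmf_eq pmfK)
      moreover have "z \<notin> set_pmf (bind_pmf (?K s x) (?K t))"
        using False x st closed unfolding set_bind_pmf by blast
      ultimately show ?thesis by (simp add: set_pmf_eq)
    qed
  qed
  show "finite (T x)" "T x \<subseteq> S - {x}" "(\<Sum>y\<in>T x. q x y) \<le> \<Lambda>"
    using x finT T \<Lambda> by auto
  have pos: "\<forall>\<^sub>F h in at_right (0::real). 0 < h" by (rule eventually_at_right_less)
  show "((\<lambda>h. pmf (?K h x) y / h) \<longlongrightarrow> q x y) (at_right 0)" if "y \<in> T x" for y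
  proof -
    have y: "y \<in> S" "y \<noteq> x" using T[OF x] that by auto
    then have "(\<lambda>h. p h x y - q x y * h) \<in> o[at_right 0](\<lambda>h. h)"
      using q x by (auto simp: has_transition_rates_def)
    then have "((\<lambda>h. (p h x y - q x y * h) / h) \<longlongrightarrow> 0) (at_right 0)" by (rule smalloD_tendsto)
    from tendsto_add[OF this tendsto_const[of "q x y"]]
    have "((\<lambda>h. (p h x y - q x y * h) / h + q x y) \<longlongrightarrow> q x y) (at_right 0)" by simp
    then show ?thesis
      by (rule Lim_transform_eventually)
         (use x y in \<open>auto intro!: eventually_mono[OF pos] simp: pmfK field_simps\<close>)
  qed
  show "((\<lambda>h. (1 - pmf (?K h x) x) / h) \<longlongrightarrow> (\<Sum>y\<in>T x. q x y)) (at_right 0)"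
  proof -
    have "(\<Sum>\<^sub>\<infinity>y\<in>S - {x}. q x y) = (\<Sum>\<^sub>\<infinity>y\<in>T x. q x y)"
      using q0[OF x] T[OF x] by (intro infsum_cong_neutral) auto
    also have "\<dots> = (\<Sum>y\<in>T x. q x y)" using finT[OF x] by simp
    finally have "(\<lambda>h. p h x x - (1 - (\<Sum>y\<in>T x. q x y) * h)) \<in> o[at_right 0](\<lambda>h. h)"
      using q x by (auto simp: has_transition_rates_def)
    then have "((\<lambda>h. (p h x x - (1 - (\<Sum>y\<in>T x. q x y) * h)) / h) \<longlongrightarrow> 0) (at_right 0)"
      by (rule smalloD_tendsto)
    from tendsto_diff[OF tendsto_const[of "\<Sum>y\<in>T x. q x y"] this]
    have "((\<lambda>h. (\<Sum>y\<in>T x. q x y) - (p h x x - (1 - (\<Sum>y\<in>T x. q x y) * h)) / h) \<longlongrightarrow>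
        (\<Sum>y\<in>T x. q x y)) (at_right 0)" by simp
    then show ?thesis
      by (rule Lim_transform_eventually)
         (use x in \<open>auto intro!: eventually_mono[OF pos] simp: pmfK field_simps\<close>)
  qed
qed

section \<open>First-passage weights of the phase walk\<close>

definition index_weight :: "nat \<Rightarrow> (nat \<Rightarrow> real) \<Rightarrow> (nat \<Rightarrow> nat) \<Rightarrow> real" where
  "index_weight l lam m = (\<Prod>j=1..l. lam j ^ m j / fact (m j))"

text \<open>
The walk on the integers has a step \<open>k * j\<close> for each arriving batch of size \<open>j\<close> and a step \<open>- 1\<close> for
each service event. With \<open>m j\<close> batches of each size \<open>j\<close> it ends at \<open>- h\<close> if there are
\<open>h + k * (\<Sum>j. j * m j)\<close> service events, so \<open>gamma0\<close> is the number of steps.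
\<close>

definition path_indices :: "nat \<Rightarrow> nat \<Rightarrow> nat \<Rightarrow> nat \<Rightarrow> (nat \<Rightarrow> nat) set" where
  "path_indices k l N h = {m \<in> {1..l} \<rightarrow>\<^sub>E UNIV. gamma0 k l h (\<Sum>j=1..l. m j) m = Suc N}"

lemma finite_path_indices: "finite (path_indices k l N h)"
proof (rule finite_subset)
  show "path_indices k l N h \<subseteq> {1..l} \<rightarrow>\<^sub>E {..Suc N}"
  proof
    fix m assume m: "m \<in> path_indices k l N h"
    then have "(\<Sum>j=1..l. m j) \<le> Suc N" by (auto simp: path_indices_def gamma0_def)
    then have "m j \<le> Suc N" if "j \<in> {1..l}" for j
      using member_le_sum[of j "{1..l}" m] that by (auto intro: order_trans)
    then show "m \<in> {1..l} \<rightarrow>\<^sub>E {..Suc N}" using m by (auto simp: path_indices_def PiE_iff)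
  qed
qed (auto intro: finite_PiE)

lemma sum_fun_upd_Suc:
  fixes f :: "nat \<Rightarrow> nat"
  assumes "j \<in> {1..l::nat}"
  shows "(\<Sum>i=1..l. f i * (m(j := Suc (m j))) i) = (\<Sum>i=1..l. f i * m i) + f j"
proof -
  have "(\<Sum>i=1..l. f i * (m(j := Suc (m j))) i) = f j * Suc (m j) + (\<Sum>i\<in>{1..l}-{j}. f i * m i)"
    using assms by (subst sum.remove[of _ j]) (auto intro!: sum.cong)
  also have "\<dots> = (\<Sum>i=1..l. f i * m i) + f j"
    using assms by (subst (2) sum.remove[of _ j]) auto
  finally show ?thesis .
qed

lemma index_weight_fun_upd_Suc:
  assumes "j \<in> {1..l}"
  shows "real (Suc (m j)) * index_weight l lam (m(j := Suc (m j))) = lam j * index_weight l lam m"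
proof -
  have "index_weight l lam (m(j := Suc (m j))) =
      lam j ^ Suc (m j) / fact (Suc (m j)) * (\<Prod>i\<in>{1..l}-{j}. lam i ^ m i / fact (m i))"
    unfolding index_weight_def using assms by (subst prod.remove[of _ j]) (auto intro!: prod.cong)
  moreover have "index_weight l lam m = lam j ^ m j / fact (m j) * (\<Prod>i\<in>{1..l}-{j}. lam i ^ m i / fact (m i))"
    unfolding index_weight_def using assms by (subst prod.remove[of _ j]) auto
  moreover have "fact (Suc (m j)) = real (Suc (m j)) * fact (m j)" by (rule fact_Suc)
  moreover have "real (Suc (m j)) \<noteq> 0" by simp
  ultimately have "fact (m j) * (real (Suc (m j)) * index_weight l lam (m(j := Suc (m j)))) =
      fact (m j) * (lam j * index_weight l lam m)"
    by (simp add: field_simps del: of_nat_Suc fact_Suc)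
  then show ?thesis by (simp del: of_nat_Suc)
qed

text \<open>
Taking away one batch of size \<open>j\<close> shortens the walk by one step and lowers its end by \<open>k * j\<close>;
the factor \<open>m j\<close> cancels against the factorial of \<open>m j\<close>.
\<close>

lemma sum_path_indices_shift:
  fixes F :: "(nat \<Rightarrow> nat) \<Rightarrow> real"
  assumes j: "j \<in> {1..l}"
  shows "(\<Sum>m\<in>path_indices k l (Suc N) h. real (m j) * F m * index_weight l lam m) =
    (\<Sum>m\<in>path_indices k l N (h + k * j). F (m(j := Suc (m j))) * (lam j * index_weight l lam m))"
proof -
  have gamma: "gamma0 k l h (\<Sum>i=1..l. (m(j := Suc (m j))) i) (m(j := Suc (m j))) =
      Suc (gamma0 k l (h + k * j) (\<Sum>i=1..l. m i) m)" for m
    using sum_fun_upd_Suc[OF j, of "\<lambda>_. 1" m] sum_fun_upd_Suc[OF j, of "\<lambda>i. i" m]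
    by (simp add: gamma0_def algebra_simps)
  have "(\<Sum>m\<in>path_indices k l (Suc N) h. real (m j) * F m * index_weight l lam m) =
      (\<Sum>m\<in>{m\<in>path_indices k l (Suc N) h. 0 < m j}. real (m j) * F m * index_weight l lam m)"
    by (rule sum.mono_neutral_right) (auto simp: finite_path_indices)
  also have "\<dots> = (\<Sum>m\<in>path_indices k l N (h + k * j).
       real (Suc (m j)) * F (m(j := Suc (m j))) * index_weight l lam (m(j := Suc (m j))))"
  proof (rule sum.reindex_bij_witness[where i = "\<lambda>m. m(j := Suc (m j))" and j = "\<lambda>m. m(j := m j - 1)"])
    fix m assume m: "m \<in> {m\<in>path_indices k l (Suc N) h. 0 < m j}"
    define m' where "m' = m(j := m j - 1)"
    have m'_eq: "m = m'(j := Suc (m' j))" using m by (auto simp: m'_def)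
    show "(m(j := m j - 1))(j := Suc ((m(j := m j - 1)) j)) = m" using m'_eq by (simp add: m'_def)
    then show "real (Suc ((m(j := m j - 1)) j)) * F ((m(j := m j - 1))(j := Suc ((m(j := m j - 1)) j))) *
        index_weight l lam ((m(j := m j - 1))(j := Suc ((m(j := m j - 1)) j))) =
        real (m j) * F m * index_weight l lam m" using m by simp
    have "m' \<in> {1..l} \<rightarrow>\<^sub>E UNIV" using m j by (auto simp: m'_def path_indices_def PiE_iff extensional_def)
    moreover have "Suc (gamma0 k l (h + k * j) (\<Sum>i=1..l. m' i) m') = Suc (Suc N)"
      using gamma[of m'] m unfolding m'_eq[symmetric] by (simp add: path_indices_def)
    ultimately show "m(j := m j - 1) \<in> path_indices k l N (h + k * j)"
      by (simp add: path_indices_def m'_def)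
  next
    fix m assume m: "m \<in> path_indices k l N (h + k * j)"
    show "(m(j := Suc (m j)))(j := (m(j := Suc (m j))) j - 1) = m" by simp
    have "m(j := Suc (m j)) \<in> {1..l} \<rightarrow>\<^sub>E UNIV"
      using m j by (auto simp: path_indices_def PiE_iff extensional_def)
    then show "m(j := Suc (m j)) \<in> {m\<in>path_indices k l (Suc N) h. 0 < m j}"
      using m gamma[of m] by (simp add: path_indices_def)
  qed
  also have "\<dots> = (\<Sum>m\<in>path_indices k l N (h + k * j). F (m(j := Suc (m j))) * (lam j * index_weight l lam m))"
    by (intro sum.cong refl) (simp add: index_weight_fun_upd_Suc[OF j, symmetric] del: of_nat_Suc)
  finally show ?thesis .
qed

locale erlang_parameters =
  fixes k l :: nat and mu :: real and lam :: "nat \<Rightarrow> real"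
  assumes k: "1 \<le> k" and l: "1 \<le> l" and mu: "0 < mu"
    and lam: "\<And>m. m \<in> {1..l} \<Longrightarrow> 0 < lam m"
begin

definition jump_rate :: real where "jump_rate = total_rate l lam + real k * mu"

lemma total_rate_pos: "0 < total_rate l lam"
  unfolding total_rate_def using l lam by (intro sum_pos) auto

lemma jump_rate_pos: "0 < jump_rate"
  using total_rate_pos k mu by (simp add: jump_rate_def add_pos_nonneg)

lemma C0_eq:
  assumes "m \<in> path_indices k l N h"
  shows "C0 k l mu lam h (\<Sum>j=1..l. m j) m =
    real h * index_weight l lam m * ((real k * mu) ^ (h + k * (\<Sum>j=1..l. j * m j) - 1) /
      fact (h + k * (\<Sum>j=1..l. j * m j))) * fact N"
proof -
  have "total_rate l lam ^ (\<Sum>j=1..l. m j) * (\<Prod>i=1..l. arrival_prob l lam i ^ m i / fact (m i)) =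
      index_weight l lam m"
    using total_rate_pos
    by (simp add: power_sum index_weight_def arrival_prob_def power_divide flip: prod.distrib)
  moreover have "gamma0 k l h (\<Sum>j=1..l. m j) m = Suc N" using assms by (simp add: path_indices_def)
  moreover have "gamma0 k l h (\<Sum>j=1..l. m j) m - (\<Sum>j=1..l. m j) = h + k * (\<Sum>j=1..l. j * m j)"
    by (simp add: gamma0_def)
  ultimately show ?thesis by (simp add: C0_def)
qed

text \<open>
Weight of the walks that reach \<open>- h\<close> for the first time at step \<open>Suc N\<close>, where the last step,
necessarily a service event, is left unweighted. In this reading the definition is the hitting-time
theorem: \<open>C0\<close> is \<open>h / Suc N\<close> times a multinomial weight.
\<close>

definition hitting_coeff :: "nat \<Rightarrow> nat \<Rightarrow> real" where
  "hitting_coeff N h = (\<Sum>m\<in>path_indices k l N h. C0 k l mu lam h (\<Sum>j=1..l. m j) m)"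

lemma hitting_coeff_level_0: "hitting_coeff N 0 = 0"
  by (simp add: hitting_coeff_def C0_def)

lemma hitting_coeff_eq_0:
  assumes "Suc N < h" shows "hitting_coeff N h = 0"
proof -
  have "path_indices k l N h = {}" using assms by (auto simp: path_indices_def gamma0_def)
  then show ?thesis by (simp add: hitting_coeff_def)
qed

lemma hitting_coeff_0: "hitting_coeff 0 h = (if h = 1 then 1 else 0)"
proof -
  consider "h = 0" | "h = 1" | "1 < h" by linarith
  then show ?thesis
  proof cases
    case 2
    have "path_indices k l 0 h = {restrict (\<lambda>_. 0) {1..l}}"
      using 2 by (auto simp: path_indices_def gamma0_def PiE_iff extensional_def fun_eq_iff)
    moreover have "index_weight l lam (restrict (\<lambda>_. 0) {1..l}) = 1"
      by (simp add: index_weight_def)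
    ultimately show ?thesis
      unfolding hitting_coeff_def using 2 C0_eq[of "restrict (\<lambda>_. 0) {1..l}" 0 h] by simp
  qed (use hitting_coeff_level_0 hitting_coeff_eq_0[of 0 h] in simp_all)
qed

text \<open>
Decomposition of first passage by the first step. For an index with \<open>n\<close> batches and
\<open>d = (\<Sum>j. j * m j)\<close>, where \<open>h + n + k * d = N + 2\<close>, it amounts to
\<open>(\<Sum>j. m j * (h + k * j)) + (h - 1) * (h + k * d) = h * (N + 1)\<close>.
\<close>

lemma hitting_coeff_Suc:
  assumes h: "1 \<le> h"
  shows "hitting_coeff (Suc N) h =
    (\<Sum>j=1..l. lam j * hitting_coeff N (h + k * j)) + real k * mu * hitting_coeff N (h - 1)"
proof -
  let ?I = "path_indices k l (Suc N) h"
  define d where "d m = (\<Sum>j=1..l. j * m j)" for m :: "nat \<Rightarrow> nat"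
  define P where "P m = (real k * mu) ^ (h + k * d m - 1) / fact (h + k * d m) * fact N" for m
  let ?v = "index_weight l lam"
  have arr: "lam j * hitting_coeff N (h + k * j) =
      (\<Sum>m\<in>?I. real (m j) * (real (h + k * j) * P m) * ?v m)" if j: "j \<in> {1..l}" for j
  proof -
    have d_upd: "h + k * d (m(j := Suc (m j))) = h + k * j + k * d m" for m
      using sum_fun_upd_Suc[OF j, of "\<lambda>i. i" m] unfolding d_def by (simp add: algebra_simps)
    have "lam j * hitting_coeff N (h + k * j) =
        (\<Sum>m\<in>path_indices k l N (h + k * j). real (h + k * j) * P (m(j := Suc (m j))) * (lam j * ?v m))"
      unfolding hitting_coeff_def sum_distrib_left
    proof (intro sum.cong refl)
      fix m assume m: "m \<in> path_indices k l N (h + k * j)"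
      show "lam j * C0 k l mu lam (h + k * j) (\<Sum>j=1..l. m j) m =
          real (h + k * j) * P (m(j := Suc (m j))) * (lam j * ?v m)"
        unfolding C0_eq[OF m] P_def d_upd by (simp add: d_def)
    qed
    then show ?thesis by (simp only: sum_path_indices_shift[OF j])
  qed
  have srv: "real k * mu * hitting_coeff N (h - 1) =
      (\<Sum>m\<in>?I. (real h - 1) * real (h + k * d m) * P m * ?v m)"
  proof -
    have I_eq: "path_indices k l N (h - 1) = ?I"
      using h by (cases h) (auto simp: path_indices_def gamma0_def)
    show ?thesis
      unfolding hitting_coeff_def sum_distrib_left I_eq
    proof (intro sum.cong refl)
      fix m assume "m \<in> ?I"
      then have m: "m \<in> path_indices k l N (h - 1)" by (simp only: I_eq)
      obtain h' where h': "h = Suc h'" using h by (cases h) auto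
      show "real k * mu * C0 k l mu lam (h - 1) (\<Sum>j=1..l. m j) m =
          (real h - 1) * real (h + k * d m) * P m * ?v m"
      proof (cases "h' = 0")
        case True then show ?thesis by (simp add: h' C0_def)
      next
        case False
        then obtain r where r: "h' + k * d m = Suc r" by (cases "h' + k * d m") auto
        have c0: "C0 k l mu lam h' (\<Sum>j=1..l. m j) m = real h' * ?v m * ((real k * mu) ^ r / fact (Suc r)) * fact N"
          using C0_eq[OF m] r by (simp add: h' d_def)
        have p: "P m = (real k * mu) ^ Suc r / (real (Suc (Suc r)) * fact (Suc r)) * fact N"
          using r fact_Suc[of "Suc r", where 'a = real] by (simp only: P_def h' add_Suc diff_Suc_1)
        have e: "h + k * d m = Suc (Suc r)" "real h - 1 = real h'" "h - 1 = h'"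
          using r by (simp_all add: h')
        have "real (Suc (Suc r)) \<noteq> 0" "fact (Suc r) \<noteq> (0::real)" by simp_all
        then show ?thesis
          unfolding e c0 p by (simp add: field_simps del: of_nat_Suc fact_Suc)
      qed
    qed
  qed
  have "(\<Sum>j=1..l. lam j * hitting_coeff N (h + k * j)) + real k * mu * hitting_coeff N (h - 1) =
      (\<Sum>m\<in>?I. (\<Sum>j=1..l. real (m j) * real (h + k * j)) * (P m * ?v m) +
         (real h - 1) * real (h + k * d m) * P m * ?v m)"
    unfolding srv sum.distrib
    by (subst sum.cong[OF refl arr], assumption, subst sum.swap)
       (simp add: sum_distrib_left sum_distrib_right mult_ac)
  also have "\<dots> = (\<Sum>m\<in>?I. real h * ?v m * (P m * real (Suc N)))"
  proof (intro sum.cong refl)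
    fix m assume m: "m \<in> ?I"
    define n where "n = (\<Sum>j=1..l. m j)"
    have "h + n + k * d m = Suc (Suc N)" using m by (simp add: path_indices_def gamma0_def n_def d_def)
    then have N: "real h + real n + real k * real (d m) = real (Suc N) + 1"
      by (metis of_nat_Suc of_nat_add of_nat_mult add.commute)
    have "(\<Sum>j=1..l. real (m j) * real (h + k * j)) = real h * real n + real k * real (d m)"
      by (simp add: n_def d_def sum_distrib_left algebra_simps sum.distrib)
    then have "(\<Sum>j=1..l. real (m j) * real (h + k * j)) + (real h - 1) * real (h + k * d m) =
        real h * (real h + real n + real k * real (d m)) - real h" by (simp add: algebra_simps)
    also have "\<dots> = real h * real (Suc N)" unfolding N by (simp add: algebra_simps)
    finally have "((\<Sum>j=1..l. real (m j) * real (h + k * j)) + (real h - 1) * real (h + k * d m)) * (P m * ?v m)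
       = real h * real (Suc N) * (P m * ?v m)" by simp
    then show "(\<Sum>j=1..l. real (m j) * real (h + k * j)) * (P m * ?v m) +
         (real h - 1) * real (h + k * d m) * P m * ?v m = real h * ?v m * (P m * real (Suc N))"
      by (simp only: distrib_left distrib_right mult_ac)
  qed
  also have "\<dots> = hitting_coeff (Suc N) h"
    unfolding hitting_coeff_def
  proof (intro sum.cong refl)
    fix m assume m: "m \<in> ?I"
    show "real h * ?v m * (P m * real (Suc N)) = C0 k l mu lam h (\<Sum>j=1..l. m j) m"
      unfolding C0_eq[OF m] P_def d_def by (simp add: mult_ac)
  qed
  finally show ?thesis by simp
qed

text \<open>
Weight of the \<open>N\<close>-step paths from phase \<open>h\<close> to phase 0 of the walk reflected at 0. The truncated
subtraction in \<open>h - 1\<close> is the reflection: a service event at an empty queue has no effect.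
\<close>

fun empty_coeff :: "nat \<Rightarrow> nat \<Rightarrow> real" where
  "empty_coeff 0 h = (if h = 0 then 1 else 0)"
| "empty_coeff (Suc N) h =
     (\<Sum>m=1..l. lam m * empty_coeff N (h + k * m)) + real k * mu * empty_coeff N (h - 1)"

text \<open>
Started in \<open>h\<close>, the reflected walk is at 0 if the free walk is at its running minimum and has come
down by at least \<open>h\<close>. One more service step then completes a first passage to a depth \<open>i > h\<close>. The
proof is by the recursion that both sides satisfy; depths beyond \<open>Suc N\<close> contribute nothing, which
leaves the upper limit \<open>R\<close> free in the induction.
\<close>

lemma empty_coeff_eq_sum:
  "Suc N \<le> R \<Longrightarrow> empty_coeff N h = (\<Sum>i\<in>{h<..R}. hitting_coeff N i)"
proof (induction N arbitrary: h R)
  case 0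
  have "(\<Sum>i\<in>{h<..R}. hitting_coeff 0 i) = (\<Sum>i\<in>{h<..R}. if i = 1 then 1 else 0)"
    by (intro sum.cong refl) (simp only: hitting_coeff_0)
  also have "\<dots> = (if h = 0 then 1 else 0)" using 0 by (subst sum.delta) auto
  finally show ?case by simp
next
  case (Suc N)
  have "(\<Sum>i\<in>{h<..R}. hitting_coeff (Suc N) i) =
      (\<Sum>i\<in>{h<..R}. (\<Sum>j=1..l. lam j * hitting_coeff N (i + k * j)) + real k * mu * hitting_coeff N (i - 1))"
    by (intro sum.cong refl hitting_coeff_Suc) auto
  also have "\<dots> = (\<Sum>j=1..l. lam j * (\<Sum>i\<in>{h<..R}. hitting_coeff N (i + k * j))) +
      real k * mu * (\<Sum>i\<in>{h<..R}. hitting_coeff N (i - 1))"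
    by (simp add: sum.distrib sum_distrib_left) (rule sum.swap)
  also have "(\<Sum>i\<in>{h<..R}. hitting_coeff N (i - 1)) = empty_coeff N (h - 1)"
  proof -
    have "(\<Sum>i\<in>{h<..R}. hitting_coeff N (i - 1)) = (\<Sum>i\<in>{h..R - 1}. hitting_coeff N i)"
      by (rule sum.reindex_bij_witness[where i = Suc and j = "\<lambda>i. i - 1"])
         (use Suc.prems in auto)
    also have "\<dots> = (\<Sum>i\<in>{h - 1<..R - 1}. hitting_coeff N i)"
    proof (rule sum.mono_neutral_right)
      show "\<forall>i\<in>{h..R - 1} - {h - 1<..R - 1}. hitting_coeff N i = 0"
      proof
        fix i assume "i \<in> {h..R - 1} - {h - 1<..R - 1}"
        then have "i = 0" by auto
        then show "hitting_coeff N i = 0" by (simp add: hitting_coeff_level_0)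
      qed
    qed auto
    also have "\<dots> = empty_coeff N (h - 1)" using Suc.prems by (intro Suc.IH[symmetric]) auto
    finally show ?thesis .
  qed
  also have "(\<Sum>j=1..l. lam j * (\<Sum>i\<in>{h<..R}. hitting_coeff N (i + k * j))) =
      (\<Sum>j=1..l. lam j * empty_coeff N (h + k * j))"
  proof (intro sum.cong refl arg_cong2[where f = "(*)"])
    fix j
    have "(\<Sum>i\<in>{h<..R}. hitting_coeff N (i + k * j)) = (\<Sum>i\<in>{h + k * j<..R + k * j}. hitting_coeff N i)"
      by (rule sum.reindex_bij_witness[where i = "\<lambda>i. i - k * j" and j = "\<lambda>i. i + k * j"]) auto
    also have "\<dots> = empty_coeff N (h + k * j)" using Suc.prems by (intro Suc.IH[symmetric]) auto
    finally show "(\<Sum>i\<in>{h<..R}. hitting_coeff N (i + k * j)) = empty_coeff N (h + k * j)" .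
  qed
  finally show ?case by simp
qed

end

section \<open>Empty probability and mean length before the time change\<close>

context erlang_parameters
begin

lemma empty_coeff_nonneg: "0 \<le> empty_coeff N h"
proof (induction N arbitrary: h)
  case (Suc N)
  then show ?case unfolding empty_coeff.simps using lam mu
    by (intro add_nonneg_nonneg sum_nonneg mult_nonneg_nonneg) (auto intro: less_imp_le)
qed simp

lemma empty_coeff_le: "empty_coeff N h \<le> jump_rate ^ N"
proof (induction N arbitrary: h)
  case (Suc N)
  have "empty_coeff (Suc N) h \<le> (\<Sum>m=1..l. lam m * jump_rate ^ N) + real k * mu * jump_rate ^ N"
    unfolding empty_coeff.simps using Suc lam mu
    by (intro add_mono sum_mono mult_left_mono) (auto intro: less_imp_le)
  also have "\<dots> = jump_rate ^ Suc N"
    by (simp add: jump_rate_def total_rate_def sum_distrib_right algebra_simps)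
  finally show ?case .
qed simp

definition empty_series :: "real \<Rightarrow> nat \<Rightarrow> real" where
  "empty_series t h = (\<Sum>N. empty_coeff N h / fact N * t ^ N)"

text \<open>
The exponential of \<open>t\<close> times the generator, applied to the indicator of the empty queue, as a
function of the number \<open>h\<close> of phases.
\<close>

definition empty_prob :: "real \<Rightarrow> nat \<Rightarrow> real" where
  "empty_prob t h = exp (- jump_rate * t) * empty_series t h"

lemma summable_empty_series: "summable (\<lambda>N. empty_coeff N h / fact N * t ^ N)"
proof (rule summable_comparison_test[OF _ summable_exp[of "jump_rate * \<bar>t\<bar>"]], intro exI allI impI)
  fix N
  have "norm (empty_coeff N h / fact N * t ^ N) \<le> jump_rate ^ N / fact N * \<bar>t\<bar> ^ N"
    using empty_coeff_nonneg[of N h] empty_coeff_le[of N h]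
    by (simp add: abs_mult power_abs divide_right_mono mult_right_mono)
  then show "norm (empty_coeff N h / fact N * t ^ N) \<le> inverse (fact N) * (jump_rate * \<bar>t\<bar>) ^ N"
    by (simp add: power_mult_distrib field_simps)
qed

lemma empty_series_derivative:
  "((\<lambda>t. empty_series t h) has_real_derivative
     (\<Sum>m=1..l. lam m * empty_series t (h + k * m)) + real k * mu * empty_series t (h - 1)) (at t)"
proof -
  have "((\<lambda>t. \<Sum>N. empty_coeff N h / fact N * t ^ N) has_real_derivative
      (\<Sum>N. diffs (\<lambda>N. empty_coeff N h / fact N) N * t ^ N)) (at t)"
    by (rule termdiffs_strong_converges_everywhere) (rule summable_empty_series)
  moreover have "diffs (\<lambda>N. empty_coeff N h / fact N) N * t ^ N =
      (\<Sum>m=1..l. lam m * (empty_coeff N (h + k * m) / fact N * t ^ N)) +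
      real k * mu * (empty_coeff N (h - 1) / fact N * t ^ N)" for N
  proof -
    have "diffs (\<lambda>N. empty_coeff N h / fact N) N = empty_coeff (Suc N) h / fact N"
      by (simp add: diffs_def del: of_nat_Suc empty_coeff.simps)
    moreover have "(\<Sum>m=1..l. lam m * (empty_coeff N (h + k * m) / fact N * t ^ N)) =
        (\<Sum>m=1..l. lam m * empty_coeff N (h + k * m)) / fact N * t ^ N"
      unfolding sum_divide_distrib sum_distrib_right by (intro sum.cong refl) simp
    ultimately show ?thesis by (simp add: add_divide_distrib distrib_right)
  qed
  moreover have "(\<Sum>N. (\<Sum>m=1..l. lam m * (empty_coeff N (h + k * m) / fact N * t ^ N)) +
      real k * mu * (empty_coeff N (h - 1) / fact N * t ^ N)) =
      (\<Sum>m=1..l. lam m * empty_series t (h + k * m)) + real k * mu * empty_series t (h - 1)"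
    unfolding empty_series_def
    by (intro sums_unique[symmetric] sums_add sums_sum sums_mult summable_sums summable_empty_series)
  ultimately show ?thesis by (simp add: empty_series_def)
qed

definition empty_prob_deriv :: "real \<Rightarrow> nat \<Rightarrow> real" where
  "empty_prob_deriv t h = (\<Sum>m=1..l. lam m * (empty_prob t (h + k * m) - empty_prob t h)) +
     real k * mu * (empty_prob t (h - 1) - empty_prob t h)"

text \<open>
The backward equation, read off from the recursion for the coefficients.
\<close>

lemma empty_prob_derivative:
  "((\<lambda>t. empty_prob t h) has_real_derivative empty_prob_deriv t h) (at t)"
  unfolding empty_prob_def
  by (rule derivative_eq_intros empty_series_derivative refl | simp)+
     (simp add: empty_prob_deriv_def empty_prob_def jump_rate_def total_rate_def algebra_simps
        sum_subtractf sum_distrib_left sum_distrib_right)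

lemma continuous_on_empty_prob: "continuous_on A (\<lambda>s. empty_prob s h)"
  by (intro continuous_at_imp_continuous_on ballI DERIV_isCont[OF empty_prob_derivative])

lemma empty_prob_nonneg: "0 \<le> t \<Longrightarrow> 0 \<le> empty_prob t h"
  unfolding empty_prob_def empty_series_def
  by (intro mult_nonneg_nonneg suminf_nonneg summable_empty_series) (auto simp: empty_coeff_nonneg)

lemma empty_prob_le_1:
  assumes "0 \<le> t" shows "empty_prob t h \<le> 1"
proof -
  have "empty_series t h \<le> (\<Sum>N. inverse (fact N) * (jump_rate * t) ^ N)"
    unfolding empty_series_def
  proof (intro suminf_le summable_empty_series summable_exp)
    fix N
    have "empty_coeff N h / fact N * t ^ N \<le> jump_rate ^ N / fact N * t ^ N"
      using assms empty_coeff_le[of N h] by (intro mult_right_mono divide_right_mono) auto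
    then show "empty_coeff N h / fact N * t ^ N \<le> inverse (fact N) * (jump_rate * t) ^ N"
      by (simp add: power_mult_distrib field_simps)
  qed
  also have "\<dots> = exp (jump_rate * t)" by (simp add: exp_def scaleR_conv_of_real)
  finally show ?thesis unfolding empty_prob_def by (simp add: exp_minus field_simps)
qed

lemma empty_prob_0: "empty_prob 0 h = (if h = 0 then 1 else 0)"
proof -
  have "empty_series 0 h = empty_coeff 0 h / fact 0"
    unfolding empty_series_def using powser_zero[of "\<lambda>N. empty_coeff N h / fact N"] by simp
  then show ?thesis by (simp add: empty_prob_def)
qed

lemma empty_prob_deriv_le:
  assumes "0 \<le> t" shows "\<bar>empty_prob_deriv t h\<bar> \<le> jump_rate"
proof -
  have d: "\<bar>empty_prob t i - empty_prob t h\<bar> \<le> 1" for i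
    using empty_prob_nonneg[OF assms] empty_prob_le_1[OF assms]
    by (simp add: abs_le_iff) (smt (verit))
  have "\<bar>empty_prob_deriv t h\<bar> \<le> \<bar>\<Sum>m=1..l. lam m * (empty_prob t (h + k * m) - empty_prob t h)\<bar> +
     \<bar>real k * mu * (empty_prob t (h - 1) - empty_prob t h)\<bar>"
    unfolding empty_prob_deriv_def by (rule abs_triangle_ineq)
  also have "\<dots> \<le> (\<Sum>m=1..l. lam m * 1) + real k * mu * 1"
  proof (intro add_mono)
    have "\<bar>\<Sum>m=1..l. lam m * (empty_prob t (h + k * m) - empty_prob t h)\<bar> \<le>
        (\<Sum>m=1..l. \<bar>lam m * (empty_prob t (h + k * m) - empty_prob t h)\<bar>)" by (rule sum_abs)
    also have "\<dots> \<le> (\<Sum>m=1..l. lam m * 1)"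
      using lam d unfolding abs_mult
      by (intro sum_mono mult_mono) (auto simp: less_imp_le abs_of_pos)
    finally show "\<bar>\<Sum>m=1..l. lam m * (empty_prob t (h + k * m) - empty_prob t h)\<bar> \<le> (\<Sum>m=1..l. lam m * 1)" .
    show "\<bar>real k * mu * (empty_prob t (h - 1) - empty_prob t h)\<bar> \<le> real k * mu * 1"
      using mu d[of "h - 1"] unfolding abs_mult by (intro mult_mono) auto
  qed
  also have "\<dots> = jump_rate" by (simp add: jump_rate_def total_rate_def)
  finally show ?thesis .
qed

lemma empty_prob_Lipschitz:
  assumes "0 \<le> s" "s \<le> t"
  shows "\<bar>empty_prob t h - empty_prob s h\<bar> \<le> jump_rate * (t - s)"
proof (cases "s = t")
  case False
  then obtain z where z: "s < z" "z < t" "empty_prob t h - empty_prob s h = (t - s) * empty_prob_deriv z h"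
    using MVT2[of s t "\<lambda>t. empty_prob t h" "\<lambda>t. empty_prob_deriv t h"] assms empty_prob_derivative by auto
  have "\<bar>empty_prob t h - empty_prob s h\<bar> = (t - s) * \<bar>empty_prob_deriv z h\<bar>"
    using z assms by (simp add: abs_mult)
  also have "\<dots> \<le> (t - s) * jump_rate"
    using z assms by (intro mult_left_mono empty_prob_deriv_le) auto
  finally show ?thesis by (simp add: mult.commute)
qed simp

definition erlang_targets :: "nat \<times> nat \<Rightarrow> (nat \<times> nat) set" where
  "erlang_targets x = (\<lambda>m. arrival_target k m x) ` {1..l} \<union> (if x \<noteq> (0, 0) then {service_target k x} else {})"

lemma erlang_targets_subset:
  assumes "x \<in> erlang_states k" shows "erlang_targets x \<subseteq> erlang_states k - {x}"
  using assms k by (cases x) (auto simp: erlang_targets_def erlang_states_def split: if_splits)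

lemma phase_arrival:
  assumes "x \<in> erlang_states k" shows "phase_number k (arrival_target k m x) = phase_number k x + k * m"
proof (cases x)
  case (Pair n s)
  show ?thesis
  proof (cases "n = 0")
    case True then show ?thesis using Pair assms by (cases m) (auto simp: erlang_states_def)
  next
    case False
    then obtain n' where "n = Suc n'" by (cases n) auto
    then show ?thesis using Pair by (simp add: algebra_simps)
  qed
qed

lemma phase_service:
  assumes "x \<in> erlang_states k" "x \<noteq> (0, 0)"
  shows "phase_number k (service_target k x) = phase_number k x - 1"
proof (cases x)
  case (Pair n s)
  then have ns: "1 \<le> n" "1 \<le> s" "s \<le> k" using assms by (auto simp: erlang_states_def)
  consider "2 \<le> s" | "s = 1" "2 \<le> n" | "s = 1" "n = 1" using ns by linarith
  then show ?thesis
  proof cases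
    case 1 then show ?thesis using Pair ns by simp
  next
    case 2
    then obtain n' where "n = Suc (Suc n')" by (metis add_2_eq_Suc le_Suc_ex)
    then show ?thesis using Pair 2 by simp
  next
    case 3 then show ?thesis using Pair by simp
  qed
qed

lemma phase_eq_0_iff: "x \<in> erlang_states k \<Longrightarrow> phase_number k x = 0 \<longleftrightarrow> x = (0, 0)"
  by (cases x) (auto simp: erlang_states_def)

lemma sum_erlang_rate:
  assumes "x \<in> erlang_states k"
  shows "(\<Sum>y\<in>erlang_targets x. erlang_rate k l mu lam x y * \<phi> y) =
    (\<Sum>m=1..l. lam m * \<phi> (arrival_target k m x)) +
    (if x \<noteq> (0, 0) then real k * mu * \<phi> (service_target k x) else 0)"
proof -
  let ?T = "erlang_targets x"
  have fin: "finite ?T" by (simp add: erlang_targets_def)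
  have "(\<Sum>y\<in>?T. erlang_rate k l mu lam x y * \<phi> y) =
      (\<Sum>y\<in>?T. \<Sum>m=1..l. if y = arrival_target k m x then lam m * \<phi> y else 0) +
      (\<Sum>y\<in>?T. if x \<noteq> (0, 0) \<and> y = service_target k x then real k * mu * \<phi> y else 0)"
    unfolding erlang_rate_def distrib_right sum.distrib sum_distrib_right
    by (intro arg_cong2[where f = "(+)"] sum.cong refl) auto
  also have "(\<Sum>y\<in>?T. \<Sum>m=1..l. if y = arrival_target k m x then lam m * \<phi> y else 0) =
      (\<Sum>m=1..l. lam m * \<phi> (arrival_target k m x))"
    by (subst sum.swap, intro sum.cong refl, subst sum.delta[OF fin]) (auto simp: erlang_targets_def)
  also have "(\<Sum>y\<in>?T. if x \<noteq> (0, 0) \<and> y = service_target k x then real k * mu * \<phi> y else 0) =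
      (if x \<noteq> (0, 0) then real k * mu * \<phi> (service_target k x) else 0)"
    using fin by (cases "x = (0, 0)") (auto simp: sum.delta erlang_targets_def)
  finally show ?thesis .
qed

end

locale erlang_kernel = erlang_parameters +
  fixes p :: "real \<Rightarrow> nat \<times> nat \<Rightarrow> nat \<times> nat \<Rightarrow> real"
  assumes transition: "transition_function (erlang_states k) p"
    and rates: "has_transition_rates (erlang_states k) p (erlang_rate k l mu lam)"
begin

abbreviation "K \<equiv> transition_kernel (erlang_states k) p"

sublocale bounded_rate_kernel "erlang_states k" K "erlang_rate k l mu lam" erlang_targets jump_rate
proof (rule bounded_rate_kernel_transition_kernel[OF transition rates])
  fix x assume x: "x \<in> erlang_states k"
  show "finite (erlang_targets x)" by (simp add: erlang_targets_def)
  show "erlang_targets x \<subseteq> erlang_states k - {x}" by (rule erlang_targets_subset[OF x])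
  show "erlang_rate k l mu lam x y = 0" if "y \<in> erlang_states k - {x} - erlang_targets x" for y
    using that by (auto simp: erlang_rate_def erlang_targets_def intro!: sum.neutral split: if_splits)
  show "(\<Sum>y\<in>erlang_targets x. erlang_rate k l mu lam x y) \<le> jump_rate"
    using sum_erlang_rate[OF x, of "\<lambda>_. 1"] mu by (auto simp: jump_rate_def total_rate_def)
qed

lemma origin_state: "(0, 0) \<in> erlang_states k" by (simp add: erlang_states_def)

lemma generator_phase:
  assumes x: "x \<in> erlang_states k"
  shows "generator (\<lambda>y. f (phase_number k y)) x =
    (\<Sum>m=1..l. lam m * (f (phase_number k x + k * m) - f (phase_number k x))) +
    real k * mu * (f (phase_number k x - 1) - f (phase_number k x))"
proof -
  have "generator (\<lambda>y. f (phase_number k y)) x =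
    (\<Sum>m=1..l. lam m * (f (phase_number k (arrival_target k m x)) - f (phase_number k x))) +
    (if x \<noteq> (0, 0) then real k * mu * (f (phase_number k (service_target k x)) - f (phase_number k x)) else 0)"
    unfolding generator_def by (rule sum_erlang_rate[OF x])
  also have "\<dots> = (\<Sum>m=1..l. lam m * (f (phase_number k x + k * m) - f (phase_number k x))) +
    real k * mu * (f (phase_number k x - 1) - f (phase_number k x))"
    using phase_service[OF x] unfolding phase_arrival[OF x] by (cases "x = (0, 0)") auto
  finally show ?thesis .
qed

text \<open>
The mean of \<open>empty_prob (t - s)\<close> at the state of time \<open>s\<close> does not depend on \<open>s\<close>. At \<open>s = 0\<close> it is
\<open>empty_prob t 0\<close>, at \<open>s = t\<close> it is the probability of an empty queue.
\<close>

lemma pmf_empty: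
  assumes t: "0 \<le> t"
  shows "pmf (K t (0, 0)) (0, 0) = empty_prob t 0"
proof -
  let ?W = "\<lambda>s y. empty_prob (t - s) (phase_number k y)"
  let ?W' = "\<lambda>s y. - empty_prob_deriv (t - s) (phase_number k y)"
  have "(\<integral>y. ?W t y \<partial>K t (0, 0)) = ?W 0 (0, 0)"
  proof (rule expectation_space_time_const[OF origin_state t, where W' = ?W' and B = 1 and C = jump_rate])
    show "\<bar>?W u y\<bar> \<le> 1" if "0 \<le> u" "u \<le> t" for u y
      using that empty_prob_nonneg[of "t - u"] empty_prob_le_1[of "t - u"] by simp
    show "\<bar>?W v y - ?W u y\<bar> \<le> jump_rate * (v - u)" if "0 \<le> u" "u \<le> v" "v \<le> t" for u v y
      using empty_prob_Lipschitz[of "t - v" "t - u" "phase_number k y"] that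
      by (simp add: abs_minus_commute)
    fix s assume s: "0 \<le> s" "s < t"
    show "((\<lambda>d. (?W (s + d) y - ?W s y) / d) \<longlongrightarrow> ?W' s y) (at_right 0)" for y
    proof -
      have "((\<lambda>s. ?W s y) has_real_derivative empty_prob_deriv (t - s) (phase_number k y) * (- 1)) (at s)"
        by (rule DERIV_chain2[OF empty_prob_derivative]) (auto intro!: derivative_eq_intros)
      then have "((\<lambda>d. (?W (s + d) y - ?W s y) / d) \<longlongrightarrow> ?W' s y) (at 0)"
        by (simp add: DERIV_def)
      then show ?thesis by (rule tendsto_mono[rotated]) (simp add: at_le)
    qed
    have "(\<integral>x. ?W' s x + generator (?W s) x \<partial>K s (0, 0)) = (\<integral>x. 0 \<partial>K s (0, 0))"
    proof (intro integral_cong_AE AE_pmfI)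
      fix x assume "x \<in> set_pmf (K s (0, 0))"
      then have "x \<in> erlang_states k" using K_closed[OF origin_state s(1)] by auto
      then show "?W' s x + generator (?W s) x = 0"
        by (simp add: generator_phase empty_prob_deriv_def)
    qed auto
    then show "(\<integral>x. ?W' s x + generator (?W s) x \<partial>K s (0, 0)) = 0" by simp
  qed
  moreover have "(\<integral>y. ?W t y \<partial>K t (0, 0)) = (\<integral>y. indicator {(0, 0)} y \<partial>K t (0, 0))"
    using K_closed[OF origin_state t] phase_eq_0_iff
    by (intro integral_cong_AE AE_pmfI) (auto simp: empty_prob_0 indicator_def)
  ultimately show ?thesis by (simp add: measure_pmf_single)
qed

definition drift :: real where
  "drift = real k * (\<Sum>m=1..l. real m * lam m) - real k * mu"

definition mean_phases :: "real \<Rightarrow> real" where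
  "mean_phases t = drift * t + real k * mu * integral {0..t} (\<lambda>s. empty_prob s 0)"

text \<open>
The generator maps the truncations \<open>min L N\<close> to functions that are bounded uniformly in \<open>N\<close> and
converge to \<open>drift\<close> plus \<open>k * mu\<close> times the indicator of the empty queue, so the limit may be taken
inside the integral in Dynkin's formula.
\<close>

lemma nn_integral_phase_number:
  assumes t: "0 \<le> t"
  shows "(\<integral>\<^sup>+y. ennreal (real (phase_number k y)) \<partial>K t (0, 0)) = ennreal (mean_phases t)"
    and "0 \<le> mean_phases t"
proof -
  let ?g = "phase_number k" and ?K = "\<lambda>s. K s (0, 0)"
  define f where "f N i = min (real i) (real N)" for N i :: nat
  define \<psi> where "\<psi> N y = (let i = ?g y in
    (\<Sum>m=1..l. lam m * (f N (i + k * m) - f N i)) + real k * mu * (f N (i - 1) - f N i))" for N y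
  define \<psi>' where "\<psi>' y = drift + real k * mu * indicator {0} (?g y)" for y
  define C where "C = (\<Sum>m=1..l. lam m * real (k * m)) + real k * mu"
  have f_diff: "\<bar>f N i - f N j\<bar> \<le> \<bar>real i - real j\<bar>" for N i j by (auto simp: f_def min_def)
  have \<psi>_bound: "\<bar>\<psi> N y\<bar> \<le> C" for N y
  proof -
    let ?i = "?g y"
    have "\<bar>\<psi> N y\<bar> \<le> \<bar>\<Sum>m=1..l. lam m * (f N (?i + k * m) - f N ?i)\<bar> + \<bar>real k * mu * (f N (?i - 1) - f N ?i)\<bar>"
      unfolding \<psi>_def Let_def by (rule abs_triangle_ineq)
    also have "\<dots> \<le> C" unfolding C_def
    proof (intro add_mono)
      have "\<bar>\<Sum>m=1..l. lam m * (f N (?i + k * m) - f N ?i)\<bar> \<le>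
          (\<Sum>m=1..l. \<bar>lam m * (f N (?i + k * m) - f N ?i)\<bar>)" by (rule sum_abs)
      also have "\<dots> \<le> (\<Sum>m=1..l. lam m * real (k * m))"
      proof (rule sum_mono)
        fix m assume "m \<in> {1..l}"
        then show "\<bar>lam m * (f N (?i + k * m) - f N ?i)\<bar> \<le> lam m * real (k * m)"
          using lam[of m] f_diff[of N "?i + k * m" ?i] by (simp add: abs_mult)
      qed
      finally show "\<bar>\<Sum>m=1..l. lam m * (f N (?i + k * m) - f N ?i)\<bar> \<le> (\<Sum>m=1..l. lam m * real (k * m))" .
      have "\<bar>f N (?i - 1) - f N ?i\<bar> \<le> 1" using f_diff[of N "?i - 1" ?i] by (cases ?i) auto
      then show "\<bar>real k * mu * (f N (?i - 1) - f N ?i)\<bar> \<le> real k * mu"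
        using mu by (simp add: abs_mult mult_left_le)
    qed
    finally show ?thesis .
  qed
  have C: "0 \<le> C" using \<psi>_bound[of 0 "(0,0)"] by linarith
  have \<psi>_lim: "(\<lambda>N. \<psi> N y) \<longlonglongrightarrow> \<psi>' y" for y
  proof -
    let ?i = "?g y"
    have ev: "\<forall>\<^sub>F N in sequentially. f N i = real i" for i
      using eventually_ge_at_top[of i] by eventually_elim (simp add: f_def)
    have f_lim: "(\<lambda>N. f N i) \<longlonglongrightarrow> real i" for i
      by (rule tendsto_eventually[OF ev])
    have "(\<lambda>N. \<psi> N y) \<longlonglongrightarrow> (\<Sum>m=1..l. lam m * (real (?i + k * m) - real ?i)) +
        real k * mu * (real (?i - 1) - real ?i)"
      unfolding \<psi>_def Let_def by (intro tendsto_intros f_lim)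
    also have "(\<Sum>m=1..l. lam m * (real (?i + k * m) - real ?i)) = real k * (\<Sum>m=1..l. real m * lam m)"
      by (simp add: sum_distrib_left mult_ac)
    also have "real k * (\<Sum>m=1..l. real m * lam m) + real k * mu * (real (?i - 1) - real ?i) = \<psi>' y"
      by (cases "?i") (auto simp: \<psi>'_def drift_def algebra_simps)
    finally show ?thesis .
  qed
  have Dynkin: "(\<integral>y. f N (?g y) \<partial>?K t) = integral {0..t} (\<lambda>s. \<integral>y. \<psi> N y \<partial>?K s)" for N
  proof -
    have "(\<integral>y. f N (?g y) \<partial>?K t) =
        f N (?g (0, 0)) + integral {0..t} (\<lambda>s. \<integral>y. \<psi> N y \<partial>?K s)"
    proof (rule Dynkin_formula[OF origin_state t, where B = "real N" and C = C])
      show "generator (\<lambda>y. f N (?g y)) x = \<psi> N x" if "x \<in> erlang_states k" for x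
        unfolding generator_phase[OF that] \<psi>_def Let_def ..
    qed (rule \<psi>_bound | simp add: f_def)+
    then show ?thesis by (simp add: f_def)
  qed
  have expect_lim: "(\<lambda>N. \<integral>y. \<psi> N y \<partial>?K s) \<longlonglongrightarrow> drift + real k * mu * empty_prob s 0" if s: "0 \<le> s" for s
  proof -
    have "(\<lambda>N. \<integral>y. \<psi> N y \<partial>?K s) \<longlonglongrightarrow> (\<integral>y. \<psi>' y \<partial>?K s)"
      by (rule integral_dominated_convergence[where w = "\<lambda>_. C"]) (auto simp: \<psi>_lim \<psi>_bound)
    also have "(\<integral>y. \<psi>' y \<partial>?K s) = (\<integral>y. drift + real k * mu * indicator {(0, 0)} y \<partial>?K s)"
      using K_closed[OF origin_state s] phase_eq_0_iff
      by (intro integral_cong_AE AE_pmfI) (auto simp: \<psi>'_def indicator_def)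
    also have "\<dots> = drift + real k * mu * empty_prob s 0"
    proof -
      have "integrable (?K s) (\<lambda>y. real k * mu * indicator {(0, 0)} y)"
        by (rule integrable_pmf_bounded[of _ "real k * mu"]) (use mu in \<open>auto simp: indicator_def\<close>)
      then show ?thesis
        using pmf_empty[OF s] by (subst Bochner_Integration.integral_add) (simp_all add: measure_pmf_single)
    qed
    finally show ?thesis .
  qed
  have "(\<lambda>N. integral {0..t} (\<lambda>s. \<integral>y. \<psi> N y \<partial>?K s)) \<longlonglongrightarrow>
      integral {0..t} (\<lambda>s. drift + real k * mu * empty_prob s 0)"
  proof (rule dominated_convergence(2)[where h = "\<lambda>_. C"])
    show "(\<lambda>s. \<integral>y. \<psi> N y \<partial>?K s) integrable_on {0..t}" for N
      by (intro integrable_continuous_real continuous_on_subset[OF continuous_expectation[OF origin_state \<psi>_bound]]) auto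
    show "norm (\<integral>y. \<psi> N y \<partial>?K s) \<le> C" for N s
      using abs_integral_pmf_le[of "\<psi> N" C, OF \<psi>_bound] by simp
  qed (use expect_lim in auto)
  moreover have "integral {0..t} (\<lambda>s. drift + real k * mu * empty_prob s 0) = mean_phases t"
  proof -
    have "(\<lambda>s. empty_prob s 0) integrable_on {0..t}"
      by (rule integrable_continuous_real[OF continuous_on_empty_prob])
    from has_integral_add[OF has_integral_const_real[of drift 0 t]
        has_integral_mult_right[OF integrable_integral[OF this], of "real k * mu"]]
    show ?thesis using t by (simp add: mean_phases_def integral_unique mult.commute)
  qed
  ultimately have lim: "(\<lambda>N. \<integral>y. f N (?g y) \<partial>?K t) \<longlonglongrightarrow> mean_phases t"
    by (simp add: Dynkin)
  show "0 \<le> mean_phases t"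
    by (rule LIMSEQ_le_const[OF lim]) (auto simp: f_def intro!: integral_nonneg_AE)
  have "(\<lambda>N. \<integral>\<^sup>+y. ennreal (f N (?g y)) \<partial>?K t) \<longlonglongrightarrow>
      (\<integral>\<^sup>+y. ennreal (real (?g y)) \<partial>?K t)"
  proof (rule nn_integral_LIMSEQ)
    show "incseq (\<lambda>N y. ennreal (f N (?g y)))"
      by (auto simp: incseq_def le_fun_def f_def intro!: ennreal_leI)
    show "(\<lambda>N. ennreal (f N (?g y))) \<longlonglongrightarrow> ennreal (real (?g y))" for y
      by (rule tendsto_eventually, rule eventually_mono[OF eventually_ge_at_top[of "?g y"]])
         (simp add: f_def)
  qed auto
  moreover have "(\<integral>\<^sup>+y. ennreal (f N (?g y)) \<partial>?K t) =
      ennreal (\<integral>y. f N (?g y) \<partial>?K t)" for N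
    by (rule nn_integral_eq_integral) (auto simp: f_def intro!: integrable_pmf_bounded[of _ "real N"])
  ultimately have "(\<lambda>N. ennreal (\<integral>y. f N (?g y) \<partial>?K t)) \<longlonglongrightarrow>
      (\<integral>\<^sup>+y. ennreal (real (?g y)) \<partial>?K t)" by simp
  moreover have "(\<lambda>N. ennreal (\<integral>y. f N (?g y) \<partial>?K t)) \<longlonglongrightarrow> ennreal (mean_phases t)"
    by (rule tendsto_ennrealI[OF lim])
  ultimately show "(\<integral>\<^sup>+y. ennreal (real (?g y)) \<partial>?K t) = ennreal (mean_phases t)"
    by (rule LIMSEQ_unique)
qed

end

section \<open>The hitting time of a stable subordinator\<close>

text \<open>
The variable \<open>exp (- X)\<close> takes values in \<open>[0, 1]\<close>, so its characteristic function is the power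
series of its moments, and these are values of the Laplace transform of \<open>X\<close>. Levy's uniqueness
theorem does the rest.
\<close>

lemma Laplace_transform_unique:
  fixes X Y :: "'a \<Rightarrow> real"
  assumes "prob_space M" and [measurable]: "X \<in> borel_measurable M" "Y \<in> borel_measurable M"
    and X0: "AE \<omega> in M. 0 \<le> X \<omega>" and Y0: "AE \<omega> in M. 0 \<le> Y \<omega>"
    and eq: "\<And>n::nat. 1 \<le> n \<Longrightarrow> (\<integral>\<omega>. exp (- (real n * X \<omega>)) \<partial>M) = (\<integral>\<omega>. exp (- (real n * Y \<omega>)) \<partial>M)"
  shows "distr M borel X = distr M borel Y"
proof -
  interpret prob_space M by fact
  have char_eq: "char (distr M borel (\<lambda>\<omega>. exp (- V \<omega>))) \<theta> =
      (\<Sum>n. (\<i> * \<theta>) ^ n / fact n * complex_of_real (\<integral>\<omega>. exp (- (real n * V \<omega>)) \<partial>M))"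
    if [measurable]: "V \<in> borel_measurable M" and V0: "AE \<omega> in M. 0 \<le> V \<omega>" for V :: "'a \<Rightarrow> real" and \<theta>
  proof -
    define g where "g n \<omega> = (\<i> * \<theta>) ^ n / fact n * complex_of_real (exp (- (real n * V \<omega>)))" for n \<omega>
    have bound: "AE \<omega> in M. norm (g n \<omega>) \<le> inverse (fact n) * \<bar>\<theta>\<bar> ^ n" for n
      using V0
    proof eventually_elim
      case (elim \<omega>)
      have "norm (g n \<omega>) = \<bar>\<theta>\<bar> ^ n / fact n * exp (- (real n * V \<omega>))"
        by (simp add: g_def norm_mult norm_divide norm_power)
      also have "\<dots> \<le> \<bar>\<theta>\<bar> ^ n / fact n * 1" using elim by (intro mult_left_mono) auto
      finally show ?case by (simp add: field_simps)
    qed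
    have int: "integrable M (g n)" for n
      by (rule integrable_const_bound[OF bound]) (simp add: g_def)
    have AE_bound: "AE \<omega> in M. \<forall>n. norm (g n \<omega>) \<le> inverse (fact n) * \<bar>\<theta>\<bar> ^ n"
      using bound by (simp add: AE_all_countable)
    have "char (distr M borel (\<lambda>\<omega>. exp (- V \<omega>))) \<theta> = (\<integral>\<omega>. iexp (\<theta> * exp (- V \<omega>)) \<partial>M)"
      by (simp add: char_def integral_distr)
    also have "\<dots> = (\<integral>\<omega>. (\<Sum>n. g n \<omega>) \<partial>M)"
    proof (intro Bochner_Integration.integral_cong refl)
      fix \<omega>
      have "iexp (\<theta> * exp (- V \<omega>)) = (\<Sum>n. (\<i> * (\<theta> * exp (- V \<omega>))) ^ n /\<^sub>R fact n)"
        by (simp add: exp_def)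
      also have "(\<lambda>n. (\<i> * (\<theta> * exp (- V \<omega>))) ^ n /\<^sub>R fact n) = (\<lambda>n. g n \<omega>)"
        using exp_of_nat_mult[of _ "- V \<omega>"]
        by (intro ext) (simp add: g_def power_mult_distrib scaleR_conv_of_real field_simps
            flip: of_real_power)
      finally show "iexp (\<theta> * exp (- V \<omega>)) = (\<Sum>n. g n \<omega>)" .
    qed
    also have "\<dots> = (\<Sum>n. \<integral>\<omega>. g n \<omega> \<partial>M)"
    proof (rule integral_suminf[OF int])
      show "AE \<omega> in M. summable (\<lambda>n. norm (g n \<omega>))"
        using AE_bound by eventually_elim
          (rule summable_comparison_test[OF _ summable_exp[of "\<bar>\<theta>\<bar>"]], auto)
      show "summable (\<lambda>n. \<integral>\<omega>. norm (g n \<omega>) \<partial>M)"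
      proof (rule summable_comparison_test[OF _ summable_exp[of "\<bar>\<theta>\<bar>"]], intro exI allI impI)
        fix n
        have "(\<integral>\<omega>. norm (g n \<omega>) \<partial>M) \<le> (\<integral>\<omega>. inverse (fact n) * \<bar>\<theta>\<bar> ^ n \<partial>M)"
          using int bound by (intro integral_mono_AE) auto
        then show "norm (\<integral>\<omega>. norm (g n \<omega>) \<partial>M) \<le> inverse (fact n) * \<bar>\<theta>\<bar> ^ n"
          by (simp add: prob_space)
      qed
    qed
    also have "\<dots> = (\<Sum>n. (\<i> * \<theta>) ^ n / fact n * complex_of_real (\<integral>\<omega>. exp (- (real n * V \<omega>)) \<partial>M))"
      by (simp add: g_def)
    finally show ?thesis .
  qed
  have eq': "(\<integral>\<omega>. exp (- (real n * X \<omega>)) \<partial>M) = (\<integral>\<omega>. exp (- (real n * Y \<omega>)) \<partial>M)" for n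
    using eq[of n] by (cases "n = 0") auto
  have "distr M borel (\<lambda>\<omega>. exp (- X \<omega>)) = distr M borel (\<lambda>\<omega>. exp (- Y \<omega>))"
    by (intro Levy_uniqueness real_distribution_distr ext) (simp_all add: char_eq X0 Y0 eq')
  then have "distr (distr M borel (\<lambda>\<omega>. exp (- X \<omega>))) borel (\<lambda>u. - ln u) =
      distr (distr M borel (\<lambda>\<omega>. exp (- Y \<omega>))) borel (\<lambda>u. - ln u)" by simp
  then show ?thesis by (simp add: distr_distr comp_def)
qed

text \<open>
The layer-cake formula, and below it the version for the strict inequality; they agree because
\<open>s = X \<omega>\<close> for one \<open>s\<close> only. The pair turns the estimates \<open>P(s < Y) \<le> P(D s \<le> t) \<le> P(s \<le> Y)\<close> for the
hitting time \<open>Y\<close> into an equality of integrals.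
\<close>

lemma (in prob_space) layer_cake_le:
  fixes X :: "'a \<Rightarrow> real" and f :: "real \<Rightarrow> ennreal"
  assumes [measurable]: "X \<in> borel_measurable M" "f \<in> borel_measurable borel"
  shows "(\<integral>\<^sup>+\<omega>. (\<integral>\<^sup>+s. f s * indicator {0<..X \<omega>} s \<partial>lborel) \<partial>M) =
    (\<integral>\<^sup>+s. f s * indicator {0<..} s * emeasure M {\<omega>\<in>space M. s \<le> X \<omega>} \<partial>lborel)"
proof -
  interpret pair_sigma_finite lborel M ..
  have "(\<integral>\<^sup>+\<omega>. (\<integral>\<^sup>+s. f s * indicator {0<..X \<omega>} s \<partial>lborel) \<partial>M) =
      (\<integral>\<^sup>+\<omega>. (\<integral>\<^sup>+s. f s * indicator {0<..} s * indicator {\<omega>\<in>space M. s \<le> X \<omega>} \<omega> \<partial>lborel) \<partial>M)"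
    by (intro nn_integral_cong) (auto split: split_indicator)
  also have "\<dots> = (\<integral>\<^sup>+s. (\<integral>\<^sup>+\<omega>. f s * indicator {0<..} s * indicator {\<omega>\<in>space M. s \<le> X \<omega>} \<omega> \<partial>M) \<partial>lborel)"
    by (rule Fubini') measurable
  also have "\<dots> = (\<integral>\<^sup>+s. f s * indicator {0<..} s * emeasure M {\<omega>\<in>space M. s \<le> X \<omega>} \<partial>lborel)"
    by (intro nn_integral_cong) (simp add: nn_integral_cmult)
  finally show ?thesis .
qed

lemma (in prob_space) layer_cake_less:
  fixes X :: "'a \<Rightarrow> real" and f :: "real \<Rightarrow> ennreal"
  assumes [measurable]: "X \<in> borel_measurable M" "f \<in> borel_measurable borel"
  shows "(\<integral>\<^sup>+\<omega>. (\<integral>\<^sup>+s. f s * indicator {0<..X \<omega>} s \<partial>lborel) \<partial>M) =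
    (\<integral>\<^sup>+s. f s * indicator {0<..} s * emeasure M {\<omega>\<in>space M. s < X \<omega>} \<partial>lborel)"
proof -
  interpret pair_sigma_finite lborel M ..
  have "(\<integral>\<^sup>+\<omega>. (\<integral>\<^sup>+s. f s * indicator {0<..X \<omega>} s \<partial>lborel) \<partial>M) =
      (\<integral>\<^sup>+\<omega>. (\<integral>\<^sup>+s. f s * indicator {0<..} s * indicator {\<omega>\<in>space M. s < X \<omega>} \<omega> \<partial>lborel) \<partial>M)"
    by (intro nn_integral_cong nn_integral_cong_AE eventually_mono[OF AE_lborel_singleton])
       (auto split: split_indicator)
  also have "\<dots> = (\<integral>\<^sup>+s. (\<integral>\<^sup>+\<omega>. f s * indicator {0<..} s * indicator {\<omega>\<in>space M. s < X \<omega>} \<omega> \<partial>M) \<partial>lborel)"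
    by (rule Fubini') measurable
  also have "\<dots> = (\<integral>\<^sup>+s. f s * indicator {0<..} s * emeasure M {\<omega>\<in>space M. s < X \<omega>} \<partial>lborel)"
    by (intro nn_integral_cong) (simp add: nn_integral_cmult)
  finally show ?thesis .
qed

lemma nn_integral_power_Ioc:
  assumes "1 \<le> n" and "0 \<le> x"
  shows "(\<integral>\<^sup>+s. ennreal (real n * s ^ (n - 1)) * indicator {0<..x} s \<partial>lborel) = ennreal (x ^ n)"
proof -
  have "(\<integral>\<^sup>+s. ennreal (real n * s ^ (n - 1)) * indicator {0<..x} s \<partial>lborel) =
      (\<integral>\<^sup>+s. ennreal (real n * s ^ (n - 1)) * indicator {0..x} s \<partial>lborel)"
    by (intro nn_integral_cong_AE eventually_mono[OF AE_lborel_singleton[of 0]]) (auto split: split_indicator)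
  also have "\<dots> = ennreal (x ^ n - 0 ^ n)"
    using assms by (intro nn_integral_FTC_Icc) (auto intro!: derivative_eq_intros)
  finally show ?thesis using assms by simp
qed

lemma nn_integral_exp_Ici:
  "(\<integral>\<^sup>+t. ennreal (exp (- t)) * indicator {c..} t \<partial>lborel) = ennreal (exp (- c))"
proof -
  have "((\<lambda>t::real. - exp (- t)) \<longlongrightarrow> - 0) at_top"
    by (intro tendsto_minus filterlim_compose[OF exp_at_bot filterlim_uminus_at_bot_at_top])
  then have "(\<integral>\<^sup>+t. ennreal (exp (- t)) * indicator {c..} t \<partial>lborel) = ennreal (- 0 - (- exp (- c)))"
    by (intro nn_integral_FTC_atLeast) (auto intro!: derivative_eq_intros)
  then show ?thesis by simp
qed

lemma root_le_iff:
  fixes s t d \<alpha> :: real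
  assumes "0 < s" "0 \<le> t" "0 < d" "0 < \<alpha>"
  shows "s powr (1 / \<alpha>) * d \<le> t \<longleftrightarrow> s \<le> (t / d) powr \<alpha>"
proof -
  have "s powr (1 / \<alpha>) * d \<le> t \<longleftrightarrow> s powr (1 / \<alpha>) \<le> t / d" using assms by (simp add: pos_le_divide_eq)
  also have "\<dots> \<longleftrightarrow> (s powr (1 / \<alpha>)) powr \<alpha> \<le> (t / d) powr \<alpha>"
    using assms powr_mono2[of \<alpha> "s powr (1 / \<alpha>)" "t / d"] powr_less_mono2[of \<alpha> "t / d" "s powr (1 / \<alpha>)"]
    by fastforce
  also have "(s powr (1 / \<alpha>)) powr \<alpha> = s" using assms by (simp add: powr_powr)
  finally show ?thesis .
qed

lemma power_powr_divide:
  fixes t d \<alpha> :: real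
  assumes "0 \<le> t" "0 < d" "1 \<le> n"
  shows "((t / d) powr \<alpha>) ^ n = t powr (\<alpha> * real n) * (d powr (- \<alpha>)) ^ n"
proof (cases "t = 0")
  case True then show ?thesis using assms by simp
next
  case False
  then show ?thesis using assms
    by (simp add: powr_divide powr_minus field_simps powr_powr flip: powr_realpow)
qed

text \<open>
The substitution \<open>u = s powr (1 / \<alpha>) * d\<close> in disguise: the exponential is written as the integral
of \<open>exp (- t)\<close> over the tail, and after exchanging the order only a power of \<open>s\<close> is left to integrate.
\<close>

lemma nn_integral_power_times_exp_root:
  assumes "1 \<le> n" and "0 < d" and "0 < \<alpha>"
  shows "(\<integral>\<^sup>+s. ennreal (real n * s ^ (n - 1)) * indicator {0<..} s * ennreal (exp (- (s powr (1 / \<alpha>) * d))) \<partial>lborel) =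
    ennreal (Gamma (\<alpha> * real n + 1)) * ennreal ((d powr (- \<alpha>)) ^ n)"
proof -
  let ?f = "\<lambda>s. ennreal (real n * s ^ (n - 1)) * indicator {0<..} s :: ennreal"
  let ?h = "\<lambda>s t. ennreal (exp (- t)) * indicator {s powr (1 / \<alpha>) * d..} t :: ennreal"
  have "(\<integral>\<^sup>+s. ?f s * ennreal (exp (- (s powr (1 / \<alpha>) * d))) \<partial>lborel) =
      (\<integral>\<^sup>+s. (\<integral>\<^sup>+t. ?f s *
         ?h s t \<partial>lborel) \<partial>lborel)"
    by (intro nn_integral_cong) (simp add: nn_integral_cmult nn_integral_exp_Ici)
  also have "\<dots> = (\<integral>\<^sup>+t. (\<integral>\<^sup>+s. ?f s *
         ?h s t \<partial>lborel) \<partial>lborel)"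
    by (rule lborel_pair.Fubini'[symmetric]) (auto simp: indicator_def)
  also have "\<dots> = (\<integral>\<^sup>+t. ennreal ((d powr (- \<alpha>)) ^ n) *
      ennreal (indicator {0..} t * t powr ((\<alpha> * real n + 1) - 1) / exp t) \<partial>lborel)"
  proof (intro nn_integral_cong)
    fix t :: real
    show "(\<integral>\<^sup>+s. ?f s *
         ?h s t \<partial>lborel) =
      ennreal ((d powr (- \<alpha>)) ^ n) * ennreal (indicator {0..} t * t powr ((\<alpha> * real n + 1) - 1) / exp t)"
    proof (cases "0 \<le> t")
      case True
      have "(\<integral>\<^sup>+s. ?f s *
         ?h s t \<partial>lborel) =
        (\<integral>\<^sup>+s. ennreal (exp (- t)) * (ennreal (real n * s ^ (n - 1)) * indicator {0<..(t / d) powr \<alpha>} s) \<partial>lborel)"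
        using root_le_iff[OF _ True assms(2,3)] by (intro nn_integral_cong) (auto simp: mult_ac split: split_indicator)
      also have "\<dots> = ennreal (exp (- t)) * ennreal (((t / d) powr \<alpha>) ^ n)"
        using nn_integral_power_Ioc[OF assms(1), of "(t / d) powr \<alpha>"] by (simp add: nn_integral_cmult)
      also have "((t / d) powr \<alpha>) ^ n = t powr (\<alpha> * real n) * (d powr (- \<alpha>)) ^ n"
        by (rule power_powr_divide[OF True assms(2,1)])
      finally show ?thesis using True
        by (simp add: ennreal_mult[symmetric] exp_minus field_simps)
    next
      case False
      have "(\<integral>\<^sup>+s. ?f s *
         ?h s t \<partial>lborel) = (\<integral>\<^sup>+s. 0 \<partial>(lborel :: real measure))"
      proof (intro nn_integral_cong)
        fix s :: real
        have "0 \<le> s powr (1 / \<alpha>) * d" using assms by simp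
        then have "\<not> s powr (1 / \<alpha>) * d \<le> t" using False by linarith
        then show "?f s *
         ?h s t = 0" by simp
      qed
      then show ?thesis using False by simp
    qed
  qed
  also have "\<dots> = ennreal ((d powr (- \<alpha>)) ^ n) *
      (\<integral>\<^sup>+t. ennreal (indicator {0..} t * t powr ((\<alpha> * real n + 1) - 1) / exp t) \<partial>lborel)"
    by (rule nn_integral_cmult) measurable
  also have "(\<integral>\<^sup>+t. ennreal (indicator {0..} t * t powr ((\<alpha> * real n + 1) - 1) / exp t) \<partial>lborel) =
      ennreal (Gamma (\<alpha> * real n + 1))"
    using assms by (intro Gamma_conv_nn_integral_real[symmetric] add_nonneg_pos) auto
  finally show ?thesis by (simp add: mult.commute)
qed

locale stable_hitting = prob_space M for M :: "'a measure" +
  fixes \<alpha> :: real and D :: "real \<Rightarrow> 'a \<Rightarrow> real"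
  assumes \<alpha>: "0 < \<alpha>" and stable: "stable_subordinator M \<alpha> D"
    and hitting_measurable: "\<And>t. 0 \<le> t \<Longrightarrow> hitting_time D t \<in> borel_measurable M"
begin

lemma D_measurable [measurable]: "0 \<le> s \<Longrightarrow> D s \<in> borel_measurable M"
  using stable by (auto simp: stable_subordinator_def levy_process_def)

lemma D_mono: "AE \<omega> in M. mono_on {0..} (\<lambda>s. D s \<omega>)"
  using stable by (auto simp: stable_subordinator_def)

lemma D_Laplace: "0 \<le> s \<Longrightarrow> 0 < z \<Longrightarrow> (\<integral>\<omega>. exp (- z * D s \<omega>) \<partial>M) = exp (- s * z powr \<alpha>)"
  using stable by (auto simp: stable_subordinator_def)

lemma D_nonneg: "0 \<le> s \<Longrightarrow> AE \<omega> in M. 0 \<le> D s \<omega>"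
proof -
  assume s: "0 \<le> s"
  have "AE \<omega> in M. D 0 \<omega> = 0" using stable by (auto simp: stable_subordinator_def levy_process_def)
  with D_mono show ?thesis
  proof eventually_elim
    case (elim \<omega>) then show ?case using mono_onD[OF elim(1), of 0 s] s by auto
  qed
qed

lemma D_exp_integrable: "0 \<le> s \<Longrightarrow> 0 \<le> z \<Longrightarrow> integrable M (\<lambda>\<omega>. exp (- (z * D s \<omega>)))"
  by (rule integrable_const_bound[where B = 1])
     (auto intro!: eventually_mono[OF D_nonneg])

lemma Chernoff_D:
  assumes "0 \<le> s" "0 < z"
  shows "measure M {\<omega>\<in>space M. D s \<omega> \<le> t} \<le> exp (z * t) * exp (- (s * z powr \<alpha>))"
proof -
  note D_measurable[OF assms(1), measurable]
  have int: "integrable M (\<lambda>\<omega>. exp (z * t) * exp (- (z * D s \<omega>)))"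
    using D_exp_integrable[of s z] assms by simp
  have "measure M {\<omega>\<in>space M. D s \<omega> \<le> t} = (\<integral>\<omega>. indicator {\<omega>\<in>space M. D s \<omega> \<le> t} \<omega> \<partial>M)"
    by simp
  also have "\<dots> \<le> (\<integral>\<omega>. exp (z * t) * exp (- (z * D s \<omega>)) \<partial>M)"
  proof (intro integral_mono int)
    show "integrable M (indicator {\<omega>\<in>space M. D s \<omega> \<le> t} :: 'a \<Rightarrow> real)"
      by (intro integrable_real_indicator) (auto simp: emeasure_eq_measure)
    show "indicator {\<omega>\<in>space M. D s \<omega> \<le> t} \<omega> \<le> exp (z * t) * exp (- (z * D s \<omega>))" for \<omega>
      using assms by (auto split: split_indicator simp flip: exp_add simp: mult_left_mono)
  qed
  also have "\<dots> = exp (z * t) * exp (- (s * z powr \<alpha>))"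
    using D_Laplace[OF assms] by simp
  finally show ?thesis .
qed

lemma D_positive:
  assumes "0 < s" shows "AE \<omega> in M. 0 < D s \<omega>"
proof -
  have [measurable]: "D s \<in> borel_measurable M" using assms by simp
  have "((\<lambda>x::real. exp (- x)) \<longlongrightarrow> 0) at_top"
    by (intro filterlim_compose[OF exp_at_bot filterlim_uminus_at_bot_at_top])
  moreover have "\<forall>\<^sub>F x in at_top. measure M {\<omega>\<in>space M. D s \<omega> \<le> 0} \<le> exp (- x)"
    using eventually_gt_at_top[of 0]
  proof eventually_elim
    case (elim x)
    \<comment> \<open>Chernoff at level 0, with \<open>s * z powr \<alpha> = x\<close>\<close>
    show ?case
      using Chernoff_D[of s "(x / s) powr (1 / \<alpha>)" 0] elim assms \<alpha> by (simp add: powr_powr)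
  qed
  ultimately have "measure M {\<omega>\<in>space M. D s \<omega> \<le> 0} \<le> 0"
    by (intro tendsto_lowerbound[of _ _ at_top]) auto
  then have "AE \<omega> in M. \<not> D s \<omega> \<le> 0"
    by (intro AE_I'[of "{\<omega>\<in>space M. D s \<omega> \<le> 0}"]) (auto simp: null_sets_def emeasure_eq_measure measure_le_0_iff)
  then show ?thesis by eventually_elim simp
qed

lemma D_unbounded: "AE \<omega> in M. \<exists>s\<ge>0. t < D s \<omega>"
proof -
  define A where "A = {\<omega>\<in>space M. \<forall>n::nat. D (real n) \<omega> \<le> t}"
  have [measurable]: "A \<in> sets M" unfolding A_def by measurable
  have "measure M A \<le> exp t * exp (- real n)" for n :: nat
  proof -
    have [measurable]: "D (real n) \<in> borel_measurable M" by simp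
    have "measure M A \<le> measure M {\<omega>\<in>space M. D (real n) \<omega> \<le> t}"
      by (intro finite_measure_mono) (auto simp: A_def)
    also have "\<dots> \<le> exp t * exp (- real n)" using Chernoff_D[of "real n" 1 t] by simp
    finally show ?thesis .
  qed
  moreover have "(\<lambda>n. exp t * exp (- real n)) \<longlonglongrightarrow> exp t * 0"
    by (intro tendsto_mult tendsto_const filterlim_compose[OF exp_at_bot]
        filterlim_compose[OF filterlim_uminus_at_bot_at_top filterlim_real_sequentially])
  ultimately have "measure M A \<le> exp t * 0"
    by (intro LIMSEQ_le_const[of "\<lambda>n. exp t * exp (- real n)"]) blast+
  then have "measure M A \<le> 0" by simp
  then show ?thesis
    by (intro AE_I'[of A]) (auto simp: null_sets_def emeasure_eq_measure measure_le_0_iff A_def not_less)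
qed

lemma D_self_similar:
  assumes s: "0 < s"
  shows "emeasure M {\<omega>\<in>space M. D s \<omega> \<le> t} = emeasure M {\<omega>\<in>space M. s powr (1 / \<alpha>) * D 1 \<omega> \<le> t}"
proof -
  have [measurable]: "D s \<in> borel_measurable M" "D 1 \<in> borel_measurable M" using s by auto
  have "distr M borel (D s) = distr M borel (\<lambda>\<omega>. s powr (1 / \<alpha>) * D 1 \<omega>)"
  proof (rule Laplace_transform_unique)
    show "AE \<omega> in M. 0 \<le> s powr (1 / \<alpha>) * D 1 \<omega>" using D_nonneg[of 1] by auto
    show "AE \<omega> in M. 0 \<le> D s \<omega>" using D_nonneg s by auto
    fix n :: nat assume n: "1 \<le> n"
    have "(\<integral>\<omega>. exp (- (real n * (s powr (1 / \<alpha>) * D 1 \<omega>))) \<partial>M) = exp (- ((real n * s powr (1 / \<alpha>)) powr \<alpha>))"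
      using D_Laplace[of 1 "real n * s powr (1 / \<alpha>)"] s n by (simp add: mult.assoc)
    also have "(real n * s powr (1 / \<alpha>)) powr \<alpha> = s * real n powr \<alpha>"
      using s \<alpha> by (simp add: powr_mult powr_powr)
    finally show "(\<integral>\<omega>. exp (- (real n * D s \<omega>)) \<partial>M) = (\<integral>\<omega>. exp (- (real n * (s powr (1 / \<alpha>) * D 1 \<omega>))) \<partial>M)"
      using D_Laplace[of s "real n"] s n by simp
  qed (auto intro: prob_space_axioms)
  then have "emeasure (distr M borel (D s)) {..t} = emeasure (distr M borel (\<lambda>\<omega>. s powr (1 / \<alpha>) * D 1 \<omega>)) {..t}"
    by simp
  then show ?thesis
    by (simp add: emeasure_distr vimage_def Int_def conj_commute)
qed

lemma hitting_time_nonneg: "0 \<le> hitting_time D t \<omega>"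
  by (auto simp: hitting_time_def intro!: cInf_greatest)

lemma emeasure_hitting_time_greater_le:
  assumes s: "0 < s" and t: "0 \<le> t"
  shows "emeasure M {\<omega>\<in>space M. s < hitting_time D t \<omega>} \<le> emeasure M {\<omega>\<in>space M. D s \<omega> \<le> t}"
proof (rule emeasure_mono)
  have [measurable]: "D s \<in> borel_measurable M" using s by auto
  show "{\<omega>\<in>space M. D s \<omega> \<le> t} \<in> sets M" by measurable
  show "{\<omega>\<in>space M. s < hitting_time D t \<omega>} \<subseteq> {\<omega>\<in>space M. D s \<omega> \<le> t}"
  proof safe
    fix \<omega> assume less: "s < hitting_time D t \<omega>"
    show "D s \<omega> \<le> t"
    proof (rule ccontr)
      assume "\<not> D s \<omega> \<le> t"
      then have "s \<in> {s. 0 \<le> s \<and> D s \<omega> > t}" using s by auto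
      moreover have "bdd_below {s. 0 \<le> s \<and> D s \<omega> > t}" by (auto intro: bdd_belowI[of _ 0])
      ultimately have "Inf {s. 0 \<le> s \<and> D s \<omega> > t} \<le> s" by (rule cInf_lower)
      then show False using less \<open>\<not> D s \<omega> \<le> t\<close> s by (auto simp: hitting_time_def split: if_splits)
    qed
  qed
qed

lemma emeasure_le_hitting_time_ge:
  assumes s: "0 < s" and t: "0 \<le> t"
  shows "emeasure M {\<omega>\<in>space M. D s \<omega> \<le> t} \<le> emeasure M {\<omega>\<in>space M. s \<le> hitting_time D t \<omega>}"
proof (rule emeasure_mono_AE)
  have [measurable]: "hitting_time D t \<in> borel_measurable M" by (rule hitting_measurable[OF t])
  show "{\<omega>\<in>space M. s \<le> hitting_time D t \<omega>} \<in> sets M" by measurable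
  show "AE \<omega> in M. \<omega> \<in> {\<omega>\<in>space M. D s \<omega> \<le> t} \<longrightarrow> \<omega> \<in> {\<omega>\<in>space M. s \<le> hitting_time D t \<omega>}"
    using D_mono D_unbounded[of t]
  proof eventually_elim
    case (elim \<omega>)
    have "s \<le> hitting_time D t \<omega>" if le: "D s \<omega> \<le> t"
    proof -
      have "s \<le> u" if "0 \<le> u" "t < D u \<omega>" for u
        using mono_onD[OF elim(1), of u s] that le s by (cases "s \<le> u") auto
      then show ?thesis using elim(2) by (auto simp: hitting_time_def intro!: cInf_greatest)
    qed
    then show ?case by auto
  qed
qed

text \<open>
The two preceding bounds differ only in the strictness of one inequality, which the two versions
of the layer-cake formula do not distinguish.
\<close>

lemma nn_integral_hitting_time:
  fixes f :: "real \<Rightarrow> ennreal"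
  assumes t: "0 \<le> t" and [measurable]: "f \<in> borel_measurable borel"
  shows "(\<integral>\<^sup>+\<omega>. (\<integral>\<^sup>+s. f s * indicator {0<..hitting_time D t \<omega>} s \<partial>lborel) \<partial>M) =
    (\<integral>\<^sup>+s. f s * indicator {0<..} s * emeasure M {\<omega>\<in>space M. D s \<omega> \<le> t} \<partial>lborel)"
proof (rule antisym)
  note [measurable] = hitting_measurable[OF t]
  show "(\<integral>\<^sup>+\<omega>. (\<integral>\<^sup>+s. f s * indicator {0<..hitting_time D t \<omega>} s \<partial>lborel) \<partial>M) \<le>
    (\<integral>\<^sup>+s. f s * indicator {0<..} s * emeasure M {\<omega>\<in>space M. D s \<omega> \<le> t} \<partial>lborel)"
    unfolding layer_cake_less[OF hitting_measurable[OF t] assms(2)]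
    by (intro nn_integral_mono) (auto intro: mult_left_mono emeasure_hitting_time_greater_le[OF _ t] split: split_indicator)
  show "(\<integral>\<^sup>+s. f s * indicator {0<..} s * emeasure M {\<omega>\<in>space M. D s \<omega> \<le> t} \<partial>lborel) \<le>
    (\<integral>\<^sup>+\<omega>. (\<integral>\<^sup>+s. f s * indicator {0<..hitting_time D t \<omega>} s \<partial>lborel) \<partial>M)"
    unfolding layer_cake_le[OF hitting_measurable[OF t] assms(2)]
    by (intro nn_integral_mono) (auto intro: mult_left_mono emeasure_le_hitting_time_ge[OF _ t] split: split_indicator)
qed

text \<open>
The integral of \<open>f\<close> against this measure is the mean of \<open>\<integral>0..Y. f s ds\<close>, where \<open>Y\<close> is the hitting
time of level \<open>t\<close>.
\<close>

definition occupation :: "real \<Rightarrow> real measure" where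
  "occupation t = density lborel (\<lambda>s. \<integral>\<^sup>+\<omega>. indicator {0<..hitting_time D t \<omega>} s \<partial>M)"

lemma sets_occupation [measurable_cong]: "sets (occupation t) = sets borel"
  by (simp add: occupation_def)

lemma nn_integral_occupation:
  fixes f :: "real \<Rightarrow> ennreal"
  assumes t: "0 \<le> t" and [measurable]: "f \<in> borel_measurable borel"
  shows "(\<integral>\<^sup>+s. f s \<partial>occupation t) = (\<integral>\<^sup>+\<omega>. (\<integral>\<^sup>+s. f s * indicator {0<..hitting_time D t \<omega>} s \<partial>lborel) \<partial>M)"
proof -
  interpret pair_sigma_finite lborel M ..
  note [measurable] = hitting_measurable[OF t]
  have [measurable]: "(\<lambda>(s, \<omega>). indicator {0<..hitting_time D t \<omega>} s :: ennreal) \<in> borel_measurable (borel \<Otimes>\<^sub>M M)"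
    by (simp add: indicator_def) 
  have "(\<integral>\<^sup>+s. f s \<partial>occupation t) = (\<integral>\<^sup>+s. (\<integral>\<^sup>+\<omega>. indicator {0<..hitting_time D t \<omega>} s \<partial>M) * f s \<partial>lborel)"
    unfolding occupation_def by (rule nn_integral_density) measurable
  also have "\<dots> = (\<integral>\<^sup>+s. (\<integral>\<^sup>+\<omega>. f s * indicator {0<..hitting_time D t \<omega>} s \<partial>M) \<partial>lborel)"
    by (intro nn_integral_cong, subst mult.commute, rule nn_integral_cmult[symmetric]) measurable
  also have "\<dots> = (\<integral>\<^sup>+\<omega>. (\<integral>\<^sup>+s. f s * indicator {0<..hitting_time D t \<omega>} s \<partial>lborel) \<partial>M)"
    by (rule Fubini'[symmetric]) measurable
  finally show ?thesis .
qed

text \<open>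
The Laplace transform of \<open>D 1\<close> at \<open>s powr (1 / \<alpha>)\<close> is \<open>exp (- s)\<close>, so averaging
\<open>nn_integral_power_times_exp_root\<close> over the law of \<open>D 1\<close> leaves a factorial.
\<close>

lemma nn_integral_D1_power:
  assumes n: "1 \<le> n"
  shows "ennreal (Gamma (\<alpha> * real n + 1)) * (\<integral>\<^sup>+\<omega>. ennreal ((D 1 \<omega> powr (- \<alpha>)) ^ n) \<partial>M) = ennreal (fact n)"
proof -
  interpret pair_sigma_finite lborel M ..
  have [measurable]: "D 1 \<in> borel_measurable M" by simp
  define f where "f s = ennreal (real n * s ^ (n - 1)) * indicator {0<..} s" for s :: real
  have [measurable]: "f \<in> borel_measurable borel" unfolding f_def by measurable
  have "ennreal (Gamma (\<alpha> * real n + 1)) * (\<integral>\<^sup>+\<omega>. ennreal ((D 1 \<omega> powr (- \<alpha>)) ^ n) \<partial>M) =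
      (\<integral>\<^sup>+\<omega>. ennreal (Gamma (\<alpha> * real n + 1)) * ennreal ((D 1 \<omega> powr (- \<alpha>)) ^ n) \<partial>M)"
    by (rule nn_integral_cmult[symmetric]) measurable
  also have "\<dots> = (\<integral>\<^sup>+\<omega>. (\<integral>\<^sup>+s. f s * ennreal (exp (- (s powr (1 / \<alpha>) * D 1 \<omega>))) \<partial>lborel) \<partial>M)"
    using D_positive[of 1] nn_integral_power_times_exp_root[OF n _ \<alpha>]
    by (intro nn_integral_cong_AE) (auto simp: f_def elim!: eventually_mono)
  also have "\<dots> = (\<integral>\<^sup>+s. (\<integral>\<^sup>+\<omega>. f s * ennreal (exp (- (s powr (1 / \<alpha>) * D 1 \<omega>))) \<partial>M) \<partial>lborel)"
    by (rule Fubini') measurable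
  also have "\<dots> = (\<integral>\<^sup>+s. ennreal (real n) * (ennreal (s ^ (n - 1) * exp (- s)) * indicator {0..} s) \<partial>lborel)"
  proof (intro nn_integral_cong_AE eventually_mono[OF AE_lborel_singleton[of 0]])
    fix s :: real assume "s \<noteq> 0"
    show "(\<integral>\<^sup>+\<omega>. f s * ennreal (exp (- (s powr (1 / \<alpha>) * D 1 \<omega>))) \<partial>M) =
        ennreal (real n) * (ennreal (s ^ (n - 1) * exp (- s)) * indicator {0..} s)"
    proof (cases "0 < s")
      case True
      have "(\<integral>\<^sup>+\<omega>. ennreal (exp (- (s powr (1 / \<alpha>) * D 1 \<omega>))) \<partial>M) =
          ennreal (\<integral>\<omega>. exp (- (s powr (1 / \<alpha>) * D 1 \<omega>)) \<partial>M)"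
        by (intro nn_integral_eq_integral D_exp_integrable) auto
      also have "\<dots> = ennreal (exp (- s))"
        using D_Laplace[of 1 "s powr (1 / \<alpha>)"] True \<alpha> by (simp add: powr_powr)
      finally have E: "(\<integral>\<^sup>+\<omega>. ennreal (exp (- (s powr (1 / \<alpha>) * D 1 \<omega>))) \<partial>M) = ennreal (exp (- s))" .
      have "(\<integral>\<^sup>+\<omega>. f s * ennreal (exp (- (s powr (1 / \<alpha>) * D 1 \<omega>))) \<partial>M) = f s * ennreal (exp (- s))"
        unfolding E[symmetric] by (rule nn_integral_cmult) measurable
      then show ?thesis using True by (simp add: f_def ennreal_mult[symmetric] mult_ac)
    qed (use \<open>s \<noteq> 0\<close> in \<open>simp add: f_def\<close>)
  qed
  also have "\<dots> = ennreal (real n) * ennreal (fact (n - 1))"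
    by (subst nn_integral_cmult) (simp_all add: nn_intergal_power_times_exp_Ici)
  also have "\<dots> = ennreal (fact n)"
    using n by (cases n) (simp_all add: ennreal_mult[symmetric] algebra_simps)
  finally show ?thesis .
qed

text \<open>
By self-similarity \<open>P(D s \<le> t) = P(s \<le> (t / D 1) powr \<alpha>)\<close>, so the occupation measure has the same
moments as if the hitting time were \<open>(t / D 1) powr \<alpha>\<close>.
\<close>

lemma occupation_moment:
  assumes t: "0 \<le> t"
  shows "(\<integral>\<^sup>+s. ennreal (s ^ n) \<partial>occupation t) =
    ennreal (fact n * t powr (\<alpha> * real (Suc n)) / Gamma (\<alpha> * real (Suc n) + 1))"
proof -
  have [measurable]: "D 1 \<in> borel_measurable M" by simp
  define f where "f s = ennreal (real (Suc n) * s ^ (Suc n - 1))" for s :: real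
  have [measurable]: "f \<in> borel_measurable borel" unfolding f_def by measurable
  let ?T = "t powr (\<alpha> * real (Suc n))"
  let ?\<Gamma> = "Gamma (\<alpha> * real (Suc n) + 1)"
  have \<Gamma>: "0 < ?\<Gamma>" using \<alpha> by (intro Gamma_real_pos add_nonneg_pos) auto
  have "(\<integral>\<^sup>+s. f s \<partial>occupation t) = (\<integral>\<^sup>+s. f s * indicator {0<..} s * emeasure M {\<omega>\<in>space M. D s \<omega> \<le> t} \<partial>lborel)"
    by (simp add: nn_integral_occupation[OF t] nn_integral_hitting_time[OF t])
  also have "\<dots> = (\<integral>\<^sup>+s. f s * indicator {0<..} s * emeasure M {\<omega>\<in>space M. s \<le> (t / D 1 \<omega>) powr \<alpha>} \<partial>lborel)"
  proof (intro nn_integral_cong)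
    fix s :: real
    show "f s * indicator {0<..} s * emeasure M {\<omega>\<in>space M. D s \<omega> \<le> t} =
        f s * indicator {0<..} s * emeasure M {\<omega>\<in>space M. s \<le> (t / D 1 \<omega>) powr \<alpha>}"
    proof (cases "0 < s")
      case True
      have "emeasure M {\<omega>\<in>space M. s powr (1 / \<alpha>) * D 1 \<omega> \<le> t} = emeasure M {\<omega>\<in>space M. s \<le> (t / D 1 \<omega>) powr \<alpha>}"
      proof (rule emeasure_eq_AE)
        show "AE \<omega> in M. \<omega> \<in> {\<omega>\<in>space M. s powr (1 / \<alpha>) * D 1 \<omega> \<le> t} \<longleftrightarrow>
            \<omega> \<in> {\<omega>\<in>space M. s \<le> (t / D 1 \<omega>) powr \<alpha>}"
          using D_positive[of 1, OF zero_less_one]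
        proof eventually_elim
          case (elim \<omega>)
          then show ?case using root_le_iff[OF True t elim \<alpha>] by simp
        qed
      qed measurable
      then show ?thesis using D_self_similar[OF True] by simp
    qed simp
  qed
  also have "\<dots> = (\<integral>\<^sup>+\<omega>. (\<integral>\<^sup>+s. f s * indicator {0<..(t / D 1 \<omega>) powr \<alpha>} s \<partial>lborel) \<partial>M)"
    by (rule layer_cake_le[symmetric]) measurable
  also have "\<dots> = (\<integral>\<^sup>+\<omega>. ennreal (((t / D 1 \<omega>) powr \<alpha>) ^ Suc n) \<partial>M)"
    unfolding f_def by (intro nn_integral_cong nn_integral_power_Ioc) auto
  also have "\<dots> = (\<integral>\<^sup>+\<omega>. ennreal (?T) * ennreal ((D 1 \<omega> powr (- \<alpha>)) ^ Suc n) \<partial>M)"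
    using D_positive[of 1, OF zero_less_one]
  proof (intro nn_integral_cong_AE, eventually_elim)
    case (elim \<omega>)
    have "((t / D 1 \<omega>) powr \<alpha>) ^ Suc n = ?T * (D 1 \<omega> powr (- \<alpha>)) ^ Suc n"
      by (rule power_powr_divide[OF t elim(2)]) auto
    then show ?case by (simp add: ennreal_mult del: power_Suc)
  qed
  also have "\<dots> = ennreal (?T) * (\<integral>\<^sup>+\<omega>. ennreal ((D 1 \<omega> powr (- \<alpha>)) ^ Suc n) \<partial>M)"
    by (rule nn_integral_cmult) measurable
  finally have "ennreal ?\<Gamma> * (\<integral>\<^sup>+s. f s \<partial>occupation t) = ennreal (?T) * ennreal (fact (Suc n))"
    using nn_integral_D1_power[of "Suc n"] by (simp add: mult.left_commute del: power_Suc of_nat_Suc)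
  moreover have "(\<integral>\<^sup>+s. f s \<partial>occupation t) = ennreal (real (Suc n)) * (\<integral>\<^sup>+s. ennreal (s ^ n) \<partial>occupation t)"
    by (subst nn_integral_cmult[symmetric]) (simp_all add: f_def[abs_def] ennreal_mult'[symmetric] del: of_nat_Suc)
  ultimately have "ennreal (?\<Gamma> * real (Suc n)) * (\<integral>\<^sup>+s. ennreal (s ^ n) \<partial>occupation t) =
      ennreal (?T) * ennreal (fact (Suc n))"
    using \<Gamma> by (subst ennreal_mult) (simp_all only: mult.assoc less_imp_le of_nat_0_le_iff)
  also have "\<dots> = ennreal (?T * fact (Suc n))"
    by (rule ennreal_mult[symmetric]) auto
  also have "?T * fact (Suc n) =
      ?\<Gamma> * real (Suc n) * (fact n * ?T / ?\<Gamma>)"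
    using \<Gamma> by (simp add: fact_Suc del: of_nat_Suc)
  also have "ennreal \<dots> = ennreal (?\<Gamma> * real (Suc n)) * ennreal (fact n * ?T / ?\<Gamma>)"
    using \<Gamma> by (intro ennreal_mult) auto
  finally have eq: "ennreal (?\<Gamma> * real (Suc n)) * (\<integral>\<^sup>+s. ennreal (s ^ n) \<partial>occupation t) =
      ennreal (?\<Gamma> * real (Suc n)) * ennreal (fact n * ?T / ?\<Gamma>)" .
  have "0 < ?\<Gamma> * real (Suc n)" using \<Gamma> by simp
  then show ?thesis using eq by (subst (asm) ennreal_mult_cancel_left) (auto simp del: of_nat_Suc)
qed

text \<open>
Chernoff's bound with \<open>z powr \<alpha> = c + 1\<close> makes the tail decay faster than \<open>exp (c * s)\<close> grows. This
replaces growth estimates for the Gamma function in the convergence of Mittag-Leffler series.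
\<close>

lemma occupation_exp_finite:
  assumes t: "0 \<le> t" and c: "0 \<le> c"
  shows "(\<integral>\<^sup>+s. ennreal (exp (c * s)) \<partial>occupation t) < \<infinity>"
proof -
  \<comment> \<open>then \<open>exp (c * s) * exp (- s * z powr \<alpha>) = exp (- s)\<close>\<close>
  define z where "z = (c + 1) powr (1 / \<alpha>)"
  have z: "0 < z" "z powr \<alpha> = c + 1" using c \<alpha> by (auto simp: z_def powr_powr)
  have "(\<integral>\<^sup>+s. ennreal (exp (c * s)) \<partial>occupation t) =
      (\<integral>\<^sup>+s. ennreal (exp (c * s)) * indicator {0<..} s * emeasure M {\<omega>\<in>space M. D s \<omega> \<le> t} \<partial>lborel)"
    by (simp add: nn_integral_occupation[OF t] nn_integral_hitting_time[OF t])
  also have "\<dots> \<le> (\<integral>\<^sup>+s. ennreal (exp (z * t)) * (ennreal (exp (- s)) * indicator {0..} s) \<partial>lborel)"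
  proof (intro nn_integral_mono)
    fix s :: real
    show "ennreal (exp (c * s)) * indicator {0<..} s * emeasure M {\<omega>\<in>space M. D s \<omega> \<le> t} \<le>
        ennreal (exp (z * t)) * (ennreal (exp (- s)) * indicator {0..} s)"
    proof (cases "0 < s")
      case True
      have "exp (c * s) * measure M {\<omega>\<in>space M. D s \<omega> \<le> t} \<le> exp (c * s) * (exp (z * t) * exp (- (s * (c + 1))))"
        using Chernoff_D[of s z t] True z by (intro mult_left_mono) auto
      also have "\<dots> = exp (z * t) * exp (- s)" by (simp add: exp_add[symmetric] algebra_simps)
      finally show ?thesis using True
        by (simp add: emeasure_eq_measure ennreal_mult[symmetric])
    qed simp
  qed
  also have "\<dots> = ennreal (exp (z * t)) * ennreal (exp (- 0))"
    by (subst nn_integral_cmult) (simp_all only: nn_integral_exp_Ici, measurable)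
  also have "\<dots> < \<infinity>" by (simp add: ennreal_mult_less_top)
  finally show ?thesis .
qed

lemma AE_occupation_pos:
  assumes t: "0 \<le> t" shows "AE s in occupation t. 0 < s"
proof -
  note [measurable] = hitting_measurable[OF t]
  have [measurable]: "(\<lambda>(s, \<omega>). indicator {0<..hitting_time D t \<omega>} s :: ennreal) \<in> borel_measurable (borel \<Otimes>\<^sub>M M)"
    by (simp add: indicator_def)
  have zero: "(\<integral>\<^sup>+\<omega>. indicator {0<..hitting_time D t \<omega>} s \<partial>M) = 0" if "s \<le> 0" for s
    using that by simp
  show ?thesis unfolding occupation_def
  proof (subst AE_density)
    show "AE s in lborel. 0 < (\<integral>\<^sup>+\<omega>. indicator {0<..hitting_time D t \<omega>} s \<partial>M) \<longrightarrow> 0 < s"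
      by (rule AE_I2) (metis zero less_irrefl not_le)
  qed measurable
qed

lemma integrable_occupation_power:
  assumes t: "0 \<le> t"
  shows "integrable (occupation t) (\<lambda>s. s ^ n)"
    and "(\<integral>s. s ^ n \<partial>occupation t) = fact n * t powr (\<alpha> * real (Suc n)) / Gamma (\<alpha> * real (Suc n) + 1)"
proof -
  have [measurable]: "(\<lambda>s. s ^ n) \<in> borel_measurable (occupation t)" by measurable
  have nn: "AE s in occupation t. 0 \<le> s ^ n"
    using AE_occupation_pos[OF t] by eventually_elim simp
  have "0 < Gamma (\<alpha> * real (Suc n) + 1)" using \<alpha> by (intro Gamma_real_pos add_nonneg_pos) auto
  then have "has_bochner_integral (occupation t) (\<lambda>s. s ^ n)
      (fact n * t powr (\<alpha> * real (Suc n)) / Gamma (\<alpha> * real (Suc n) + 1))"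
    by (intro has_bochner_integral_nn_integral nn occupation_moment[OF t]) auto
  then show "integrable (occupation t) (\<lambda>s. s ^ n)"
    and "(\<integral>s. s ^ n \<partial>occupation t) = fact n * t powr (\<alpha> * real (Suc n)) / Gamma (\<alpha> * real (Suc n) + 1)"
    by (auto simp: has_bochner_integral_iff)
qed

text \<open>
The exponential is expanded and integrated term by term, with the moments above; the series of
absolute values is dominated by \<open>exp ((a + 1) * s)\<close>.
\<close>

lemma occupation_gamma_density:
  fixes a :: real and N :: nat
  assumes t: "0 \<le> t" and a: "0 \<le> a"
  defines "\<beta> \<equiv> \<alpha> * real (Suc N) + 1"
  shows "integrable (occupation t) (\<lambda>s. s ^ N / fact N * exp (- (a * s)))" (is "?int")
    and "(\<integral>s. s ^ N / fact N * exp (- (a * s)) \<partial>occupation t) =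
      t powr (\<beta> - 1) * mittag_leffler3 (real (Suc N)) \<alpha> \<beta> (- a * t powr \<alpha>)" (is "?eq")
proof -
  let ?c = "\<lambda>r. Gamma (real (Suc N) + real r) * (- a * t powr \<alpha>) ^ r /
    (fact r * Gamma (real (Suc N)) * Gamma (\<alpha> * real r + \<beta>))"
  define g where "g r s = (- a) ^ r / (fact r * fact N) * s ^ (N + r)" for r :: nat and s :: real
  have g_int: "integrable (occupation t) (g r)" for r
    unfolding g_def by (rule integrable_mult_right) (rule integrable_occupation_power[OF t])
  note [measurable] = borel_measurable_integrable[OF g_int]
  have g_norm: "norm (g r s) = s ^ N / fact N * (inverse (fact r) * (a * s) ^ r)" if "0 < s" for r s
    using that a by (simp add: g_def abs_mult power_mult_distrib power_add power_abs field_simps)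
  have g_sums: "(\<lambda>r. g r s) sums (s ^ N / fact N * exp (- (a * s)))" for s
  proof -
    have "(\<lambda>r. s ^ N / fact N * ((- (a * s)) ^ r /\<^sub>R fact r)) sums (s ^ N / fact N * exp (- (a * s)))"
      by (intro sums_mult exp_converges)
    moreover have "s ^ N / fact N * ((- (a * s)) ^ r /\<^sub>R fact r) = g r s" for r
    proof -
      have "(- (a * s)) ^ r = (- a) ^ r * s ^ r" using power_mult_distrib[of "- a" s r] by simp
      then show ?thesis by (simp add: g_def power_add divide_inverse mult_ac)
    qed
    ultimately show ?thesis by simp
  qed
  have summ_norm: "AE s in occupation t. summable (\<lambda>r. norm (g r s))"
    using AE_occupation_pos[OF t]
  proof eventually_elim
    case (elim s)
    show ?case unfolding g_norm[OF elim] by (intro summable_mult summable_exp)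
  qed
  have summ_int: "summable (\<lambda>r. \<integral>s. norm (g r s) \<partial>occupation t)"
  proof (rule summable_suminf_not_top)
    have "(\<Sum>r. ennreal (\<integral>s. norm (g r s) \<partial>occupation t)) = (\<Sum>r. \<integral>\<^sup>+s. ennreal (norm (g r s)) \<partial>occupation t)"
      by (intro suminf_cong nn_integral_eq_integral[symmetric]) (auto intro: g_int)
    also have "\<dots> = (\<integral>\<^sup>+s. (\<Sum>r. ennreal (norm (g r s))) \<partial>occupation t)"
      by (rule nn_integral_suminf[symmetric]) measurable
    also have "\<dots> \<le> (\<integral>\<^sup>+s. ennreal (exp ((a + 1) * s)) \<partial>occupation t)"
    proof (rule nn_integral_mono_AE, use AE_occupation_pos[OF t] in eventually_elim)
      case (elim s)
      have "summable (\<lambda>r. norm (g r s))"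
        unfolding g_norm[OF elim] by (intro summable_mult summable_exp)
      then have "(\<Sum>r. ennreal (norm (g r s))) = ennreal (\<Sum>r. norm (g r s))"
        by (intro suminf_ennreal2) auto
      also have "(\<Sum>r. norm (g r s)) = s ^ N / fact N * (\<Sum>r. inverse (fact r) * (a * s) ^ r)"
        unfolding g_norm[OF elim] by (intro suminf_mult summable_exp)
      also have "(\<Sum>r. inverse (fact r) * (a * s) ^ r) = exp (a * s)"
        by (simp add: exp_def scaleR_conv_of_real)
      also have "ennreal (s ^ N / fact N * exp (a * s)) \<le> ennreal (exp s * exp (a * s))"
      proof (intro ennreal_leI mult_right_mono)
        have "(\<Sum>r\<in>{N}. inverse (fact r) * s ^ r) \<le> (\<Sum>r. inverse (fact r) * s ^ r)"
          using elim by (intro sum_le_suminf summable_exp) auto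
        then show "s ^ N / fact N \<le> exp s" by (simp add: exp_def scaleR_conv_of_real divide_inverse mult.commute)
      qed simp
      also have "exp s * exp (a * s) = exp ((a + 1) * s)" by (simp add: exp_add[symmetric] algebra_simps)
      finally show ?case .
    qed
    also have "\<dots> < \<infinity>" using a by (intro occupation_exp_finite[OF t]) auto
    finally show "(\<Sum>r. ennreal (\<integral>s. norm (g r s) \<partial>occupation t)) \<noteq> \<top>" by simp
  qed auto
  have suminf_g: "(\<Sum>r. g r s) = s ^ N / fact N * exp (- (a * s))" for s
    using g_sums[of s] by (rule sums_unique[symmetric])
  show ?int using integrable_suminf[OF g_int summ_norm summ_int] by (simp add: suminf_g)
  have "(\<integral>s. s ^ N / fact N * exp (- (a * s)) \<partial>occupation t) = (\<integral>s. (\<Sum>r. g r s) \<partial>occupation t)"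
    by (simp add: suminf_g)
  also have "\<dots> = (\<Sum>r. \<integral>s. g r s \<partial>occupation t)"
    by (rule integral_suminf[OF g_int summ_norm summ_int])
  also have sums: "(\<lambda>r. \<integral>s. g r s \<partial>occupation t) = (\<lambda>r. t powr (\<beta> - 1) *
      ?c r)"
  proof
    fix r
    have "(\<integral>s. g r s \<partial>occupation t) = (- a) ^ r / (fact r * fact N) *
       (fact (N + r) * t powr (\<alpha> * real (Suc (N + r))) / Gamma (\<alpha> * real (Suc (N + r)) + 1))"
      unfolding g_def by (simp only: integral_mult_right_zero integrable_occupation_power(2)[OF t])
    also have "t powr (\<alpha> * real (Suc (N + r))) = t powr (\<beta> - 1) * (t powr \<alpha>) ^ r"
    proof (cases "t = 0")
      case False
      then have "(t powr \<alpha>) ^ r = t powr (\<alpha> * real r)" using t by (simp add: powr_powr flip: powr_realpow)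
      then show ?thesis by (simp add: \<beta>_def powr_add[symmetric] algebra_simps)
    qed simp
    also have "\<alpha> * real (Suc (N + r)) + 1 = \<alpha> * real r + \<beta>" by (simp add: \<beta>_def algebra_simps)
    also have "(fact (N + r) :: real) = Gamma (real (Suc N) + real r)"
      using Gamma_fact[of "N + r", where 'a = real] by (simp add: algebra_simps)
    also have "(fact N :: real) = Gamma (real (Suc N))"
      using Gamma_fact[of N, where 'a = real] by (simp add: algebra_simps)
    finally show "(\<integral>s. g r s \<partial>occupation t) = t powr (\<beta> - 1) *
      ?c r"
      unfolding power_mult_distrib by (simp add: mult_ac del: of_nat_Suc)
  qed
  also have "(\<Sum>r. t powr (\<beta> - 1) * ?c r) =
      t powr (\<beta> - 1) * mittag_leffler3 (real (Suc N)) \<alpha> \<beta> (- a * t powr \<alpha>)"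
  proof (cases "t = 0")
    case True
    then show ?thesis using \<alpha> by (simp add: \<beta>_def)
  next
    case False
    have "summable (\<lambda>r. \<integral>s. g r s \<partial>occupation t)"
      by (rule summable_comparison_test'[OF summ_int, of 0]) simp
    then have "summable (\<lambda>r. t powr (\<beta> - 1) * ?c r)" unfolding sums .
    then have "summable ?c"
      by (rule summable_mult_D) (use False t in simp)
    then show ?thesis unfolding mittag_leffler3_def by (rule suminf_mult)
  qed
  finally show ?eq .
qed

end

section \<open>Evaluating a process at an independent random time\<close>

text \<open>
Independence of random variables is formulated for a common type of values. The states and the
times have different types; composed with \<open>f\<close> and \<open>g\<close> they become comparable.
\<close>

lemma (in prob_space) independent_processes_nn_integral_mult:
  fixes f :: "'s \<Rightarrow> ennreal" and g :: "'r \<Rightarrow> ennreal"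
  assumes ind: "independent_processes M A X B Y" and s: "0 \<le> s" and t: "0 \<le> t"
    and f: "f \<in> borel_measurable A" and g: "g \<in> borel_measurable B"
  shows "(\<integral>\<^sup>+\<omega>. f (X s \<omega>) * g (Y t \<omega>) \<partial>M) = (\<integral>\<^sup>+\<omega>. f (X s \<omega>) \<partial>M) * (\<integral>\<^sup>+\<omega>. g (Y t \<omega>) \<partial>M)"
proof -
  define VX where "VX = vimage_algebra (space M) (\<lambda>\<omega>. \<lambda>t\<in>{0..}. X t \<omega>) (PiM {0..} (\<lambda>_. A))"
  define VY where "VY = vimage_algebra (space M) (\<lambda>\<omega>. \<lambda>t\<in>{0..}. Y t \<omega>) (PiM {0..} (\<lambda>_. B))"
  have X: "X t \<in> measurable M A" if "0 \<le> t" for t using ind that by (auto simp: independent_processes_def)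
  have Y: "Y t \<in> measurable M B" if "0 \<le> t" for t using ind that by (auto simp: independent_processes_def)
  have indep: "indep_set (sets VX) (sets VY)"
    using ind by (auto simp: independent_processes_def VX_def VY_def)
  have XV: "X s \<in> measurable VX A"
  proof -
    have "(\<lambda>\<omega>. \<lambda>t\<in>{0..}. X t \<omega>) \<in> space M \<rightarrow> space (PiM {0..} (\<lambda>_. A))"
      using measurable_space[OF X] by (auto simp: space_PiM)
    from measurable_compose[OF measurable_vimage_algebra1[OF this] measurable_component_singleton[of s]]
    show ?thesis using s by (simp add: VX_def)
  qed
  have YV: "Y t \<in> measurable VY B"
  proof -
    have "(\<lambda>\<omega>. \<lambda>t\<in>{0..}. Y t \<omega>) \<in> space M \<rightarrow> space (PiM {0..} (\<lambda>_. B))"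
      using measurable_space[OF Y] by (auto simp: space_PiM)
    from measurable_compose[OF measurable_vimage_algebra1[OF this] measurable_component_singleton[of t]]
    show ?thesis using t by (simp add: VY_def)
  qed
  let ?f = "\<lambda>\<omega>. f (X s \<omega>)" and ?g = "\<lambda>\<omega>. g (Y t \<omega>)"
  have spaces: "space VX = space M" "space VY = space M" by (simp_all add: VX_def VY_def)
  have "sigma_sets (space M) {?f -` C \<inter> space M |C. C \<in> sets borel} \<subseteq> sets VX"
    using measurable_sets[OF measurable_compose[OF XV f]]
      sets.sigma_sets_subset[of "{?f -` C \<inter> space M |C. C \<in> sets borel}" VX]
    by (auto simp: spaces)
  moreover have "sigma_sets (space M) {?g -` C \<inter> space M |C. C \<in> sets borel} \<subseteq> sets VY"
    using measurable_sets[OF measurable_compose[OF YV g]]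
      sets.sigma_sets_subset[of "{?g -` C \<inter> space M |C. C \<in> sets borel}" VY]
    by (auto simp: spaces)
  ultimately have "indep_set (sigma_sets (space M) {?f -` C \<inter> space M |C. C \<in> sets borel})
      (sigma_sets (space M) {?g -` C \<inter> space M |C. C \<in> sets borel})"
    using indep unfolding indep_sets2_eq by blast
  then have "indep_var borel ?f borel ?g"
    unfolding indep_var_eq using measurable_compose[OF X[OF s] f] measurable_compose[OF Y[OF t] g] by blast
  then have "indep_vars (\<lambda>_. borel) (case_bool ?f ?g) UNIV"
    unfolding indep_var_def by (rule indep_vars_cong[THEN iffD1, rotated -1]) (auto split: bool.split)
  from indep_vars_nn_integral[OF _ this] show ?thesis by (simp add: UNIV_bool mult.commute)
qed

text \<open>
A dyadic approximation from strictly above. Paths that are right-continuous for the discrete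
topology are eventually constant along it.
\<close>

definition dyadic_above :: "nat \<Rightarrow> real \<Rightarrow> real" where
  "dyadic_above n y = (real (nat \<lfloor>2 ^ n * y\<rfloor>) + 1) / 2 ^ n"

lemma dyadic_above_tendsto:
  assumes y: "0 \<le> y" shows "filterlim (\<lambda>n. dyadic_above n y) (at_right y) sequentially"
proof -
  have bounds: "y < dyadic_above n y" "dyadic_above n y \<le> y + (1 / 2) ^ n" for n
  proof -
    have fl: "real (nat \<lfloor>2 ^ n * y\<rfloor>) = of_int \<lfloor>2 ^ n * y\<rfloor>" using y by simp
    show "y < dyadic_above n y"
      unfolding dyadic_above_def fl by (simp add: pos_less_divide_eq mult.commute)
    have "of_int \<lfloor>2 ^ n * y\<rfloor> + 1 \<le> 2 ^ n * y + (1 :: real)" by simp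
    then have "dyadic_above n y \<le> (2 ^ n * y + 1) / 2 ^ n"
      unfolding dyadic_above_def fl by (rule divide_right_mono) simp
    then show "dyadic_above n y \<le> y + (1 / 2) ^ n" by (simp add: add_divide_distrib power_one_over)
  qed
  have lim: "(\<lambda>n. y + (1 / 2) ^ n) \<longlonglongrightarrow> y + 0" by (intro tendsto_add tendsto_const LIMSEQ_realpow_zero) auto
  have "(\<lambda>n. dyadic_above n y) \<longlonglongrightarrow> y"
  proof (rule tendsto_sandwich[OF _ _ tendsto_const])
    show "\<forall>\<^sub>F n in sequentially. y \<le> dyadic_above n y"
      by (rule always_eventually) (simp add: bounds(1)[THEN less_imp_le])
    show "\<forall>\<^sub>F n in sequentially. dyadic_above n y \<le> y + (1 / 2) ^ n"
      by (rule always_eventually) (simp add: bounds(2))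
    show "(\<lambda>n. y + (1 / 2) ^ n) \<longlonglongrightarrow> y" using lim by simp
  qed
  then show ?thesis
    unfolding filterlim_at using bounds(1) by (simp add: less_imp_neq[THEN not_sym])
qed

locale independent_time_change = prob_space M for M :: "'a measure" +
  fixes S :: "'s set" and Q :: "real \<Rightarrow> 'a \<Rightarrow> 's" and Z :: "real \<Rightarrow> 'a \<Rightarrow> real" and t :: real
  assumes Q [measurable]: "\<And>u. 0 \<le> u \<Longrightarrow> Q u \<in> measurable M (count_space S)"
    and right_cont: "\<And>\<omega> u. \<omega> \<in> space M \<Longrightarrow> 0 \<le> u \<Longrightarrow> \<forall>\<^sub>F s in at_right u. Q s \<omega> = Q u \<omega>"
    and indep: "independent_processes M (count_space S) Q borel Z"
    and t: "0 \<le> t" and Z0: "\<And>\<omega>. 0 \<le> Z t \<omega>"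
begin

text \<open>
Along the dyadic approximations the random time takes countably many values. On each of them
independence separates the time from the state, and right-continuity passes to the limit.
\<close>

lemma time_changed_nn_integral_bounded:
  fixes \<phi> :: "'s \<Rightarrow> real"
  assumes \<phi>: "\<And>x. 0 \<le> \<phi> x" "\<And>x. \<phi> x \<le> B"
  shows "(\<lambda>\<omega>. \<phi> (Q (Z t \<omega>) \<omega>)) \<in> borel_measurable M"
    and "(\<integral>\<^sup>+\<omega>. ennreal (\<phi> (Q (Z t \<omega>) \<omega>)) \<partial>M) = (\<integral>\<^sup>+\<omega>. (\<integral>\<^sup>+\<omega>'. ennreal (\<phi> (Q (Z t \<omega>) \<omega>')) \<partial>M) \<partial>M)"
    and "(\<lambda>\<omega>. \<integral>\<^sup>+\<omega>'. ennreal (\<phi> (Q (Z t \<omega>) \<omega>')) \<partial>M) \<in> borel_measurable M"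
proof -
  define Y where "Y = Z t"
  have [measurable]: "Y \<in> borel_measurable M" using indep t by (simp add: Y_def independent_processes_def)
  have Y0: "0 \<le> Y \<omega>" for \<omega> using Z0 by (simp add: Y_def)
  define H where "H u = (\<integral>\<^sup>+\<omega>. ennreal (\<phi> (Q u \<omega>)) \<partial>M)" for u
  define J where "J n \<omega> = nat \<lfloor>2 ^ n * Y \<omega>\<rfloor>" for n :: nat and \<omega>
  define d where "d n j = (real j + 1) / 2 ^ n" for n j :: nat
  have [measurable]: "J n \<in> measurable M (count_space UNIV)" for n unfolding J_def by measurable
  have d0: "0 \<le> d n j" for n j by (simp add: d_def)
  have dJ: "d n (J n \<omega>) = dyadic_above n (Y \<omega>)" for n \<omega> by (simp add: d_def J_def dyadic_above_def)
  have \<phi>Q: "(\<lambda>\<omega>. \<phi> (Q u \<omega>)) \<in> borel_measurable M" if "0 \<le> u" for u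
    using measurable_compose[OF Q[OF that], of \<phi> borel] by simp
  have [measurable]: "(\<lambda>\<omega>. \<phi> (Q (d n j) \<omega>)) \<in> borel_measurable M" for n j by (rule \<phi>Q[OF d0])
  have [measurable]: "(\<lambda>\<omega>. indicator {j} (J n \<omega>) :: ennreal) \<in> borel_measurable M" for n j
    by (rule measurable_compose[of "J n" M "count_space UNIV"]) simp_all
  have right: "filterlim (\<lambda>n. d n (J n \<omega>)) (at_right (Y \<omega>)) sequentially" for \<omega>
    unfolding dJ by (rule dyadic_above_tendsto[OF Y0])
  have Q_lim: "(\<lambda>n. \<phi> (Q (d n (J n \<omega>)) \<omega>)) \<longlonglongrightarrow> \<phi> (Q (Y \<omega>) \<omega>)" if "\<omega> \<in> space M" for \<omega>
  proof (rule tendsto_eventually)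
    show "\<forall>\<^sub>F n in sequentially. \<phi> (Q (d n (J n \<omega>)) \<omega>) = \<phi> (Q (Y \<omega>) \<omega>)"
      using filterlim_iff[THEN iffD1, OF right[of \<omega>], rule_format, OF right_cont[OF that Y0]]
      by eventually_elim simp
  qed
  have meas_n [measurable]: "(\<lambda>\<omega>. \<phi> (Q (d n (J n \<omega>)) \<omega>)) \<in> borel_measurable M" for n
    by (rule measurable_compose_countable[where f = "\<lambda>j \<omega>. \<phi> (Q (d n j) \<omega>)"]) (auto simp: d0)
  have meas [measurable]: "(\<lambda>\<omega>. \<phi> (Q (Y \<omega>) \<omega>)) \<in> borel_measurable M"
    by (rule borel_measurable_LIMSEQ_metric[OF meas_n Q_lim])
  then show "(\<lambda>\<omega>. \<phi> (Q (Z t \<omega>) \<omega>)) \<in> borel_measurable M" by (simp add: Y_def)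
  have H_le: "H u \<le> ennreal B" for u
  proof -
    have "H u \<le> (\<integral>\<^sup>+\<omega>. ennreal B \<partial>M)" unfolding H_def by (intro nn_integral_mono ennreal_leI \<phi>)
    then show ?thesis by (simp add: emeasure_space_1)
  qed
  have H_lim: "(\<lambda>n. H (X n)) \<longlonglongrightarrow> H u" if X: "filterlim X (at_right u) sequentially" and u: "0 \<le> u" and X0: "\<And>n. 0 \<le> X n" for X u
    unfolding H_def
  proof (rule nn_integral_dominated_convergence[where w = "\<lambda>_. ennreal B"])
    show "AE \<omega> in M. (\<lambda>n. ennreal (\<phi> (Q (X n) \<omega>))) \<longlonglongrightarrow> ennreal (\<phi> (Q u \<omega>))"
    proof (rule AE_I2, rule tendsto_eventually)
      fix \<omega> assume "\<omega> \<in> space M"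
      from filterlim_iff[THEN iffD1, OF X, rule_format, OF right_cont[OF this u]]
      show "\<forall>\<^sub>F n in sequentially. ennreal (\<phi> (Q (X n) \<omega>)) = ennreal (\<phi> (Q u \<omega>))"
        by eventually_elim simp
    qed
  qed (use X0 u \<phi> in \<open>auto simp: emeasure_space_1 intro!: ennreal_leI \<phi>Q\<close>)
  have step: "(\<integral>\<^sup>+\<omega>. ennreal (\<phi> (Q (d n (J n \<omega>)) \<omega>)) \<partial>M) = (\<integral>\<^sup>+\<omega>. H (d n (J n \<omega>)) \<partial>M)" for n
  proof -
    have single: "(\<Sum>j. c j * indicator {j} (J n \<omega>)) = c (J n \<omega>)" for c :: "nat \<Rightarrow> ennreal" and \<omega>
      by (subst suminf_finite[of "{J n \<omega>}"]) (auto simp: indicator_def)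
    have "(\<integral>\<^sup>+\<omega>. ennreal (\<phi> (Q (d n (J n \<omega>)) \<omega>)) \<partial>M) =
        (\<integral>\<^sup>+\<omega>. (\<Sum>j. ennreal (\<phi> (Q (d n j) \<omega>)) * indicator {j} (J n \<omega>)) \<partial>M)"
      unfolding single ..
    also have "\<dots> = (\<Sum>j. \<integral>\<^sup>+\<omega>. ennreal (\<phi> (Q (d n j) \<omega>)) * indicator {j} (J n \<omega>) \<partial>M)"
      by (intro nn_integral_suminf) measurable
    also have "\<dots> = (\<Sum>j. \<integral>\<^sup>+\<omega>. H (d n j) * indicator {j} (J n \<omega>) \<partial>M)"
    proof (intro suminf_cong)
      fix j
      have "(\<integral>\<^sup>+\<omega>. ennreal (\<phi> (Q (d n j) \<omega>)) * indicator {j} (nat \<lfloor>2 ^ n * Y \<omega>\<rfloor>) \<partial>M) =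
          H (d n j) * (\<integral>\<^sup>+\<omega>. indicator {j} (nat \<lfloor>2 ^ n * Y \<omega>\<rfloor>) \<partial>M)"
        unfolding H_def
        unfolding Y_def
        by (rule independent_processes_nn_integral_mult[OF indep d0 t, of "\<lambda>x. ennreal (\<phi> x)"
              "\<lambda>y. indicator {j} (nat \<lfloor>2 ^ n * y\<rfloor>)"]) simp_all
      then show "(\<integral>\<^sup>+\<omega>. ennreal (\<phi> (Q (d n j) \<omega>)) * indicator {j} (J n \<omega>) \<partial>M) =
          (\<integral>\<^sup>+\<omega>. H (d n j) * indicator {j} (J n \<omega>) \<partial>M)"
        unfolding J_def by (subst nn_integral_cmult) simp_all
    qed
    also have "\<dots> = (\<integral>\<^sup>+\<omega>. (\<Sum>j. H (d n j) * indicator {j} (J n \<omega>)) \<partial>M)"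
      by (intro nn_integral_suminf[symmetric]) auto
    also have "\<dots> = (\<integral>\<^sup>+\<omega>. H (d n (J n \<omega>)) \<partial>M)" unfolding single ..
    finally show ?thesis .
  qed
  have HJ_meas [measurable]: "(\<lambda>\<omega>. H (d n (J n \<omega>))) \<in> borel_measurable M" for n
    by (rule measurable_compose_countable[where f = "\<lambda>j \<omega>. H (d n j)"]) auto
  have HJ_lim: "(\<lambda>n. H (d n (J n \<omega>))) \<longlonglongrightarrow> H (Y \<omega>)" for \<omega>
    by (rule H_lim[OF right Y0 d0])
  have HY_meas [measurable]: "(\<lambda>\<omega>. H (Y \<omega>)) \<in> borel_measurable M"
    by (rule borel_measurable_LIMSEQ_order[OF HJ_lim HJ_meas])
  then show "(\<lambda>\<omega>. \<integral>\<^sup>+\<omega>'. ennreal (\<phi> (Q (Z t \<omega>) \<omega>')) \<partial>M) \<in> borel_measurable M"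
    by (simp add: H_def Y_def)
  have "(\<lambda>n. \<integral>\<^sup>+\<omega>. ennreal (\<phi> (Q (d n (J n \<omega>)) \<omega>)) \<partial>M) \<longlonglongrightarrow> (\<integral>\<^sup>+\<omega>. ennreal (\<phi> (Q (Y \<omega>) \<omega>)) \<partial>M)"
    by (rule nn_integral_dominated_convergence[where w = "\<lambda>_. ennreal B"])
       (use \<phi> Q_lim in \<open>auto simp: emeasure_space_1 intro!: ennreal_leI tendsto_ennrealI\<close>)
  moreover have "(\<lambda>n. \<integral>\<^sup>+\<omega>. H (d n (J n \<omega>)) \<partial>M) \<longlonglongrightarrow> (\<integral>\<^sup>+\<omega>. H (Y \<omega>) \<partial>M)"
    by (rule nn_integral_dominated_convergence[where w = "\<lambda>_. ennreal B"])
       (use H_le HJ_lim in \<open>auto simp: emeasure_space_1\<close>)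
  ultimately have "(\<integral>\<^sup>+\<omega>. ennreal (\<phi> (Q (Y \<omega>) \<omega>)) \<partial>M) = (\<integral>\<^sup>+\<omega>. H (Y \<omega>) \<partial>M)"
    unfolding step by (rule LIMSEQ_unique)
  then show "(\<integral>\<^sup>+\<omega>. ennreal (\<phi> (Q (Z t \<omega>) \<omega>)) \<partial>M) = (\<integral>\<^sup>+\<omega>. (\<integral>\<^sup>+\<omega>'. ennreal (\<phi> (Q (Z t \<omega>) \<omega>')) \<partial>M) \<partial>M)"
    by (simp add: H_def Y_def)
qed

lemma time_changed_nn_integral:
  fixes \<phi> :: "'s \<Rightarrow> real"
  assumes \<phi>: "\<And>x. 0 \<le> \<phi> x"
  shows "(\<lambda>\<omega>. \<phi> (Q (Z t \<omega>) \<omega>)) \<in> borel_measurable M"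
    and "(\<integral>\<^sup>+\<omega>. ennreal (\<phi> (Q (Z t \<omega>) \<omega>)) \<partial>M) = (\<integral>\<^sup>+\<omega>. (\<integral>\<^sup>+\<omega>'. ennreal (\<phi> (Q (Z t \<omega>) \<omega>')) \<partial>M) \<partial>M)"
    and "(\<lambda>\<omega>. \<integral>\<^sup>+\<omega>'. ennreal (\<phi> (Q (Z t \<omega>) \<omega>')) \<partial>M) \<in> borel_measurable M"
proof -
  define f where "f N x = min (\<phi> x) (real N)" for N :: nat and x
  have f: "0 \<le> f N x" "f N x \<le> real N" for N x using \<phi>[of x] by (auto simp: f_def)
  note bounded = time_changed_nn_integral_bounded[where \<phi> = "f N" and B = "real N" for N, OF f]
  have f_ev: "\<forall>\<^sub>F N in sequentially. f N x = \<phi> x" for x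
  proof -
    obtain n :: nat where "\<phi> x \<le> real n" using real_arch_simple by blast
    then show ?thesis
      by (intro eventually_mono[OF eventually_ge_at_top[of n]]) (auto simp: f_def)
  qed
  have f_lim: "(\<lambda>N. f N x) \<longlonglongrightarrow> \<phi> x" for x by (rule tendsto_eventually[OF f_ev])
  have f_mono: "ennreal (f M x) \<le> ennreal (f N x)" if "M \<le> N" for M N x
    using that by (intro ennreal_leI) (auto simp: f_def)
  show "(\<lambda>\<omega>. \<phi> (Q (Z t \<omega>) \<omega>)) \<in> borel_measurable M"
    by (rule borel_measurable_LIMSEQ_metric[OF bounded(1) f_lim])
  have lim: "(\<lambda>N. \<integral>\<^sup>+\<omega>'. ennreal (f N (Q u \<omega>')) \<partial>M) \<longlonglongrightarrow> (\<integral>\<^sup>+\<omega>'. ennreal (\<phi> (Q u \<omega>')) \<partial>M)"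
    if u: "0 \<le> u" for u
  proof (rule nn_integral_LIMSEQ)
    show "(\<lambda>\<omega>'. ennreal (f N (Q u \<omega>'))) \<in> borel_measurable M" for N
      using measurable_compose[OF Q[OF u], of "\<lambda>x. ennreal (f N x)" borel] by simp
  qed (auto simp: incseq_def le_fun_def f_mono intro!: tendsto_ennrealI f_lim)
  show "(\<lambda>\<omega>. \<integral>\<^sup>+\<omega>'. ennreal (\<phi> (Q (Z t \<omega>) \<omega>')) \<partial>M) \<in> borel_measurable M"
    by (rule borel_measurable_LIMSEQ_order[OF lim[OF Z0] bounded(3)])
  have "(\<lambda>N. \<integral>\<^sup>+\<omega>. ennreal (f N (Q (Z t \<omega>) \<omega>)) \<partial>M) \<longlonglongrightarrow> (\<integral>\<^sup>+\<omega>. ennreal (\<phi> (Q (Z t \<omega>) \<omega>)) \<partial>M)"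
    using bounded(1) by (intro nn_integral_LIMSEQ) (auto simp: incseq_def le_fun_def f_mono intro!: tendsto_ennrealI f_lim)
  moreover have "(\<lambda>N. \<integral>\<^sup>+\<omega>. (\<integral>\<^sup>+\<omega>'. ennreal (f N (Q (Z t \<omega>) \<omega>')) \<partial>M) \<partial>M) \<longlonglongrightarrow>
      (\<integral>\<^sup>+\<omega>. (\<integral>\<^sup>+\<omega>'. ennreal (\<phi> (Q (Z t \<omega>) \<omega>')) \<partial>M) \<partial>M)"
  proof (rule nn_integral_LIMSEQ)
    show "incseq (\<lambda>N \<omega>. \<integral>\<^sup>+\<omega>'. ennreal (f N (Q (Z t \<omega>) \<omega>')) \<partial>M)"
      by (auto simp: incseq_def le_fun_def intro!: nn_integral_mono f_mono)
    show "(\<lambda>\<omega>. \<integral>\<^sup>+\<omega>'. ennreal (f N (Q (Z t \<omega>) \<omega>')) \<partial>M) \<in> borel_measurable M" for N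
      by (rule bounded(3))
    show "(\<lambda>N. \<integral>\<^sup>+\<omega>'. ennreal (f N (Q (Z t \<omega>) \<omega>')) \<partial>M) \<longlonglongrightarrow>
        (\<integral>\<^sup>+\<omega>'. ennreal (\<phi> (Q (Z t \<omega>) \<omega>')) \<partial>M)" for \<omega>
      using lim[of "Z t \<omega>"] Z0[of \<omega>] by simp
  qed
  ultimately show "(\<integral>\<^sup>+\<omega>. ennreal (\<phi> (Q (Z t \<omega>) \<omega>)) \<partial>M) = (\<integral>\<^sup>+\<omega>. (\<integral>\<^sup>+\<omega>'. ennreal (\<phi> (Q (Z t \<omega>) \<omega>')) \<partial>M) \<partial>M)"
    by (simp only: bounded(2) LIMSEQ_unique)
qed

end

section \<open>The time-changed queue\<close>

lemma finite_multi_indices: "finite (multi_indices l n)"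
proof (rule finite_subset)
  show "multi_indices l n \<subseteq> {1..l} \<rightarrow>\<^sub>E {..n}"
  proof
    fix m assume m: "m \<in> multi_indices l n"
    then have "m j \<le> n" if "j \<in> {1..l}" for j
      using member_le_sum[of j "{1..l}" m] that by (auto simp: multi_indices_def)
    then show "m \<in> {1..l} \<rightarrow>\<^sub>E {..n}" using m by (auto simp: multi_indices_def PiE_iff)
  qed
qed (auto intro: finite_PiE)

lemma ennreal_suminf_swap:
  fixes f :: "nat \<Rightarrow> nat \<Rightarrow> ennreal"
  shows "(\<Sum>i. \<Sum>j. f i j) = (\<Sum>j. \<Sum>i. f i j)"
  using nn_integral_suminf[of "\<lambda>i j. f i j" "count_space UNIV"] by (simp add: nn_integral_count_space_nat)

lemma ennreal_suminf_finite_summable: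
  fixes f :: "nat \<Rightarrow> real"
  assumes "\<And>i. 0 \<le> f i" "(\<Sum>i. ennreal (f i)) \<noteq> \<top>"
  shows "summable f" "ennreal (suminf f) = (\<Sum>i. ennreal (f i))"
  using assms summable_suminf_not_top[of f] by auto

context erlang_parameters
begin

lemma C0_nonneg: "0 \<le> C0 k l mu lam h n m"
proof -
  have "0 \<le> arrival_prob l lam i" if "i \<in> {1..l}" for i
    using lam[OF that] total_rate_pos by (simp add: arrival_prob_def)
  then show ?thesis using mu total_rate_pos
    by (auto simp: C0_def intro!: mult_nonneg_nonneg prod_nonneg divide_nonneg_nonneg)
qed

text \<open>
Each triple \<open>(h, n, m)\<close> belongs to a single \<open>N\<close> with \<open>gamma0 = Suc N\<close>. For given \<open>N\<close> the terms form
a finite sum, which \<open>empty_coeff_eq_sum\<close> evaluates; the order of summation is immaterial in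
\<open>ennreal\<close>.
\<close>

lemma sum_C0_regroup:
  fixes J :: "nat \<Rightarrow> real"
  assumes J: "\<And>N. 0 \<le> J N"
  shows "(\<Sum>h. \<Sum>n. ennreal (\<Sum>m\<in>multi_indices l n. C0 k l mu lam (Suc h) n m * J (gamma0 k l (Suc h) n m - 1))) =
    (\<Sum>N. ennreal (empty_coeff N 0 * J N))"
proof -
  define g where "g h n m = C0 k l mu lam (Suc h) n m * J (gamma0 k l (Suc h) n m - 1)" for h n m
  define G where "G N h n = (\<Sum>m\<in>{m\<in>multi_indices l n. gamma0 k l (Suc h) n m = Suc N}. g h n m)" for N h n
  have g0: "0 \<le> g h n m" for h n m using C0_nonneg J by (simp add: g_def)
  have G0: "0 \<le> G N h n" for N h n unfolding G_def by (intro sum_nonneg g0)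
  have split: "ennreal (\<Sum>m\<in>multi_indices l n. g h n m) = (\<Sum>N. ennreal (G N h n))" for h n
  proof -
    define R where "R = (\<Sum>m\<in>multi_indices l n. gamma0 k l (Suc h) n m)"
    have le: "gamma0 k l (Suc h) n m - 1 \<in> {..R}" if "m \<in> multi_indices l n" for m
      using member_le_sum[of m "multi_indices l n" "gamma0 k l (Suc h) n"] that finite_multi_indices[of l n]
      by (simp add: R_def le_diff_conv)
    have set_eq: "{m\<in>multi_indices l n. gamma0 k l (Suc h) n m = Suc N} =
        {m\<in>multi_indices l n. gamma0 k l (Suc h) n m - 1 = N}" for N
      by (auto simp: gamma0_def)
    have "(\<Sum>m\<in>multi_indices l n. g h n m) = (\<Sum>N\<le>R. G N h n)"
      unfolding G_def set_eq using le
      by (intro sum.group[symmetric] finite_multi_indices) auto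
    moreover have "G N h n = 0" if "N \<notin> {..R}" for N
    proof -
      have "{m\<in>multi_indices l n. gamma0 k l (Suc h) n m = Suc N} = {}"
        unfolding set_eq using that le by blast
      then show ?thesis by (simp only: G_def sum.empty)
    qed
    ultimately show ?thesis
      by (subst suminf_finite[of "{..R}"]) (auto simp: sum_ennreal G0)
  qed
  have inner: "(\<Sum>n. ennreal (G N h n)) = ennreal (hitting_coeff N (Suc h) * J N)" for N h
  proof -
    have set_eq: "{m\<in>multi_indices l n. gamma0 k l (Suc h) n m = Suc N} =
        {m\<in>path_indices k l N (Suc h). (\<Sum>j=1..l. m j) = n}" for n
      by (auto simp: multi_indices_def path_indices_def)
    have "hitting_coeff N (Suc h) * J N =
        (\<Sum>m\<in>path_indices k l N (Suc h). g h (\<Sum>j=1..l. m j) m)"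
      unfolding hitting_coeff_def sum_distrib_right
      by (intro sum.cong refl) (simp add: g_def path_indices_def)
    also have "\<dots> = (\<Sum>n\<le>Suc N. \<Sum>m\<in>{m\<in>path_indices k l N (Suc h). (\<Sum>j=1..l. m j) = n}. g h (\<Sum>j=1..l. m j) m)"
      by (intro sum.group[symmetric] finite_path_indices) (auto simp: path_indices_def gamma0_def)
    also have "\<dots> = (\<Sum>n\<le>Suc N. G N h n)"
      unfolding G_def set_eq by (intro sum.cong refl) auto
    finally have "hitting_coeff N (Suc h) * J N = (\<Sum>n\<le>Suc N. G N h n)" .
    moreover have "G N h n = 0" if "n \<notin> {..Suc N}" for n
    proof -
      have "{m\<in>multi_indices l n. gamma0 k l (Suc h) n m = Suc N} = {}"
        using that by (auto simp: gamma0_def)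
      then show ?thesis by (simp only: G_def sum.empty)
    qed
    ultimately show ?thesis
      by (subst suminf_finite[of "{..Suc N}"]) (auto simp: sum_ennreal G0 simp del: sum.atMost_Suc)
  qed
  have outer: "(\<Sum>h. ennreal (hitting_coeff N (Suc h) * J N)) = ennreal (empty_coeff N 0 * J N)" for N
  proof -
    have "empty_coeff N 0 = (\<Sum>i\<in>{0<..Suc N}. hitting_coeff N i)" by (rule empty_coeff_eq_sum) simp
    also have "\<dots> = (\<Sum>h\<le>N. hitting_coeff N (Suc h))"
      by (rule sum.reindex_bij_witness[where i = Suc and j = "\<lambda>i. i - 1"]) auto
    finally have "empty_coeff N 0 * J N = (\<Sum>h\<le>N. hitting_coeff N (Suc h) * J N)"
      by (simp add: sum_distrib_right)
    moreover have "hitting_coeff N (Suc h) * J N = 0" if "h \<notin> {..N}" for h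
      using that by (simp add: hitting_coeff_eq_0)
    moreover have "0 \<le> hitting_coeff N (Suc h) * J N" for h
      unfolding hitting_coeff_def by (intro mult_nonneg_nonneg sum_nonneg C0_nonneg J)
    ultimately show ?thesis
      by (subst suminf_finite[of "{..N}"]) (auto simp: sum_ennreal)
  qed
  have "(\<Sum>h. \<Sum>n. ennreal (\<Sum>m\<in>multi_indices l n. g h n m)) = (\<Sum>h. \<Sum>N. \<Sum>n. ennreal (G N h n))"
    unfolding split by (intro suminf_cong ennreal_suminf_swap)
  also have "\<dots> = (\<Sum>N. \<Sum>h. \<Sum>n. ennreal (G N h n))" by (rule ennreal_suminf_swap)
  finally show ?thesis by (simp add: inner outer g_def)
qed

lemma empty_prob_origin_suminf:
  assumes "0 \<le> s"
  shows "ennreal (empty_prob s 0) = (\<Sum>N. ennreal (empty_coeff N 0) * ennreal (s ^ N / fact N * exp (- (jump_rate * s))))"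
proof -
  have "(\<lambda>N. exp (- jump_rate * s) * (empty_coeff N 0 / fact N * s ^ N)) sums empty_prob s 0"
    unfolding empty_prob_def empty_series_def by (intro sums_mult summable_sums summable_empty_series)
  then have S: "(\<lambda>N. empty_coeff N 0 * (s ^ N / fact N * exp (- (jump_rate * s)))) sums empty_prob s 0"
    by (simp add: mult_ac)
  have nn: "0 \<le> empty_coeff N 0 * (s ^ N / fact N * exp (- (jump_rate * s)))" for N
    using assms empty_coeff_nonneg by simp
  have "ennreal (empty_prob s 0) = (\<Sum>N. ennreal (empty_coeff N 0 * (s ^ N / fact N * exp (- (jump_rate * s)))))"
    using suminf_ennreal2[OF nn sums_summable[OF S]] sums_unique[OF S] by simp
  also have "\<dots> = (\<Sum>N. ennreal (empty_coeff N 0) * ennreal (s ^ N / fact N * exp (- (jump_rate * s))))"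
    using assms empty_coeff_nonneg by (intro suminf_cong ennreal_mult) auto
  finally show ?thesis .
qed

end

lemma (in prob_space) nn_integral_markov_process:
  fixes Q :: "real \<Rightarrow> 'a \<Rightarrow> 's :: countable"
  assumes Q: "\<And>u. 0 \<le> u \<Longrightarrow> Q u \<in> measurable M (count_space S)"
    and start: "AE \<omega> in M. Q 0 \<omega> = x" and x: "x \<in> S"
    and p: "transition_function S p"
    and markov: "\<And>h y. 0 \<le> h \<Longrightarrow> y \<in> S \<Longrightarrow> \<P>(\<omega> in M. Q h \<omega> = y \<bar> Q 0 \<omega> = x) = p h x y"
    and h: "0 \<le> h"
  shows "(\<integral>\<^sup>+\<omega>. f (Q h \<omega>) \<partial>M) = (\<integral>\<^sup>+y. f y \<partial>transition_kernel S p h x)"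
proof -
  have Qm: "Q u \<in> measurable M (count_space UNIV)" if "0 \<le> u" for u
    using measurable_compose[OF Q[OF that], of "\<lambda>x. x" "count_space UNIV"] by simp
  note [measurable] = Qm[OF h] Qm[of 0, simplified]
  have "distr M (count_space UNIV) (Q h) = measure_pmf (transition_kernel S p h x)"
  proof (rule measure_eqI_countable[where A = UNIV])
    fix y :: 's
    have "emeasure (distr M (count_space UNIV) (Q h)) {y} = emeasure M {\<omega>\<in>space M. Q h \<omega> = y}"
      by (subst emeasure_distr) (auto intro!: arg_cong2[where f = emeasure])
    also have "\<dots> = ennreal (if y \<in> S then p h x y else 0)"
    proof (cases "y \<in> S")
      case True
      have "prob {\<omega>\<in>space M. Q 0 \<omega> = x} = 1" using start by (subst prob_Collect_eq_1) auto
      moreover have "prob {\<omega>\<in>space M. Q h \<omega> = y \<and> Q 0 \<omega> = x} = prob {\<omega>\<in>space M. Q h \<omega> = y}"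
        using start by (intro prob_eq_AE) auto
      ultimately have "prob {\<omega>\<in>space M. Q h \<omega> = y} = p h x y"
        using markov[OF h True] by (simp add: cond_prob_def)
      then show ?thesis using True by (simp add: emeasure_eq_measure)
    next
      case False
      have "{\<omega>\<in>space M. Q h \<omega> = y} = {}" using measurable_space[OF Q[OF h]] False by auto
      then show ?thesis using False by (simp only: emeasure_empty if_False ennreal_0)
    qed
    also have "\<dots> = emeasure (measure_pmf (transition_kernel S p h x)) {y}"
      by (simp add: emeasure_pmf_single pmf_transition_kernel[OF p h x])
    finally show "emeasure (distr M (count_space UNIV) (Q h)) {y} = emeasure (measure_pmf (transition_kernel S p h x)) {y}" .
  qed auto
  then have "(\<integral>\<^sup>+y. f y \<partial>transition_kernel S p h x) = (\<integral>\<^sup>+y. f y \<partial>distr M (count_space UNIV) (Q h))" by simp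
  also have "\<dots> = (\<integral>\<^sup>+\<omega>. f (Q h \<omega>) \<partial>M)" by (rule nn_integral_distr) auto
  finally show ?thesis by simp
qed

text \<open>
The assumption \<open>Q_transition\<close> is the Markov property with present time 0 and empty past.
\<close>

locale time_changed_erlang =
  erlang_kernel k l mu lam p + stable_hitting M \<alpha> D
  for k l :: nat and mu :: real and lam :: "nat \<Rightarrow> real"
    and p :: "real \<Rightarrow> nat \<times> nat \<Rightarrow> nat \<times> nat \<Rightarrow> real"
    and M :: "'a measure" and \<alpha> :: real and D :: "real \<Rightarrow> 'a \<Rightarrow> real" +
  fixes Q :: "real \<Rightarrow> 'a \<Rightarrow> nat \<times> nat"
  assumes Q_measurable: "\<And>u. 0 \<le> u \<Longrightarrow> Q u \<in> measurable M (count_space (erlang_states k))"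
    and Q_right_continuous: "\<And>\<omega> u. \<omega> \<in> space M \<Longrightarrow> 0 \<le> u \<Longrightarrow> \<forall>\<^sub>F s in at_right u. Q s \<omega> = Q u \<omega>"
    and Q_start: "AE \<omega> in M. Q 0 \<omega> = (0, 0)"
    and Q_transition: "\<And>h y. 0 \<le> h \<Longrightarrow> y \<in> erlang_states k \<Longrightarrow>
       \<P>(\<omega> in M. Q h \<omega> = y \<bar> Q 0 \<omega> = (0, 0)) = p h (0, 0) y"
    and independent: "independent_processes M (count_space (erlang_states k)) Q borel (hitting_time D)"
begin

abbreviation Q\<alpha> :: "real \<Rightarrow> 'a \<Rightarrow> nat \<times> nat" where
  "Q\<alpha> \<equiv> time_changed Q (hitting_time D)"

lemma nn_integral_queue_length_untimed:
  assumes u: "0 \<le> u"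
  shows "(\<integral>\<^sup>+\<omega>. ennreal (real (phase_number k (Q u \<omega>))) \<partial>M) = ennreal (mean_phases u)"
  using nn_integral_markov_process[OF Q_measurable Q_start origin_state transition Q_transition u,
      of "\<lambda>y. ennreal (real (phase_number k y))"]
    nn_integral_phase_number(1)[OF u] by simp

lemma
  assumes t: "0 \<le> t"
  shows queue_length_measurable: "(\<lambda>\<omega>. real (queue_length k Q\<alpha> t \<omega>)) \<in> borel_measurable M" (is ?meas)
    and nn_integral_queue_length: "(\<integral>\<^sup>+\<omega>. ennreal (real (queue_length k Q\<alpha> t \<omega>)) \<partial>M) =
      (\<integral>\<^sup>+\<omega>. ennreal (mean_phases (hitting_time D t \<omega>)) \<partial>M)" (is ?eq)
    and mean_phases_measurable: "(\<lambda>\<omega>. ennreal (mean_phases (hitting_time D t \<omega>))) \<in> borel_measurable M" (is ?mmeas)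
proof -
  interpret time_change: independent_time_change M "erlang_states k" Q "hitting_time D" t
    by unfold_locales (simp_all add: Q_measurable Q_right_continuous independent t hitting_time_nonneg)
  note time_change.time_changed_nn_integral[of "\<lambda>y. real (phase_number k y)"]
  then show ?meas ?eq ?mmeas
    by (simp_all add: nn_integral_queue_length_untimed hitting_time_nonneg queue_length_def time_changed_def)
qed

lemma nn_integral_hitting_time_eq:
  assumes t: "0 \<le> t"
  shows "(\<integral>\<^sup>+\<omega>. ennreal (hitting_time D t \<omega>) \<partial>M) = ennreal (t powr \<alpha> / Gamma (\<alpha> + 1))"
proof -
  have "(\<integral>\<^sup>+\<omega>. ennreal (hitting_time D t \<omega>) \<partial>M) =
      (\<integral>\<^sup>+\<omega>. (\<integral>\<^sup>+s. 1 * indicator {0<..hitting_time D t \<omega>} s \<partial>lborel) \<partial>M)"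
    using hitting_time_nonneg by (intro nn_integral_cong) simp
  also have "\<dots> = (\<integral>\<^sup>+s. 1 \<partial>occupation t)" by (rule nn_integral_occupation[OF t, symmetric]) simp
  also have "\<dots> = ennreal (t powr \<alpha> / Gamma (\<alpha> + 1))"
    using occupation_moment[OF t, of 0] by simp
  finally show ?thesis .
qed

lemma empty_prob_measurable: "(\<lambda>s. ennreal (empty_prob s 0)) \<in> borel_measurable borel"
proof -
  have [measurable]: "(\<lambda>s. empty_prob s 0) \<in> borel_measurable borel"
    by (rule borel_measurable_continuous_onI[OF continuous_on_empty_prob])
  show ?thesis by measurable
qed

lemma nn_integral_empty_prob:
  assumes y: "0 \<le> y"
  shows "(\<integral>\<^sup>+s. ennreal (empty_prob s 0) * indicator {0<..y} s \<partial>lborel) = ennreal (integral {0..y} (\<lambda>s. empty_prob s 0))"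
    and "0 \<le> integral {0..y} (\<lambda>s. empty_prob s 0)"
proof -
  have int: "(\<lambda>s. empty_prob s 0) integrable_on {0..y}"
    by (rule integrable_continuous_real[OF continuous_on_empty_prob])
  have "(\<integral>\<^sup>+s. ennreal (empty_prob s 0) * indicator {0<..y} s \<partial>lborel) =
      (\<integral>\<^sup>+s. ennreal (empty_prob s 0) * indicator {0..y} s \<partial>lborel)"
    by (intro nn_integral_cong_AE eventually_mono[OF AE_lborel_singleton[of 0]]) (auto split: split_indicator)
  also have "\<dots> = ennreal (integral {0..y} (\<lambda>s. empty_prob s 0))"
    by (rule nn_integral_has_integral_lebesgue'[OF _ integrable_integral[OF int]]) (simp add: empty_prob_nonneg)
  finally show "(\<integral>\<^sup>+s. ennreal (empty_prob s 0) * indicator {0<..y} s \<partial>lborel) = ennreal (integral {0..y} (\<lambda>s. empty_prob s 0))" .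
  show "0 \<le> integral {0..y} (\<lambda>s. empty_prob s 0)"
    by (rule Henstock_Kurzweil_Integration.integral_nonneg[OF int]) (simp add: empty_prob_nonneg)
qed

text \<open>
The drift may be negative. Its service part is moved to the left, so that all integrals are of
nonnegative functions.
\<close>

lemma nn_integral_queue_length_balance:
  assumes t: "0 \<le> t"
  shows "(\<integral>\<^sup>+\<omega>. ennreal (real (queue_length k Q\<alpha> t \<omega>)) \<partial>M) + ennreal (real k * mu * (t powr \<alpha> / Gamma (\<alpha> + 1))) =
    ennreal (real k * (\<Sum>m=1..l. real m * lam m) * (t powr \<alpha> / Gamma (\<alpha> + 1))) +
    ennreal (real k * mu) * (\<integral>\<^sup>+s. ennreal (empty_prob s 0) \<partial>occupation t)"
proof -
  let ?Y = "hitting_time D t"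
  note [measurable] = hitting_measurable[OF t] mean_phases_measurable[OF t] empty_prob_measurable
  define A where "A = real k * (\<Sum>m=1..l. real m * lam m)"
  have A: "0 \<le> A" unfolding A_def using lam
    by (intro mult_nonneg_nonneg sum_nonneg) (auto intro: less_imp_le)
  have B: "0 \<le> real k * mu" using mu by simp
  let ?I = "\<lambda>\<omega>. \<integral>\<^sup>+s. ennreal (empty_prob s 0) * indicator {0<..?Y \<omega>} s \<partial>lborel"
  have pointwise: "ennreal (mean_phases (?Y \<omega>)) + ennreal (real k * mu) * ennreal (?Y \<omega>) =
      ennreal A * ennreal (?Y \<omega>) + ennreal (real k * mu) * ?I \<omega>" for \<omega>
  proof -
    have y: "0 \<le> ?Y \<omega>" by (rule hitting_time_nonneg)
    have "mean_phases (?Y \<omega>) + real k * mu * ?Y \<omega> = A * ?Y \<omega> + real k * mu * integral {0..?Y \<omega>} (\<lambda>s. empty_prob s 0)"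
      by (simp add: mean_phases_def drift_def A_def algebra_simps)
    then show ?thesis
      unfolding nn_integral_empty_prob(1)[OF y]
      using y A B nn_integral_empty_prob(2)[OF y] nn_integral_phase_number(2)[OF y]
      by (simp add: ennreal_mult[symmetric] ennreal_plus[symmetric] del: ennreal_plus)
  qed
  have I_measurable [measurable]: "?I \<in> borel_measurable M"
  proof -
    have "(\<lambda>(\<omega>, s). ennreal (empty_prob s 0) * indicator {0<..?Y \<omega>} s) \<in> borel_measurable (M \<Otimes>\<^sub>M lborel)"
      by (simp add: indicator_def)
    then show ?thesis by (rule lborel.borel_measurable_nn_integral)
  qed
  have "(\<integral>\<^sup>+\<omega>. ennreal (mean_phases (?Y \<omega>)) + ennreal (real k * mu) * ennreal (?Y \<omega>) \<partial>M) =
      (\<integral>\<^sup>+\<omega>. ennreal A * ennreal (?Y \<omega>) + ennreal (real k * mu) * ?I \<omega> \<partial>M)"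
    unfolding pointwise ..
  then have "(\<integral>\<^sup>+\<omega>. ennreal (mean_phases (?Y \<omega>)) \<partial>M) + ennreal (real k * mu) * (\<integral>\<^sup>+\<omega>. ennreal (?Y \<omega>) \<partial>M) =
      ennreal A * (\<integral>\<^sup>+\<omega>. ennreal (?Y \<omega>) \<partial>M) + ennreal (real k * mu) * (\<integral>\<^sup>+\<omega>. ?I \<omega> \<partial>M)"
    by (simp add: nn_integral_add nn_integral_cmult)
  moreover have "0 \<le> t powr \<alpha> / Gamma (\<alpha> + 1)" using \<alpha> by (intro divide_nonneg_pos Gamma_real_pos) auto
  ultimately show ?thesis
    using A B by (simp add: nn_integral_queue_length[OF t] nn_integral_hitting_time_eq[OF t]
        nn_integral_occupation[OF t empty_prob_measurable] ennreal_mult[symmetric] A_def)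
qed

definition gamma_integral :: "real \<Rightarrow> nat \<Rightarrow> real" where
  "gamma_integral t N = (\<integral>s. s ^ N / fact N * exp (- (jump_rate * s)) \<partial>occupation t)"

lemma gamma_integral_eq:
  assumes "0 \<le> t"
  shows "gamma_integral t N = t powr (\<alpha> * real (Suc N) + 1 - 1) *
    mittag_leffler3 (real (Suc N)) \<alpha> (\<alpha> * real (Suc N) + 1) (- jump_rate * t powr \<alpha>)"
  unfolding gamma_integral_def using assms jump_rate_pos by (intro occupation_gamma_density(2)) auto

lemma gamma_integral_nonneg:
  assumes t: "0 \<le> t" shows "0 \<le> gamma_integral t N"
  unfolding gamma_integral_def
  by (intro integral_nonneg_AE eventually_mono[OF AE_occupation_pos[OF t]]) auto

lemma nn_integral_empty_prob_occupation:
  assumes t: "0 \<le> t"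
  shows "(\<integral>\<^sup>+s. ennreal (empty_prob s 0) \<partial>occupation t) = (\<Sum>N. ennreal (empty_coeff N 0 * gamma_integral t N))"
    and "(\<integral>\<^sup>+s. ennreal (empty_prob s 0) \<partial>occupation t) < \<infinity>"
proof -
  let ?\<nu> = "occupation t"
  let ?g = "\<lambda>N s. s ^ N / fact N * exp (- (jump_rate * s))"
  have int: "integrable (?\<nu>) (?g N)" for N
    using t jump_rate_pos by (intro occupation_gamma_density(1)) auto
  have "(\<integral>\<^sup>+s. ennreal (empty_prob s 0) \<partial>?\<nu>) =
      (\<integral>\<^sup>+s. (\<Sum>N. ennreal (empty_coeff N 0) * ennreal (?g N s)) \<partial>?\<nu>)"
    by (intro nn_integral_cong_AE eventually_mono[OF AE_occupation_pos[OF t]] empty_prob_origin_suminf) auto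
  also have "\<dots> = (\<Sum>N. \<integral>\<^sup>+s. ennreal (empty_coeff N 0) * ennreal (?g N s) \<partial>?\<nu>)"
    using borel_measurable_integrable[OF int] by (intro nn_integral_suminf) auto
  also have "\<dots> = (\<Sum>N. ennreal (empty_coeff N 0 * gamma_integral t N))"
  proof (intro suminf_cong)
    fix N
    have "(\<integral>\<^sup>+s. ennreal (empty_coeff N 0) * ennreal (?g N s) \<partial>?\<nu>) =
        ennreal (empty_coeff N 0) * (\<integral>\<^sup>+s. ennreal (?g N s) \<partial>?\<nu>)"
      using borel_measurable_integrable[OF int] by (intro nn_integral_cmult) auto
    also have "(\<integral>\<^sup>+s. ennreal (?g N s) \<partial>?\<nu>) = ennreal (gamma_integral t N)"
      unfolding gamma_integral_def
      by (intro nn_integral_eq_integral int eventually_mono[OF AE_occupation_pos[OF t]]) auto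
    also have "ennreal (empty_coeff N 0) * ennreal (gamma_integral t N) = ennreal (empty_coeff N 0 * gamma_integral t N)"
      by (rule ennreal_mult[OF empty_coeff_nonneg gamma_integral_nonneg[OF t], symmetric])
    finally show "(\<integral>\<^sup>+s. ennreal (empty_coeff N 0) * ennreal (?g N s) \<partial>?\<nu>) =
        ennreal (empty_coeff N 0 * gamma_integral t N)" .
  qed
  finally show "(\<integral>\<^sup>+s. ennreal (empty_prob s 0) \<partial>?\<nu>) = (\<Sum>N. ennreal (empty_coeff N 0 * gamma_integral t N))" .
  have "(\<integral>\<^sup>+s. ennreal (empty_prob s 0) \<partial>?\<nu>) \<le> (\<integral>\<^sup>+s. ennreal (s ^ 0) \<partial>?\<nu>)"
  proof (rule nn_integral_mono_AE, rule eventually_mono[OF AE_occupation_pos[OF t]])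
    fix s :: real assume "0 < s"
    then show "ennreal (empty_prob s 0) \<le> ennreal (s ^ 0)"
      using empty_prob_le_1[of s 0] by (intro ennreal_leI) simp
  qed
  also have "\<dots> < \<infinity>" unfolding occupation_moment[OF t] by simp
  finally show "(\<integral>\<^sup>+s. ennreal (empty_prob s 0) \<partial>?\<nu>) < \<infinity>" .
qed

definition series_term :: "real \<Rightarrow> nat \<Rightarrow> nat \<Rightarrow> real" where
  "series_term t h n = (\<Sum>m\<in>multi_indices l n. C0 k l mu lam h n m * gamma_integral t (gamma0 k l h n m - 1))"

lemma series_term_eq:
  assumes "0 \<le> t" "1 \<le> h"
  shows "series_term t h n = (\<Sum>m\<in>multi_indices l n.
    C0 k l mu lam h n m * t powr (betaM k l \<alpha> h n m - 1) *
    mittag_leffler3 (real (gamma0 k l h n m)) \<alpha> (betaM k l \<alpha> h n m)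
      (- (total_rate l lam + real k * mu) * t powr \<alpha>))"
  unfolding series_term_def
proof (intro sum.cong refl)
  fix m
  have "Suc (gamma0 k l h n m - 1) = gamma0 k l h n m" using assms(2) by (simp add: gamma0_def)
  then show "C0 k l mu lam h n m * gamma_integral t (gamma0 k l h n m - 1) =
    C0 k l mu lam h n m * t powr (betaM k l \<alpha> h n m - 1) *
    mittag_leffler3 (real (gamma0 k l h n m)) \<alpha> (betaM k l \<alpha> h n m)
      (- (total_rate l lam + real k * mu) * t powr \<alpha>)"
    unfolding gamma_integral_eq[OF assms(1)] by (simp add: betaM_def jump_rate_def)
qed

lemma series_term_sums:
  assumes t: "0 \<le> t"
  shows "\<And>h. 1 \<le> h \<Longrightarrow> summable (series_term t h)"
    and "summable (\<lambda>h. \<Sum>n. series_term t (Suc h) n)"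
    and "ennreal (\<Sum>h. \<Sum>n. series_term t (Suc h) n) = (\<integral>\<^sup>+s. ennreal (empty_prob s 0) \<partial>occupation t)"
    and "0 \<le> (\<Sum>h. \<Sum>n. series_term t (Suc h) n)"
proof -
  have nn: "0 \<le> series_term t h n" for h n
    unfolding series_term_def by (intro sum_nonneg mult_nonneg_nonneg C0_nonneg gamma_integral_nonneg[OF t])
  have total: "(\<Sum>h. \<Sum>n. ennreal (series_term t (Suc h) n)) = (\<integral>\<^sup>+s. ennreal (empty_prob s 0) \<partial>occupation t)"
    unfolding series_term_def nn_integral_empty_prob_occupation(1)[OF t]
    by (rule sum_C0_regroup[OF gamma_integral_nonneg[OF t]])
  have finite: "(\<Sum>h. \<Sum>n. ennreal (series_term t (Suc h) n)) < \<top>"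
    unfolding total using nn_integral_empty_prob_occupation(2)[OF t] by simp
  have inner: "(\<Sum>n. ennreal (series_term t (Suc h) n)) \<noteq> \<top>" for h
  proof -
    have "(\<Sum>n. ennreal (series_term t (Suc h) n)) \<le> (\<Sum>h. \<Sum>n. ennreal (series_term t (Suc h) n))"
      using sum_le_suminf[of "\<lambda>h. \<Sum>n. ennreal (series_term t (Suc h) n)" "{h}"] by (simp add: summableI)
    then show ?thesis using finite by (auto simp: top_unique)
  qed
  show "summable (series_term t h)" if "1 \<le> h" for h
    using ennreal_suminf_finite_summable(1)[OF nn inner[of "h - 1"]] that by simp
  have eq: "(\<Sum>n. ennreal (series_term t (Suc h) n)) = ennreal (\<Sum>n. series_term t (Suc h) n)" for h
    using ennreal_suminf_finite_summable(2)[OF nn inner] by simp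
  have inner_nn: "0 \<le> (\<Sum>n. series_term t (Suc h) n)" for h
    by (intro suminf_nonneg nn ennreal_suminf_finite_summable(1)[OF nn inner])
  have fin': "(\<Sum>h. ennreal (\<Sum>n. series_term t (Suc h) n)) \<noteq> \<top>" using finite by (simp add: eq)
  show s: "summable (\<lambda>h. \<Sum>n. series_term t (Suc h) n)"
    by (rule ennreal_suminf_finite_summable(1)[OF inner_nn fin'])
  show "ennreal (\<Sum>h. \<Sum>n. series_term t (Suc h) n) = (\<integral>\<^sup>+s. ennreal (empty_prob s 0) \<partial>occupation t)"
    using ennreal_suminf_finite_summable(2)[OF inner_nn fin'] by (simp add: total[symmetric] eq)
  show "0 \<le> (\<Sum>h. \<Sum>n. series_term t (Suc h) n)" by (rule suminf_nonneg[OF s inner_nn])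
qed

lemma queue_length_expectation:
  assumes t: "0 \<le> t"
  shows "integrable M (\<lambda>\<omega>. real (queue_length k Q\<alpha> t \<omega>))"
    and "(\<integral>\<omega>. real (queue_length k Q\<alpha> t \<omega>) \<partial>M) = drift * (t powr \<alpha> / Gamma (\<alpha> + 1)) +
      real k * mu * (\<Sum>h. \<Sum>n. series_term t (Suc h) n)"
proof -
  let ?L = "\<lambda>\<omega>. real (queue_length k Q\<alpha> t \<omega>)"
  define e where "e = t powr \<alpha> / Gamma (\<alpha> + 1)"
  define A where "A = real k * (\<Sum>m=1..l. real m * lam m)"
  define \<Sigma> where "\<Sigma> = (\<Sum>h. \<Sum>n. series_term t (Suc h) n)"
  have drift_eq: "drift = A - real k * mu" by (simp add: drift_def A_def)
  have e: "0 \<le> e" unfolding e_def using \<alpha> by (intro divide_nonneg_pos Gamma_real_pos) auto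
  have A: "0 \<le> A" unfolding A_def using lam
    by (intro mult_nonneg_nonneg sum_nonneg) (auto intro: less_imp_le)
  have \<Sigma>: "0 \<le> \<Sigma>" unfolding \<Sigma>_def by (rule series_term_sums(4)[OF t])
  have B: "0 \<le> real k * mu" using mu by simp
  have balance: "(\<integral>\<^sup>+\<omega>. ennreal (?L \<omega>) \<partial>M) + ennreal (real k * mu * e) = ennreal (A * e + real k * mu * \<Sigma>)"
  proof -
    have "ennreal (A * e) + ennreal (real k * mu) * ennreal \<Sigma> = ennreal (A * e + real k * mu * \<Sigma>)"
      using A B e \<Sigma> by (simp add: ennreal_mult[symmetric])
    then show ?thesis
      using nn_integral_queue_length_balance[OF t, folded e_def A_def]
      unfolding series_term_sums(3)[OF t, symmetric] \<Sigma>_def[symmetric] by simp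
  qed
  then have "(\<integral>\<^sup>+\<omega>. ennreal (?L \<omega>) \<partial>M) < \<top>"
    by (metis ennreal_add_eq_top ennreal_neq_top less_top)
  then show int: "integrable M ?L"
    using queue_length_measurable[OF t] by (intro integrableI_nonneg) auto
  have "ennreal ((\<integral>\<omega>. ?L \<omega> \<partial>M) + real k * mu * e) = ennreal (A * e + real k * mu * \<Sigma>)"
    using balance B e by (subst (asm) nn_integral_eq_integral[OF int]) (simp_all add: ennreal_plus)
  then have "(\<integral>\<omega>. ?L \<omega> \<partial>M) + real k * mu * e = A * e + real k * mu * \<Sigma>"
    using A B e \<Sigma> by (subst (asm) ennreal_inj) auto
  then show "(\<integral>\<omega>. ?L \<omega> \<partial>M) = drift * (t powr \<alpha> / Gamma (\<alpha> + 1)) +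
      real k * mu * (\<Sum>h. \<Sum>n. series_term t (Suc h) n)"
    unfolding e_def[symmetric] \<Sigma>_def[symmetric] drift_eq by (simp add: algebra_simps)
qed

lemma AE_start_empty: "AE \<omega> in M. queue_length k Q\<alpha> 0 \<omega> = 0"
proof -
  have "(\<integral>\<^sup>+\<omega>. ennreal (hitting_time D 0 \<omega>) \<partial>M) = 0"
    using nn_integral_hitting_time_eq[of 0] by simp
  then have "AE \<omega> in M. ennreal (hitting_time D 0 \<omega>) = 0"
    using hitting_measurable[of 0] by (subst (asm) nn_integral_0_iff_AE) auto
  with Q_start show ?thesis
  proof eventually_elim
    case (elim \<omega>)
    then have "hitting_time D 0 \<omega> = 0" using hitting_time_nonneg[of 0 \<omega>] by (simp add: ennreal_eq_0_iff)
    then show ?case using elim by (simp add: queue_length_def time_changed_def)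
  qed
qed

lemma mean_queue_length_eq_expectation:
  assumes t: "0 \<le> t"
  shows "mean_queue_length M k Q\<alpha> t = (\<integral>\<omega>. real (queue_length k Q\<alpha> t \<omega>) \<partial>M)"
proof -
  define A where "A = {\<omega>\<in>space M. queue_length k Q\<alpha> 0 \<omega> = 0}"
  have [measurable]: "(\<lambda>\<omega>. real (queue_length k Q\<alpha> 0 \<omega>)) \<in> borel_measurable M"
    "(\<lambda>\<omega>. real (queue_length k Q\<alpha> t \<omega>)) \<in> borel_measurable M"
    using queue_length_measurable t by auto
  have A_eq: "A = {\<omega>\<in>space M. real (queue_length k Q\<alpha> 0 \<omega>) = 0}" by (simp add: A_def)
  have [measurable]: "A \<in> sets M" unfolding A_eq by measurable
  have AE: "AE \<omega> in M. \<omega> \<in> A" using AE_start_empty AE_space by eventually_elim (simp add: A_def)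
  then have "measure M A = 1" by (simp add: prob_eq_1)
  moreover have "(LINT \<omega>:A|M. real (queue_length k Q\<alpha> t \<omega>)) = (\<integral>\<omega>. real (queue_length k Q\<alpha> t \<omega>) \<partial>M)"
    unfolding set_lebesgue_integral_def using AE by (intro integral_cong_AE) auto
  ultimately show ?thesis unfolding mean_queue_length_def A_def[symmetric] by simp
qed

end

theorem theorem3p6:
  fixes M :: "'a measure" and k l :: nat and mu \<alpha> t :: real and lam :: "nat \<Rightarrow> real"
    and Q :: "real \<Rightarrow> 'a \<Rightarrow> nat \<times> nat" and D :: "real \<Rightarrow> 'a \<Rightarrow> real"
  assumes "prob_space M"
    and "1 \<le> k" and "1 \<le> l" and "0 < mu" and "\<And>m. m \<in> {1..l} \<Longrightarrow> 0 < lam m"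
    and "0 < \<alpha>" and "\<alpha> < 1"
    and "erlang_queue M k l mu lam Q"
    and "stable_subordinator M \<alpha> D"
    and "independent_processes M (count_space (erlang_states k)) Q borel (hitting_time D)"
    and "0 \<le> t"
  shows
    "let Q\<alpha> = time_changed Q (hitting_time D);
         a = (\<lambda>h n. \<Sum>m\<in>multi_indices l n.
                C0 k l mu lam h n m * t powr (betaM k l \<alpha> h n m - 1) *
                mittag_leffler3 (real (gamma0 k l h n m)) \<alpha> (betaM k l \<alpha> h n m)
                  (- (total_rate l lam + real k * mu) * t powr \<alpha>))
     in integrable M (\<lambda>\<omega>. real (queue_length k Q\<alpha> t \<omega>)) \<and>
        (\<forall>h\<ge>1. summable (a h)) \<and>
        summable (\<lambda>h. \<Sum>n. a (Suc h) n) \<and>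
        mean_queue_length M k Q\<alpha> t =
          real k * (total_rate l lam * (\<Sum>i=1..l. real i * arrival_prob l lam i) - mu) *
            (t powr \<alpha> / Gamma (\<alpha> + 1)) +
          real k * mu * (\<Sum>h. \<Sum>n. a (Suc h) n)"
proof -
  interpret prob_space M by fact
  interpret erlang_parameters k l mu lam by unfold_locales (use assms in auto)
  have markov: "markov_process M (erlang_states k) (erlang_rate k l mu lam) Q"
    and start: "AE \<omega> in M. Q 0 \<omega> = (0, 0)"
    using assms by (auto simp: erlang_queue_def)
  from markov obtain p where p: "transition_function (erlang_states k) p"
    "has_transition_rates (erlang_states k) p (erlang_rate k l mu lam)"
    and cond: "\<forall>t\<ge>0. \<forall>h\<ge>0. \<forall>x\<in>erlang_states k. \<forall>y\<in>erlang_states k. \<forall>J z. finite J \<and> J \<subseteq> {0..<t} \<and>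
       measure M {\<omega>\<in>space M. Q t \<omega> = x \<and> (\<forall>u\<in>J. Q u \<omega> = z u)} > 0 \<longrightarrow>
       \<P>(\<omega> in M. Q (t + h) \<omega> = y \<bar> Q t \<omega> = x \<and> (\<forall>u\<in>J. Q u \<omega> = z u)) = p h x y"
    unfolding markov_process_def by (elim conjE exE) (rule that)
  have Qm: "\<And>u. 0 \<le> u \<Longrightarrow> Q u \<in> measurable M (count_space (erlang_states k))"
    and Qr: "\<And>\<omega> u. \<omega> \<in> space M \<Longrightarrow> 0 \<le> u \<Longrightarrow> \<forall>\<^sub>F s in at_right u. Q s \<omega> = Q u \<omega>"
    using markov by (auto simp: markov_process_def)
  have origin: "(0, 0) \<in> erlang_states k" by (simp add: erlang_states_def)
  have prob_start: "measure M {\<omega>\<in>space M. Q 0 \<omega> = (0, 0)} = 1"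
  proof -
    have [measurable]: "Q 0 \<in> measurable M (count_space UNIV)"
      using measurable_compose[OF Qm[of 0], of "\<lambda>x. x" "count_space UNIV"] by simp
    show ?thesis using start by (subst prob_Collect_eq_1) auto
  qed
  interpret time_changed_erlang k l mu lam p M \<alpha> D Q
  proof unfold_locales
    show "\<P>(\<omega> in M. Q h \<omega> = y \<bar> Q 0 \<omega> = (0, 0)) = p h (0, 0) y" if "0 \<le> h" "y \<in> erlang_states k" for h y
      using cond[rule_format, of 0 h "(0, 0)" y "{}"] that origin prob_start by simp
    show "hitting_time D u \<in> borel_measurable M" if "0 \<le> u" for u
      using assms(10) that by (auto simp: independent_processes_def)
  qed (use assms p start Qm Qr in auto)
  define a where "a h n = (\<Sum>m\<in>multi_indices l n.
                C0 k l mu lam h n m * t powr (betaM k l \<alpha> h n m - 1) *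
                mittag_leffler3 (real (gamma0 k l h n m)) \<alpha> (betaM k l \<alpha> h n m)
                  (- (total_rate l lam + real k * mu) * t powr \<alpha>))" for h n
  have a_eq: "a h = series_term t h" if "1 \<le> h" for h
    using series_term_eq[OF assms(11) that] by (auto simp: a_def fun_eq_iff)
  have drift: "real k * (total_rate l lam * (\<Sum>i=1..l. real i * arrival_prob l lam i) - mu) = drift"
    using total_rate_pos by (simp add: drift_def arrival_prob_def sum_distrib_left algebra_simps)
  show ?thesis
    using queue_length_expectation[OF assms(11)] series_term_sums(1,2)[OF assms(11)]
    unfolding Let_def drift mean_queue_length_eq_expectation[OF assms(11)] a_def[abs_def, symmetric]
    by (simp add: a_eq)
qed

end
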